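(* Let $k>\frac{4\pi}{\pi-\sqrt{16-\pi^2}}\approx18.88$ with $\sigma_k:=\min_{\xi\in\pi\mathbb N}|k-\xi|>0$, let $p\ge2$ be an integer, $f\in H_0^p(0,1)$ with $f_{\mathrm{low}}\ne0$, and $g_0=g_1=0$. Let there be given a sequence of mesh sizes $h=\frac1N$ going to zero and a constant $C_\mu$ such that $0<\frac{kh}2\le C_\mu\le\frac34$ for every $h$ in the sequence and $$\tilde\sigma_k:=\inf_{\xi,h}\left|k-\frac2h\sin\frac{\xi h}2\right|>0,$$ the infimum being over $\xi\in\{1,\dots,N-1\}\pi$ and all $h=1/N$ in the sequence. Then for every $h$ in the sequence the finite difference scheme has a unique solution $u^h$. Moreover, $$\frac{\|u-u^h\|}{\|u\|}\le\left(\frac{(kh)^p}{\pi^p}+\frac{2k(kh)^{p-2}}{\tilde\sigma_k\pi^{p-2}}\right)\frac{k^{-p}|f_{\mathrm{high}}|_p}{\|f_{\mathrm{low}}\|}+\frac{\|E_1^h\|}{\|u\|},$$ $$\frac{|u-u^h|_1}{|u|_1}\le\left(\frac{(kh)^{p-1}}{\pi^{p-1}}+\frac{k(kh)^{p-2}}{\tilde\sigma_k\pi^{p-3}}\right)\frac{k^{-p}|f_{\mathrm{high}}|_p}{k^{-1}|f_{\mathrm{low}}|_1}+\frac{|E_1^h|_1}{|u|_1},$$ and equality is attained when $f_{\mathrm{high}}=0$. In turn, $E_1^h$ satisfies $$\frac{\|E_1^h\|}{\|u\|}\le\frac{k^{-2}|u_{\mathrm{low}}|_2}{\|u\|}\,k^2C_{rel}(k,h),\qquad\frac{|E_1^h|_1}{|u|_1}\le\frac{k^{-3}|u_{\mathrm{low}}|_3}{k^{-1}|u|_1}\,k^2C_{rel}(k,h),$$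 where the upper bounds are attained when $\hat f(\xi)=0$ for all $\xi\in\{1,\dots,N-1\}\pi$ but one (suitable one) of $k_\pm^h$, and there exist positive constants $c_{rel}$ and $\tilde C_{rel}$ independent of $k$, $\tilde\sigma_\pm^h$ and $h$ such that $$c_{rel}\,\frac{k^3h^2}{\tilde\sigma_k^h}<k^2C_{rel}(k,h)<\tilde C_{rel}\,\frac{k^3h^2}{\tilde\sigma_k^h}.$$ In particular, when the upper bounds for $E_1^h$ relative to $u$ are attained, e.g. for $f(x)=2\sin(k_\pm^hx)$ (with the suitable sign), one has $$u=\frac{f}{k^2-(k_\pm^h)^2},\qquad\|u\|=\frac{\|f\|}{|k^2-(k_\pm^h)^2|},\qquad|u|_p=|u_{\mathrm{low}}|_p=\frac{\|f\|(k_\pm^h)^p}{|k^2-(k_\pm^h)^2|},$$ and hence the exact order of the relative errors is $k^3h^2/\tilde\sigma_k^h$, more precisely $$\frac{\|E_1^h\|}{\|u\|}=\frac{|E_1^h|_1}{|u|_1}=(k_\pm^h)^2C_{rel}(k,h)\in\frac{(k_\pm^h)^2kh^2}{\tilde\sigma_k^h}\,(c_{rel},\tilde C_{rel}).$$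
   Context: The continuous problem is $u''+k^2u=f$ in $(0,1)$, $u(0)=u(1)=0$. The scheme on the grid $x_j=jh$, $j=0,\dots,N$, $Nh=1$, is $$\left(k^2-\tfrac2{h^2}\right)u^h(x_j)+\tfrac1{h^2}u^h(x_{j-1})+\tfrac1{h^2}u^h(x_{j+1})=f(x_j)\ (1\le j\le N-1),\qquad u^h(x_0)=u^h(x_N)=0.$$ The grid solution is extended to $x\in(0,1)$ by sine interpolation: $u^h(x)=\sum_{\xi/\pi=1}^{N-1}\widehat{u^h}(\xi)\sin(\xi x)$, $\widehat{u^h}(\xi)=2\sum_{j=1}^{N-1}h\sin(\xi x_j)u^h(x_j)$. (Sums $\sum_{\xi/\pi=a}^{b}$ run over $\xi\in\pi\mathbb Z$ with $a\le\xi/\pi\le b$.) Notation: $\hat v(\xi)=2\int_0^1v(x)\sin(\xi x)\,dx$; $v_{\mathrm{low}}=\sum_{\xi/\pi=1}^{N-1}\hat v(\xi)\sin(\xi x)$ and $v_{\mathrm{high}}=\sum_{\xi/\pi=N}^\infty\hat v(\xi)\sin(\xi x)$ for $v=f$ or $v=u$. $\|v\|$ is the $L^2(0,1)$-norm and $|v|_p:=\|v^{(p)}\|$. $\lambda(\xi):=k^2-\xi^2$, $\lambda^h(\xi):=k^2-\frac4{h^2}\sin^2\frac{\xi h}2$, and $$E_1^h(x):=\sum_{\xi/\pi=1}^{N-1}\left(\frac1{\lambda(\xi)}-\frac1{\lambda^h(\xi)}\right)\hat f(\xi)\sin(\xi x),\qquad C_{rel}(k,h):=\max_{\xi\in\{1,\dots,N-1\}\pi}\left|\frac{\lambda(\xi)-\lambda^h(\xi)}{\xi^2\lambda^h(\xi)}\right|.$$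 $k^h:=\frac2h\arcsin\frac{kh}2$; $k_\pm^h\in\pi\mathbb N$ are such that $k_-^h<k^h<k_+^h$ and $k_+^h-k_-^h=\pi$; $\tilde\sigma_\pm^h:=\left|k-\frac2h\sin\frac{k_\pm^hh}2\right|$; $\tilde\sigma_k^h:=\min\{\tilde\sigma_-^h,\tilde\sigma_+^h\}$. *)

theory Defs
  imports "HOL-Analysis.Analysis"
begin

text \<open>Functions on $(0,1)$ are represented by functions on the whole real line of which only the
  values on $(0,1)$ (or $[0,1]$, where boundary values are needed) are used.\<close>

definition L2_fun :: "(real \<Rightarrow> real) \<Rightarrow> bool" where
  "L2_fun v \<longleftrightarrow> set_borel_measurable lborel {0<..<1} v \<and>
     set_integrable lborel {0<..<1} (\<lambda>x. (v x)\<^sup>2)"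

definition L2_norm :: "(real \<Rightarrow> real) \<Rightarrow> real" where
  "L2_norm v = sqrt (LBINT x:{0<..<1}. (v x)\<^sup>2)"

definition test_fun :: "(real \<Rightarrow> real) \<Rightarrow> bool" where
  "test_fun \<phi> \<longleftrightarrow> (\<forall>n x. (deriv ^^ n) \<phi> differentiable (at x)) \<and>
     (\<exists>K. compact K \<and> K \<subseteq> {0<..<1} \<and> (\<forall>x. x \<notin> K \<longrightarrow> \<phi> x = 0))"

definition weak_deriv :: "nat \<Rightarrow> (real \<Rightarrow> real) \<Rightarrow> (real \<Rightarrow> real) \<Rightarrow> bool" where
  "weak_deriv p v w \<longleftrightarrow> L2_fun v \<and> L2_fun w \<and>
     (\<forall>\<phi>. test_fun \<phi> \<longrightarrow>
        (LBINT x:{0<..<1}. v x * (deriv ^^ p) \<phi> x) = (- 1) ^ p * (LBINT x:{0<..<1}. w x * \<phi> x))"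

text \<open>The seminorm $|v|_p = \|v^{(p)}\|$; weak derivatives are unique almost everywhere, so the
  choice of the representative is immaterial.\<close>

definition seminorm :: "nat \<Rightarrow> (real \<Rightarrow> real) \<Rightarrow> real" where
  "seminorm p v = L2_norm (SOME w. weak_deriv p v w)"

definition sobolev :: "nat \<Rightarrow> (real \<Rightarrow> real) \<Rightarrow> bool" where
  "sobolev p v \<longleftrightarrow> (\<forall>j\<le>p. \<exists>w. weak_deriv j v w)"

definition sobolev_norm :: "nat \<Rightarrow> (real \<Rightarrow> real) \<Rightarrow> real" where
  "sobolev_norm p v = sqrt (\<Sum>j\<le>p. (seminorm j v)\<^sup>2)"

text \<open>$H_0^p(0,1)$ is the closure of the test functions in $H^p(0,1)$.\<close>

definition sobolev0 :: "nat \<Rightarrow> (real \<Rightarrow> real) \<Rightarrow> bool" where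
  "sobolev0 p v \<longleftrightarrow> sobolev p v \<and>
     (\<forall>\<epsilon>>0. \<exists>\<phi>. test_fun \<phi> \<and> sobolev_norm p (\<lambda>x. v x - \<phi> x) < \<epsilon>)"

definition sine_coeff :: "(real \<Rightarrow> real) \<Rightarrow> real \<Rightarrow> real" where
  "sine_coeff v \<xi> = 2 * (LBINT x:{0<..<1}. v x * sin (\<xi> * x))"

definition low_freqs :: "nat \<Rightarrow> real set" where
  "low_freqs N = (\<lambda>m. real m * pi) ` {1..<N}"

definition low_part :: "nat \<Rightarrow> (real \<Rightarrow> real) \<Rightarrow> real \<Rightarrow> real" where
  "low_part N v x = (\<Sum>\<xi>\<in>low_freqs N. sine_coeff v \<xi> * sin (\<xi> * x))"

text \<open>The series below is read pointwise; for elements of $H_0^p(0,1)$ with $p \ge 1$ it converges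
  absolutely and uniformly, so that its pointwise and its $L^2$ sum agree.\<close>

definition high_part :: "nat \<Rightarrow> (real \<Rightarrow> real) \<Rightarrow> real \<Rightarrow> real" where
  "high_part N v x =
     (\<Sum>m. sine_coeff v (real (N + m) * pi) * sin (real (N + m) * pi * x))"

text \<open>Solutions are taken in the classical sense; for continuous $f \in L^2(0,1)$ this agrees with the weak
  notion, once $u$ is identified with its continuous representative.\<close>

definition helmholtz_sol :: "real \<Rightarrow> (real \<Rightarrow> real) \<Rightarrow> (real \<Rightarrow> real) \<Rightarrow> bool" where
  "helmholtz_sol k f u \<longleftrightarrow> continuous_on {0..1} u \<and> u 0 = 0 \<and> u 1 = 0 \<and>
     (\<exists>u' u''. \<forall>x\<in>{0<..<1}. (u has_real_derivative u' x) (at x) \<and>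
        (u' has_real_derivative u'' x) (at x) \<and> u'' x + k\<^sup>2 * u x = f x)"

abbreviation mesh :: "nat \<Rightarrow> real" where
  "mesh N \<equiv> 1 / real N"

text \<open>The right-hand side is evaluated at grid points, so \<open>f\<close> is meant to be the continuous
  representative of its $L^2$ class.\<close>

definition fd_sol :: "real \<Rightarrow> (real \<Rightarrow> real) \<Rightarrow> nat \<Rightarrow> (nat \<Rightarrow> real) \<Rightarrow> bool" where
  "fd_sol k f N U \<longleftrightarrow> U 0 = 0 \<and> U N = 0 \<and>
     (\<forall>j\<in>{1..<N}. (k\<^sup>2 - 2 / (mesh N)\<^sup>2) * U j + 1 / (mesh N)\<^sup>2 * U (j - 1)
        + 1 / (mesh N)\<^sup>2 * U (j + 1) = f (real j * mesh N))"

definition grid_sine_coeff :: "nat \<Rightarrow> (nat \<Rightarrow> real) \<Rightarrow> real \<Rightarrow> real" where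
  "grid_sine_coeff N U \<xi> = 2 * (\<Sum>j\<in>{1..<N}. mesh N * sin (\<xi> * (real j * mesh N)) * U j)"

definition sine_interp :: "nat \<Rightarrow> (nat \<Rightarrow> real) \<Rightarrow> real \<Rightarrow> real" where
  "sine_interp N U x = (\<Sum>\<xi>\<in>low_freqs N. grid_sine_coeff N U \<xi> * sin (\<xi> * x))"

definition symb :: "real \<Rightarrow> real \<Rightarrow> real" where
  "symb k \<xi> = k\<^sup>2 - \<xi>\<^sup>2"

definition symb_h :: "real \<Rightarrow> nat \<Rightarrow> real \<Rightarrow> real" where
  "symb_h k N \<xi> = k\<^sup>2 - 4 / (mesh N)\<^sup>2 * (sin (\<xi> * mesh N / 2))\<^sup>2"

definition E1 :: "real \<Rightarrow> nat \<Rightarrow> (real \<Rightarrow> real) \<Rightarrow> real \<Rightarrow> real" where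
  "E1 k N f x = (\<Sum>\<xi>\<in>low_freqs N.
     (1 / symb k \<xi> - 1 / symb_h k N \<xi>) * sine_coeff f \<xi> * sin (\<xi> * x))"

definition C_rel :: "real \<Rightarrow> nat \<Rightarrow> real" where
  "C_rel k N = Max ((\<lambda>\<xi>. \<bar>(symb k \<xi> - symb_h k N \<xi>) / (\<xi>\<^sup>2 * symb_h k N \<xi>)\<bar>) ` low_freqs N)"

text \<open>The minimum over $\pi\mathbb{N}$ exists, hence coincides with the infimum.\<close>

definition sigma_k :: "real \<Rightarrow> real" where
  "sigma_k k = (INF m\<in>{1::nat..}. \<bar>k - real m * pi\<bar>)"

definition sigma_h :: "real \<Rightarrow> nat \<Rightarrow> real \<Rightarrow> real" where
  "sigma_h k N \<xi> = \<bar>k - 2 / mesh N * sin (\<xi> * mesh N / 2)\<bar>"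

definition sigma_seq :: "real \<Rightarrow> (nat \<Rightarrow> nat) \<Rightarrow> real" where
  "sigma_seq k Ns = (INF (n, \<xi>)\<in>(SIGMA n:UNIV. low_freqs (Ns n)). sigma_h k (Ns n) \<xi>)"

definition k_h :: "real \<Rightarrow> nat \<Rightarrow> real" where
  "k_h k N = 2 / mesh N * arcsin (k * mesh N / 2)"

text \<open>The consecutive elements of $\pi\mathbb{N}$ strictly enclosing $k^h$; they exist (and are then
  unique) whenever $k^h > \pi$ is not itself a multiple of $\pi$.\<close>

definition k_minus :: "real \<Rightarrow> nat \<Rightarrow> real" where
  "k_minus k N = (THE \<xi>. (\<exists>m::nat. m \<ge> 1 \<and> \<xi> = real m * pi) \<and> \<xi> < k_h k N \<and> k_h k N < \<xi> + pi)"

definition k_plus :: "real \<Rightarrow> nat \<Rightarrow> real" where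
  "k_plus k N = k_minus k N + pi"

definition sigma_min :: "real \<Rightarrow> nat \<Rightarrow> real" where
  "sigma_min k N = min (sigma_h k N (k_minus k N)) (sigma_h k N (k_plus k N))"

end

theory Submission
  imports Defs
begin

text \<open>
  Everything is read off in frequency space. By uniqueness for the boundary value problem,
  \<open>u\<close> is the sine series with coefficients $\hat f(\xi)/\lambda(\xi)$, and by discrete orthogonality
  the interpolated grid solution has coefficients $\hat f_h(\xi)/\lambda^h(\xi)$, where $\hat f_h$ is the
  discrete sine transform of the grid values of \<open>f\<close>. For low $\xi$ one has
  $\hat f_h = \hat f + P$, the aliasing term \<open>P\<close> collecting the high coefficients of \<open>f\<close> that look like
  $\xi$ on the grid. Hence the error is the sum of three sine series: the high part of \<open>u\<close>, the
  function $E_1^h$, and $-P/\lambda^h$ (\<open>error_series\<close>).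

  The first and the third are bounded by $|f_{high}|_p$. Dividing by $\lambda$ costs at most the gap
  $\Lambda = (N\pi)^2 - k^2$ on low frequencies and gains at least $\Lambda$ on high ones, so that $\Lambda$ cancels in
  quotients (\<open>low_f_norm_le\<close>, \<open>high_u_norm_le\<close>); aliasing is controlled by Cauchy--Schwarz
  because each block of \<open>N\<close> consecutive frequencies contains at most one alias of a given low frequency
  (\<open>aliasing_sum_bound\<close>), and $1/\lambda^h$ by the resonance distance $\tilde\sigma_k$. When there are no high
  frequencies both terms vanish, whence the equality statements.

  The bounds for $E_1^h$ are the pointwise identity
  $|\widehat{E_1^h}(\xi)| = \xi^2 R(\xi) |\hat u(\xi)|$ with
  $R = |(\lambda-\lambda^h)/(\xi^2\lambda^h)|$, so what matters is where \<open>R\<close> has its maximum. With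
  $t = \xi h/2$ and $\mu = kh/2$, \<open>R\<close> is a multiple of $(1-(\sin t/t)^2)/|\mu^2-\sin^2 t|$. Left of the
  singularity $\sin t = \mu$ this increases. Right of it the numerator is a convex function of
  $\sin^2 t$ and the denominator an affine one, so the quotient is at most the larger of its values at the two
  ends, and for the given range of \<open>k\<close> and $\mu$ the end next to the singularity wins
  (\<open>sinc_quot_le_at_right\<close>). Thus the maximum sits at one of the two frequencies $k_\pm^h$ enclosing $k^h$
  (\<open>C_rel_attained\<close>), where numerator and denominator are comparable to $k^2h^2$ and
  $k\tilde\sigma_\pm^h$ (\<open>rel_symb_err_bounds\<close>).

  The analytic input is that a continuous \<open>f\<close> in $H_0^p$ is the sum of its absolutely convergent sine
  series and that $|f_{high}|_p$ dominates the weighted sum of its high coefficients. The first follows from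
  completeness of the sines (\<open>sines_complete\<close>), the second from Bessel's inequality for the \<open>p\<close>-th weak
  derivative, whose coefficients against the phase-shifted sines $\sin(m\pi x + p\pi/2)$ are
  $(m\pi)^p\hat f(m\pi)$ by approximation with test functions (\<open>weak_deriv_trig_coeff\<close>). Seminorms of functions
  with known derivatives can be computed because weak derivatives are unique (\<open>weak_deriv_unique\<close>), which
  rests on an explicit family of smooth cutoff functions.
\<close>

section \<open>The symbol error as a function of the half angle\<close>

text \<open>The relative symbol error $(\lambda^h-\lambda)/\xi^2$ at $t=\xi h/2$.\<close>

definition sinc_defect :: "real \<Rightarrow> real" where
  "sinc_defect t = 1 - (sin t / t)\<^sup>2"

text \<open>The derivative of \<open>sinc_defect\<close> with respect to $\sin^2 t$; its monotonicity is
  the convexity that locates the maximum of the relative symbol error.\<close>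

definition tan_excess :: "real \<Rightarrow> real" where
  "tan_excess t = (tan t - t) / t ^ 3"

lemma inverse_cos_sq:
  assumes "0 \<le> t" "t < pi / 2"
  shows "cos t \<noteq> 0" "inverse ((cos t)\<^sup>2) = 1 + (tan t)\<^sup>2"
proof -
  have "cos t > 0" using assms by (intro cos_gt_zero_pi) auto
  then show "cos t \<noteq> 0" by simp
  from tan_sec[OF this] show "inverse ((cos t)\<^sup>2) = 1 + (tan t)\<^sup>2" by (simp add: power_inverse)
qed

lemma tan_le_mult_sec:
  assumes "0 \<le> t" "t < pi / 2"
  shows "tan t \<le> t * (1 + (tan t)\<^sup>2)"
proof -
  have c: "cos t > 0" using assms by (intro cos_gt_zero_pi) auto
  have "sin t * cos t \<le> t * 1"
    using assms c sin_x_le_x[of t] by (intro mult_mono) (auto intro: sin_ge_zero)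
  then have "sin t / cos t \<le> t * (1 / (cos t)\<^sup>2)"
    using c by (simp add: field_simps power2_eq_square)
  moreover have "1 + (tan t)\<^sup>2 = 1 / (cos t)\<^sup>2"
    using tan_sec[of t] c by (simp add: power_inverse inverse_eq_divide power_one_over)
  ultimately show ?thesis by (simp add: tan_def)
qed

lemma tan_ge_self: "0 \<le> t \<Longrightarrow> t < pi / 2 \<Longrightarrow> t \<le> tan t"
proof -
  assume "0 \<le> t" "t < pi / 2"
  have "tan 0 - 0 \<le> tan t - t"
  proof (rule DERIV_nonneg_imp_nondecreasing[where f = "\<lambda>t. tan t - t"])
    fix x assume x: "0 \<le> x" "x \<le> t"
    then show "\<exists>y. ((\<lambda>t. tan t - t) has_real_derivative y) (at x) \<and> 0 \<le> y"
      using inverse_cos_sq[of x] \<open>t < pi / 2\<close> by (intro exI[of _ "(tan x)\<^sup>2"])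
        (auto intro!: derivative_eq_intros)
  qed fact
  then show ?thesis by simp
qed

lemma tan_ge_cubic:
  assumes "0 \<le> t" "t < pi / 2"
  shows "t ^ 3 / 3 \<le> tan t - t"
proof -
  have "tan 0 - 0 - 0 ^ 3 / 3 \<le> tan t - t - t ^ 3 / 3"
  proof (rule DERIV_nonneg_imp_nondecreasing[where f = "\<lambda>t. tan t - t - t ^ 3 / 3"])
    fix x assume x: "0 \<le> x" "x \<le> t"
    have "x\<^sup>2 \<le> (tan x)\<^sup>2" using x assms tan_ge_self[of x] by (intro power_mono) auto
    then show "\<exists>y. ((\<lambda>t. tan t - t - t ^ 3 / 3) has_real_derivative y) (at x) \<and> 0 \<le> y"
      using x assms inverse_cos_sq[of x] by (intro exI[of _ "(tan x)\<^sup>2 - x\<^sup>2"])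
        (auto intro!: derivative_eq_intros)
  qed (use assms in auto)
  then show ?thesis by simp
qed

text \<open>The sign of the derivative is that of $t\tan^2 t - 3\tan t + 3t$, which vanishes at
  \<open>0\<close> and has derivative $2\tan t\,(t\sec^2 t - \tan t) \ge 0$.\<close>

lemma tan_excess_mono:
  assumes "0 < a" "a \<le> b" "b < pi / 2"
  shows "tan_excess a \<le> tan_excess b"
proof -
  have q: "0 \<le> t * (tan t)\<^sup>2 - 3 * tan t + 3 * t" if "0 \<le> t" "t < pi / 2" for t
  proof -
    have "0 * (tan 0)\<^sup>2 - 3 * tan 0 + 3 * 0 \<le> t * (tan t)\<^sup>2 - 3 * tan t + 3 * t"
    proof (rule DERIV_nonneg_imp_nondecreasing[where f = "\<lambda>t. t * (tan t)\<^sup>2 - 3 * tan t + 3 * t"])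
      fix x assume x: "0 \<le> x" "x \<le> t"
      have "0 \<le> tan x" using tan_ge_self[of x] x that by linarith
      then have "0 \<le> 2 * tan x * (x * (1 + (tan x)\<^sup>2) - tan x)"
        using tan_le_mult_sec[of x] x that by (intro mult_nonneg_nonneg) auto
      then show "\<exists>y. ((\<lambda>t. t * (tan t)\<^sup>2 - 3 * tan t + 3 * t) has_real_derivative y) (at x) \<and> 0 \<le> y"
        using x that inverse_cos_sq[of x]
        by (intro exI[of _ "2 * tan x * (x * (1 + (tan x)\<^sup>2) - tan x)"] conjI)
          (auto intro!: derivative_eq_intros simp: algebra_simps power2_eq_square simp del: inverse_mult_distrib)
    qed (use that in auto)
    then show ?thesis by simp
  qed
  show ?thesis
  proof (rule DERIV_nonneg_imp_nondecreasing[where f = tan_excess])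
    fix x assume x: "a \<le> x" "x \<le> b"
    have "(tan_excess has_real_derivative (x * (tan x)\<^sup>2 - 3 * tan x + 3 * x) / x ^ 4) (at x)"
    proof -
      have d: "(tan has_real_derivative 1 + (tan x)\<^sup>2) (at x)"
        using DERIV_tan[of x] inverse_cos_sq[of x] x assms by simp
      show ?thesis unfolding tan_excess_def
        by (rule DERIV_cong[OF DERIV_divide[OF DERIV_diff[OF d DERIV_ident] DERIV_pow[of 3]]])
          (use x assms in \<open>simp_all add: field_simps power_def numeral_eq_Suc\<close>)
    qed
    moreover have "0 \<le> (x * (tan x)\<^sup>2 - 3 * tan x + 3 * x) / x ^ 4"
      using q[of x] x assms by (intro divide_nonneg_nonneg) auto
    ultimately show "\<exists>y. (tan_excess has_real_derivative y) (at x) \<and> 0 \<le> y" by blast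
  qed (use assms in auto)
qed

lemma tan_excess_ge_third: "0 < t \<Longrightarrow> t < pi / 2 \<Longrightarrow> 1 / 3 \<le> tan_excess t"
  using tan_ge_cubic[of t] by (simp add: tan_excess_def field_simps)

lemma sinc_defect_deriv:
  assumes "0 < t" "t < pi / 2"
  shows "(sinc_defect has_real_derivative 2 * sin t * cos t * tan_excess t) (at t)"
proof -
  have c: "cos t > 0" using assms by (intro cos_gt_zero_pi) auto
  show ?thesis unfolding sinc_defect_def[abs_def] tan_excess_def tan_def using assms c
    by (auto intro!: derivative_eq_intros simp: field_simps power_def numeral_eq_Suc)
qed

lemma sinc_defect_nonneg: "0 < t \<Longrightarrow> t \<le> pi \<Longrightarrow> 0 \<le> sinc_defect t"
proof -
  assume t: "0 < t" "t \<le> pi"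
  then have "(sin t / t)\<^sup>2 \<le> 1\<^sup>2" using sin_x_le_x[of t] sin_ge_zero[of t]
    by (intro power_mono) (auto simp: field_simps)
  then show ?thesis by (simp add: sinc_defect_def)
qed

text \<open>By \<open>tan_excess_ge_third\<close> the difference of the two sides increases; since the
  formula divides by \<open>t\<close>, its value at \<open>0\<close> is replaced by a limit along $s \to
  0$.\<close>

lemma sinc_defect_ge:
  assumes "0 < t" "t < pi / 2"
  shows "(sin t)\<^sup>2 / 3 \<le> sinc_defect t"
proof -
  have m: "sinc_defect s - (sin s)\<^sup>2 / 3 \<le> sinc_defect t - (sin t)\<^sup>2 / 3" if "0 < s" "s \<le> t" for s
  proof (rule DERIV_nonneg_imp_nondecreasing[where f = "\<lambda>t. sinc_defect t - (sin t)\<^sup>2 / 3"])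
    fix x assume x: "s \<le> x" "x \<le> t"
    have "0 < cos x" "0 < sin x" "1 / 3 \<le> tan_excess x"
      using x that assms tan_excess_ge_third[of x] by (auto intro!: cos_gt_zero_pi sin_gt_zero)
    then have "0 \<le> 2 * sin x * cos x * (tan_excess x - 1 / 3)" by auto
    then show "\<exists>y. ((\<lambda>t. sinc_defect t - (sin t)\<^sup>2 / 3) has_real_derivative y) (at x) \<and> 0 \<le> y"
      using x that assms by (intro exI[of _ "2 * sin x * cos x * (tan_excess x - 1 / 3)"])
        (auto intro!: derivative_eq_intros sinc_defect_deriv simp: algebra_simps)
  qed fact
  have low: "- (s\<^sup>2) \<le> sinc_defect t - (sin t)\<^sup>2 / 3" if "0 < s" "s \<le> t" for s
  proof -
    have "(sin s)\<^sup>2 \<le> s\<^sup>2" using that assms sin_x_le_x[of s] sin_ge_zero[of s] by (intro power_mono) auto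
    moreover have "0 \<le> sinc_defect s" using that assms by (intro sinc_defect_nonneg) auto
    ultimately show ?thesis using m[OF that] zero_le_power2[of s] by linarith
  qed
  have "((\<lambda>s. - (s\<^sup>2)) \<longlongrightarrow> - (0\<^sup>2)) (at_right (0::real))" by (intro tendsto_intros)
  moreover have "eventually (\<lambda>s. - (s\<^sup>2) \<le> sinc_defect t - (sin t)\<^sup>2 / 3) (at_right 0)"
    unfolding eventually_at_right_field using assms low by (intro exI[of _ t]) auto
  ultimately have "- (0\<^sup>2) \<le> sinc_defect t - (sin t)\<^sup>2 / 3"
    by (intro tendsto_upperbound) auto
  then show ?thesis by simp
qed

lemma sinc_defect_le:
  assumes "0 < t" "t < pi / 2"
  shows "sinc_defect t \<le> t\<^sup>2"
proof -
  have "t \<le> tan t" using assms by (intro tan_ge_self) auto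
  moreover have c: "0 < cos t" using assms by (intro cos_gt_zero_pi) auto
  ultimately have 1: "cos t \<le> sin t / t" using assms by (simp add: tan_def field_simps)
  have "(sin (t/2))\<^sup>2 \<le> (t/2)\<^sup>2" using assms sin_x_le_x[of "t/2"] sin_ge_zero[of "t/2"] by (intro power_mono) auto
  then have 2: "1 - t\<^sup>2/2 \<le> cos t" using cos_double_sin[of "t/2"] by (simp add: power_divide)
  have s1: "sin t / t \<le> 1" "0 \<le> sin t / t" using sin_x_le_x[of t] assms sin_ge_zero[of t] by (auto simp: field_simps)
  have "1 - (sin t / t)\<^sup>2 = (1 - sin t / t) * (1 + sin t / t)" by (simp add: algebra_simps power2_eq_square)
  also have "\<dots> \<le> (t\<^sup>2/2) * 2" using 1 2 s1 by (intro mult_mono) auto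
  finally show ?thesis by (simp add: sinc_defect_def)
qed

lemma sinc_defect_mono:
  assumes "0 < a" "a \<le> b" "b \<le> pi / 2"
  shows "sinc_defect a \<le> sinc_defect b"
proof (rule DERIV_nonneg_imp_increasing_open[where f = sinc_defect])
  fix x assume x: "a < x" "x < b"
  have "0 < cos x" "0 < sin x" "1 / 3 \<le> tan_excess x"
    using x assms tan_excess_ge_third[of x] by (auto intro!: cos_gt_zero_pi sin_gt_zero)
  then have "0 \<le> 2 * sin x * cos x * tan_excess x" by auto
  then show "\<exists>y. (sinc_defect has_real_derivative y) (at x) \<and> 0 \<le> y"
    using sinc_defect_deriv[of x] x assms by auto
next
  show "continuous_on {a..b} sinc_defect"
    unfolding sinc_defect_def using assms by (intro continuous_intros) auto
qed fact

text \<open>Jordan's inequality says that $\sin t/t$ is smallest at the right end, i.e. that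
  \<open>sinc_defect\<close> is largest there.\<close>

lemma sin_ge_Jordan:
  assumes "0 \<le> t" "t \<le> pi / 2"
  shows "2 / pi * t \<le> sin t"
proof (cases "t = 0")
  case False
  then have "(2 / pi)\<^sup>2 \<le> (sin t / t)\<^sup>2"
    using sinc_defect_mono[of t "pi/2"] assms by (simp add: sinc_defect_def)
  then have "2 / pi \<le> sin t / t"
    by (rule power2_le_imp_le) (use assms in \<open>auto intro!: divide_nonneg_nonneg sin_ge_zero\<close>)
  then show ?thesis using False assms by (simp add: field_simps)
qed auto

definition sinc_quot :: "real \<Rightarrow> real \<Rightarrow> real" where
  "sinc_quot \<mu> t = sinc_defect t / \<bar>\<mu>\<^sup>2 - (sin t)\<^sup>2\<bar>"

lemma sinc_quot_mono_left:
  assumes "0 < a" "a \<le> b" "b < pi / 2" "sin b < \<mu>"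
  shows "sinc_quot \<mu> a \<le> sinc_quot \<mu> b"
proof -
  have s: "sin a \<le> sin b" using assms by (intro sin_monotone_2pi_le) auto
  have s0: "0 \<le> sin a" "0 \<le> sin b" using assms by (auto intro!: sin_ge_zero)
  have "(sin a)\<^sup>2 \<le> (sin b)\<^sup>2" "(sin b)\<^sup>2 < \<mu>\<^sup>2" using s s0 assms
    by (auto intro!: power_mono power_strict_mono)
  then show ?thesis unfolding sinc_quot_def
    using sinc_defect_mono[of a b] sinc_defect_nonneg[of b] assms by (intro frac_le) auto
qed

text \<open>Let \<open>c\<close> be the value at \<open>t1\<close>. As a function of $\sin^2 t$ the
  difference \<open>H\<close> of numerator and \<open>c\<close> times denominator is convex, and it
  vanishes at \<open>t1\<close>; so it stays nonpositive up to $\pi/2$ once it is nonpositive at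
  $\pi/2$. The hypotheses on $\mu$ and on $\sin t_1$ give the latter.\<close>

lemma sinc_quot_le_at_right:
  assumes \<mu>: "0 < \<mu>" "\<mu> \<le> 3/4" and t1: "0 < t1" "t1 \<le> t" "t < pi / 2"
    and lower: "\<mu> < sin t1" and upper: "sin t1 \<le> \<mu> * (1 + sqrt (1 - \<mu>\<^sup>2) / 5)"
  shows "sinc_quot \<mu> t \<le> sinc_quot \<mu> t1"
proof -
  define c where "c = sinc_quot \<mu> t1"
  define H where "H x = sinc_defect x - c * ((sin x)\<^sup>2 - \<mu>\<^sup>2)" for x
  have pos: "\<mu>\<^sup>2 < (sin x)\<^sup>2" if "t1 \<le> x" "x \<le> pi/2" for x
  proof -
    have "sin t1 \<le> sin x" using that t1 by (intro sin_monotone_2pi_le) auto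
    then show ?thesis using lower \<mu> by (intro power_strict_mono) auto
  qed
  have s2: "\<mu>\<^sup>2 \<le> 9/16" using power_mono[OF \<mu>(2), of 2] \<mu> by (simp add: power_divide)
  have Ht1: "H t1 = 0" using pos[of t1] t1 by (simp add: H_def c_def sinc_quot_def)
  have Hpi: "H (pi/2) \<le> 0"
  proof -
    define S Q where "S = (sin t1)\<^sup>2" and "Q = 1 - \<mu>\<^sup>2"
    \<comment> \<open>With $n(t) \ge \frac13\sin^2 t$ at \<open>t1\<close> and $n(\pi/2) = 1 - 4/\pi^2 \le \frac35$, it remains to prove $\frac35 (S - \mu^2) \le \frac13 S Q$.\<close>
    have Q: "7/16 \<le> Q" "Q \<le> 1" "0 \<le> Q" using s2 by (auto simp: Q_def)
    define q where "q = sqrt Q"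
    have q: "0 \<le> q" "q\<^sup>2 = Q" using Q by (auto simp: q_def)
    have "0 \<le> (q - 1)\<^sup>2" by simp
    then have q1: "2 * q \<le> 1 + Q" using q by (simp add: power2_eq_square algebra_simps)
    have "S \<le> (\<mu> * (1 + q / 5))\<^sup>2"
      unfolding S_def q_def Q_def using lower upper \<mu> by (intro power_mono) auto
    also have "\<dots> = \<mu>\<^sup>2 * (1 + 2 * q / 5 + Q / 25)"
      using q by (simp add: power_mult_distrib power2_eq_square algebra_simps)
    also have "\<dots> \<le> \<mu>\<^sup>2 * (6/5 + 6/25 * Q)" using q1 by (intro mult_left_mono) auto
    finally have S: "S \<le> \<mu>\<^sup>2 * (6/5 + 6/25 * Q)" .
    have "(7/16) * (7/16) \<le> Q * Q" using Q by (intro mult_mono) auto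
    moreover have "(6/5 + 6/25 * Q) * (9/5 - Q) = 54/25 - 96/125 * Q - 6/25 * (Q * Q)"
      by (simp add: field_simps)
    ultimately have poly: "(6/5 + 6/25 * Q) * (9/5 - Q) \<le> 9/5"
      using Q by linarith
    have "S * (9/5 - Q) \<le> \<mu>\<^sup>2 * (6/5 + 6/25 * Q) * (9/5 - Q)"
      using S Q by (intro mult_right_mono) auto
    also have "\<dots> \<le> \<mu>\<^sup>2 * (9/5)" unfolding mult.assoc using poly by (intro mult_left_mono) auto
    finally have fin: "(3/5) * (S - \<mu>\<^sup>2) \<le> (S / 3) * Q" by (simp add: algebra_simps)
    have SM: "\<mu>\<^sup>2 < S" using pos[of t1] t1 by (simp add: S_def)
    have "(S/3) / (S - \<mu>\<^sup>2) \<le> sinc_defect t1 / (S - \<mu>\<^sup>2)"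
      using sinc_defect_ge[of t1] t1 SM by (intro divide_right_mono) (auto simp: S_def)
    then have "(S/3) / (S - \<mu>\<^sup>2) \<le> c"
      using SM by (simp add: c_def sinc_quot_def S_def)
    then have "(S/3) / (S - \<mu>\<^sup>2) * Q \<le> c * Q" using Q by (intro mult_right_mono) auto
    moreover have "3/5 \<le> (S/3) / (S - \<mu>\<^sup>2) * Q" using fin SM by (simp add: field_simps)
    ultimately have "3/5 \<le> c * Q" by (rule order_trans[rotated])
    then have "3/5 \<le> c * (1 - \<mu>\<^sup>2)" by (simp add: Q_def)
    moreover have "pi * pi \<le> 3.15 * 3.15" using pi_approx by (intro mult_mono) auto
    then have "sinc_defect (pi/2) \<le> 3/5"
      by (simp add: sinc_defect_def power_divide power2_eq_square field_simps)
    ultimately show ?thesis by (simp add: H_def)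
  qed
  have dH: "(H has_real_derivative 2 * sin x * cos x * (tan_excess x - c)) (at x)"
    if "t1 \<le> x" "x < pi/2" for x
    unfolding H_def using that t1
    by (auto intro!: derivative_eq_intros sinc_defect_deriv simp: algebra_simps)
  have cont: "continuous_on {t1..pi/2} H"
    unfolding H_def sinc_defect_def using t1 by (intro continuous_intros) auto
  have "H t \<le> 0"
  proof (rule ccontr)
    assume "\<not> H t \<le> 0"
    then have Ht: "H t > 0" by simp
    then have "t1 < t" using Ht1 t1 by (cases "t = t1") auto
    have dif: "H differentiable (at x)" if "t1 \<le> x" "x < pi/2" for x
      using dH[OF that] by (auto simp: real_differentiable_def)
    \<comment> \<open>A positive value in between would make the slope in $\sin^2 t$ positive before it and negative after it, contradicting convexity.\<close>
    obtain l a where a: "t1 < a" "a < t" "DERIV H a :> l" "H t - H t1 = (t - t1) * l"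
      using MVT[OF \<open>t1 < t\<close> continuous_on_subset[OF cont]] dif t1 by force
    obtain l' b where b: "t < b" "b < pi/2" "DERIV H b :> l'" "H (pi/2) - H t = (pi/2 - t) * l'"
      using MVT[OF \<open>t < pi/2\<close> continuous_on_subset[OF cont]] dif t1 by force
    have l: "l = 2 * sin a * cos a * (tan_excess a - c)"
      using DERIV_unique[OF a(3) dH[of a]] a t1 by auto
    have l': "l' = 2 * sin b * cos b * (tan_excess b - c)"
      using DERIV_unique[OF b(3) dH[of b]] a b t1 by auto
    have "0 < (t - t1) * l" using a(4) Ht Ht1 by simp
    then have "0 < l" using \<open>t1 < t\<close> by (simp add: zero_less_mult_iff)
    moreover have "(pi/2 - t) * l' < 0" using b(4) Hpi Ht by linarith
    then have "l' < 0" using t1 by (simp add: mult_less_0_iff)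
    moreover have "0 < cos a" "0 < sin a" "0 < cos b" "0 < sin b"
      using a b t1 by (auto intro!: cos_gt_zero_pi sin_gt_zero)
    ultimately have "tan_excess b < c" "c < tan_excess a"
      unfolding l l' by (auto simp: zero_less_mult_iff mult_less_0_iff)
    with tan_excess_mono[of a b] a b t1 show False by auto
  qed
  then show ?thesis
    using pos[of t] t1 by (simp add: H_def c_def[symmetric] sinc_quot_def[of \<mu> t] field_simps)
qed

lemma arcsin_nonneg: "0 \<le> y \<Longrightarrow> y \<le> 1 \<Longrightarrow> 0 \<le> arcsin y"
  using arcsin_le_arcsin[of 0 y] by simp

lemma arcsin_le_Jordan:
  assumes "0 \<le> y" "y \<le> 1"
  shows "arcsin y \<le> pi / 2 * y"
proof -
  have "2 / pi * arcsin y \<le> sin (arcsin y)"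
    using assms arcsin_bounded[of y] arcsin_nonneg[of y] by (intro sin_ge_Jordan) auto
  then have "pi / 2 * (2 / pi * arcsin y) \<le> pi / 2 * y"
    using assms by (intro mult_left_mono) auto
  then show ?thesis by simp
qed

section \<open>The maximal relative symbol error\<close>

text \<open>A single mesh $h = 1/N$ on which neither the continuous nor the discrete problem is
  resonant.\<close>

locale fd_mesh =
  fixes k :: real and N :: nat
  assumes k_ge: "16 \<le> k"
    and N_pos: "0 < N"
    and mesh_fine: "k / (real N * 2) \<le> 3 / 4"
    and nonres: "k \<noteq> real m * pi"
    and nonres_mesh: "m \<in> {1..<N} \<Longrightarrow> sigma_h k N (real m * pi) \<noteq> 0"
begin

definition \<mu> :: real where "\<mu> = k / (real N * 2)"
definition half_angle :: "nat \<Rightarrow> real" where "half_angle m = real m * pi / (real N * 2)"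
definition disc_freq :: "nat \<Rightarrow> real" where "disc_freq m = 2 * real N * sin (half_angle m)"
definition rel_symb_err :: "real \<Rightarrow> real" where
  "rel_symb_err \<xi> = \<bar>(symb k \<xi> - symb_h k N \<xi>) / (\<xi>\<^sup>2 * symb_h k N \<xi>)\<bar>"

lemma \<mu>_bounds: "0 < \<mu>" "\<mu> \<le> 3 / 4"
  using k_ge N_pos mesh_fine by (auto simp: \<mu>_def)

lemma k_le_N: "k \<le> 3 / 2 * real N"
  using mesh_fine N_pos by (simp add: field_simps)

lemma N_ge: "10 \<le> N"
proof -
  have "real 10 \<le> real N" using k_le_N k_ge by simp
  then show ?thesis by linarith
qed

lemma pi_bounds: "3 < pi" "pi \<le> 3.15"
  using pi_approx by auto

lemma half_angle_bounds:
  "m \<in> {1..<N} \<Longrightarrow> 0 < half_angle m \<and> half_angle m < pi / 2"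
  using N_pos by (auto simp: half_angle_def field_simps)

lemma half_angle_mono: "m \<le> n \<Longrightarrow> half_angle m \<le> half_angle n"
  using N_pos by (auto simp: half_angle_def intro!: divide_right_mono mult_right_mono)

lemma sigma_h_eq: "sigma_h k N (real m * pi) = \<bar>k - disc_freq m\<bar>"
  by (simp add: sigma_h_def disc_freq_def half_angle_def)

lemma symb_h_eq: "symb_h k N (real m * pi) = (k - disc_freq m) * (k + disc_freq m)"
  by (simp add: symb_h_def disc_freq_def half_angle_def power2_eq_square algebra_simps)

lemma disc_freq_pos: "m \<in> {1..<N} \<Longrightarrow> 0 < disc_freq m"
  using half_angle_bounds[of m] N_pos by (auto simp: disc_freq_def intro!: sin_gt_zero mult_pos_pos)

text \<open>The discrete frequency $\frac2h\sin\frac{\xi h}2$ underestimates $\xi$ by a factor of at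
  most $\pi/2$; this is the source of the extra $\pi$ in the estimate of the derivative.\<close>

lemma disc_freq_ge_Jordan:
  assumes "m \<in> {1..<N}"
  shows "2 / pi * (real m * pi) \<le> disc_freq m"
proof -
  have "2 * real N * (2 / pi * half_angle m) \<le> 2 * real N * sin (half_angle m)"
    using half_angle_bounds[OF assms] by (intro mult_left_mono sin_ge_Jordan) auto
  moreover have "real m * pi = 2 * real N * half_angle m" using N_pos by (simp add: half_angle_def)
  ultimately show ?thesis by (simp add: disc_freq_def mult_ac)
qed

lemma disc_freq_le: "disc_freq m \<le> real m * pi"
  using sin_x_le_x[of "half_angle m"] N_pos by (simp add: disc_freq_def half_angle_def field_simps)

lemma symb_h_nonzero: "m \<in> {1..<N} \<Longrightarrow> symb_h k N (real m * pi) \<noteq> 0"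
  using nonres_mesh[of m] disc_freq_pos[of m] k_ge by (auto simp: symb_h_eq sigma_h_eq)

lemma symb_nonzero: "symb k (real m * pi) \<noteq> 0"
proof
  assume "symb k (real m * pi) = 0"
  then have "(k - real m * pi) * (k + real m * pi) = 0"
    by (simp add: symb_def power2_eq_square algebra_simps)
  moreover have "0 < k + real m * pi" using k_ge by (intro add_pos_nonneg) auto
  ultimately show False using nonres[of m] by auto
qed

lemma rel_symb_err_eq:
  assumes "m \<in> {1..<N}"
  shows "rel_symb_err (real m * pi) = sinc_quot \<mu> (half_angle m) / (2 * real N)\<^sup>2"
    and "rel_symb_err (real m * pi) = sinc_defect (half_angle m) / (sigma_h k N (real m * pi) * (k + disc_freq m))"
proof -
  define t where "t = half_angle m"
  have t: "0 < t" "t < pi / 2" using half_angle_bounds[OF assms] by (auto simp: t_def)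
  have \<xi>: "real m * pi = 2 * real N * t" using N_pos by (simp add: t_def half_angle_def)
  have sh: "symb_h k N (real m * pi) = (2 * real N)\<^sup>2 * (\<mu>\<^sup>2 - (sin t)\<^sup>2)"
  proof -
    have "k = 2 * real N * \<mu>" using N_pos by (simp add: \<mu>_def)
    then have "symb_h k N (real m * pi)
        = (2 * real N * \<mu> - 2 * real N * sin t) * (2 * real N * \<mu> + 2 * real N * sin t)"
      unfolding symb_h_eq disc_freq_def t_def[symmetric] by simp
    then show ?thesis by (simp add: algebra_simps power2_eq_square)
  qed
  have "symb k (real m * pi) - symb_h k N (real m * pi) = (2 * real N)\<^sup>2 * ((sin t)\<^sup>2 - t\<^sup>2)"
    unfolding symb_def symb_h_eq[of m] disc_freq_def t_def[symmetric] unfolding \<xi>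
    by (simp add: algebra_simps power2_eq_square)
  also have "\<dots> = - ((real m * pi)\<^sup>2 * sinc_defect t)"
    using t unfolding \<xi> sinc_defect_def by (simp add: power_mult_distrib power_divide field_simps)
  finally have "symb k (real m * pi) - symb_h k N (real m * pi) = - ((real m * pi)\<^sup>2 * sinc_defect t)" .
  then have "rel_symb_err (real m * pi) = \<bar>sinc_defect t / symb_h k N (real m * pi)\<bar>"
    using assms by (simp add: rel_symb_err_def)
  then have *: "rel_symb_err (real m * pi) = sinc_defect t / \<bar>symb_h k N (real m * pi)\<bar>"
    using sinc_defect_nonneg[of t] t by simp
  show "rel_symb_err (real m * pi) = sinc_quot \<mu> (half_angle m) / (2 * real N)\<^sup>2"
    unfolding * sh by (simp add: sinc_quot_def t_def abs_mult)
  show "rel_symb_err (real m * pi) = sinc_defect (half_angle m) / (sigma_h k N (real m * pi) * (k + disc_freq m))"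
    unfolding * using disc_freq_pos[OF assms] k_ge by (simp add: symb_h_eq sigma_h_eq t_def abs_mult)
qed

text \<open>$k^h$ lies between \<open>M * pi\<close> and \<open>(M + 1) * pi\<close>, so these two
  frequencies are $k_-^h$ and $k_+^h$.\<close>

definition M :: nat where "M = nat \<lfloor>k_h k N / pi\<rfloor>"

lemma k_h_bounds: "k \<le> k_h k N" "k_h k N \<le> pi / 2 * k"
proof -
  have e: "k_h k N = 2 * real N * arcsin \<mu>" by (simp add: k_h_def \<mu>_def)
  have "arcsin \<mu> \<le> pi / 2 * \<mu>" using \<mu>_bounds by (intro arcsin_le_Jordan) auto
  moreover have "\<mu> \<le> arcsin \<mu>"
    using sin_x_le_x[of "arcsin \<mu>"] \<mu>_bounds arcsin_nonneg[of \<mu>] by simp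
  ultimately have "2 * real N * \<mu> \<le> k_h k N" "k_h k N \<le> 2 * real N * (pi / 2 * \<mu>)"
    unfolding e by (intro mult_left_mono; simp)+
  moreover have "2 * real N * \<mu> = k" "2 * real N * (pi / 2 * \<mu>) = pi / 2 * k"
    using N_pos by (auto simp: \<mu>_def)
  ultimately show "k \<le> k_h k N" "k_h k N \<le> pi / 2 * k" by (simp_all only:)
qed

lemma sin_k_h: "sin (k_h k N / (real N * 2)) = \<mu>"
proof -
  have "k_h k N / (real N * 2) = arcsin \<mu>" using N_pos by (simp add: k_h_def \<mu>_def)
  then show ?thesis using \<mu>_bounds by simp
qed

lemma M_bounds: "1 \<le> M" "M + 1 < N"
  and M_enclose: "real M * pi < k_h k N" "k_h k N < real (M + 1) * pi"
proof -
  have q: "1 \<le> k_h k N / pi" using k_h_bounds k_ge pi_bounds by simp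
  have M: "real M \<le> k_h k N / pi" "k_h k N / pi < real M + 1" "1 \<le> M"
    unfolding M_def using q by linarith+
  show "1 \<le> M" by fact
  have "real M * pi \<le> k_h k N" using M(1) pi_bounds by (simp add: field_simps)
  then have "real M * pi \<le> k / 2 * pi" using k_h_bounds(2)
    by (metis mult.commute order_trans times_divide_eq_right)
  then have "real M \<le> k / 2" by (rule mult_right_le_imp_le) simp
  then have "real (M + 1) < real N" using k_le_N N_ge by simp
  then show N: "M + 1 < N" by linarith
  have "k_h k N \<noteq> real M * pi"
  proof
    assume "k_h k N = real M * pi"
    then have "disc_freq M = k" using sin_k_h N_pos by (simp add: disc_freq_def half_angle_def \<mu>_def)
    then show False using nonres_mesh[of M] \<open>1 \<le> M\<close> N by (simp add: sigma_h_eq)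
  qed
  then show "real M * pi < k_h k N" "k_h k N < real (M + 1) * pi"
    using M pi_bounds by (auto simp: field_simps)
qed

lemma k_minus_eq: "k_minus k N = real M * pi"
  unfolding k_minus_def
proof (rule the_equality)
  show "(\<exists>m::nat. m \<ge> 1 \<and> real M * pi = real m * pi) \<and> real M * pi < k_h k N \<and> k_h k N < real M * pi + pi"
    using M_bounds M_enclose by (auto simp: algebra_simps)
next
  fix \<xi> assume "(\<exists>m::nat. m \<ge> 1 \<and> \<xi> = real m * pi) \<and> \<xi> < k_h k N \<and> k_h k N < \<xi> + pi"
  then obtain m where m: "\<xi> = real m * pi" "real m * pi < k_h k N" "k_h k N < real m * pi + pi" by auto
  have "real m * pi < real (M + 1) * pi" "real M * pi < real (m + 1) * pi"
    using m M_enclose by (auto simp: algebra_simps)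
  then have "m = M" by simp
  then show "\<xi> = real M * pi" using m by simp
qed

lemma k_plus_eq: "k_plus k N = real (M + 1) * pi"
  by (simp add: k_plus_def k_minus_eq algebra_simps)

lemma M_freq_bounds:
  assumes "m \<in> {M, M + 1}"
  shows "m \<in> {1..<N}" "4 / 5 * k \<le> real m * pi" "real m * pi \<le> 9 / 5 * k"
proof -
  show "m \<in> {1..<N}" using assms M_bounds by auto
  have "k - pi \<le> real m * pi" "real m * pi \<le> k_h k N + pi"
    using assms M_enclose k_h_bounds pi_bounds by (auto simp: algebra_simps)
  moreover have "k_h k N \<le> 3.15 / 2 * k"
    using k_h_bounds(2) mult_right_mono[of "pi/2" "3.15/2" k] pi_bounds(2) k_ge
    by (meson divide_right_mono order_trans zero_le_numeral)
  ultimately show "4 / 5 * k \<le> real m * pi" "real m * pi \<le> 9 / 5 * k"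
    using pi_bounds k_ge by auto
qed

lemma sin_half_angle_M: "sin (half_angle M) < \<mu>" "\<mu> < sin (half_angle (M + 1))"
proof -
  have "half_angle M < k_h k N / (real N * 2)" "k_h k N / (real N * 2) < half_angle (M + 1)"
    using M_enclose N_pos by (auto simp: half_angle_def field_simps)
  moreover have "k_h k N / (real N * 2) = arcsin \<mu>" using N_pos by (simp add: k_h_def \<mu>_def)
  moreover have "half_angle (M + 1) < pi / 2" "0 < half_angle M"
    using half_angle_bounds[of "M+1"] half_angle_bounds[of "M"] M_bounds by auto
  ultimately have *: "half_angle M < arcsin \<mu>" "arcsin \<mu> < half_angle (M + 1)"
    "half_angle (M + 1) < pi / 2" "0 < half_angle M" by auto
  have "sin (half_angle M) < sin (arcsin \<mu>)" "sin (arcsin \<mu>) < sin (half_angle (M + 1))"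
    using * by (auto intro!: sin_monotone_2pi)
  then show "sin (half_angle M) < \<mu>" "\<mu> < sin (half_angle (M + 1))" using \<mu>_bounds by auto
qed

text \<open>The half angle of $k_+^h$ exceeds $\arcsin\mu$ by at most $\pi h/2 = \mu\pi/k \le \mu/5$,
  and the sine is below its tangent at $\arcsin\mu$.\<close>

lemma sin_half_angle_M_upper:
  "sin (half_angle (M + 1)) \<le> \<mu> * (1 + sqrt (1 - \<mu>\<^sup>2) / 5)"
proof -
  define \<theta> where "\<theta> = arcsin \<mu>"
  have kh: "k_h k N / (real N * 2) = \<theta>" using N_pos by (simp add: k_h_def \<mu>_def \<theta>_def)
  define \<delta> where "\<delta> = half_angle (M + 1) - \<theta>"
  have "half_angle M < \<theta>" "\<theta> < half_angle (M + 1)"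
    using M_enclose N_pos unfolding kh[symmetric] by (auto simp: half_angle_def field_simps)
  moreover have "half_angle (M + 1) = half_angle M + pi / (real N * 2)"
    by (simp add: half_angle_def add_divide_distrib[symmetric] distrib_right)
  ultimately have \<delta>: "0 \<le> \<delta>" "\<delta> \<le> pi / (real N * 2)" by (auto simp: \<delta>_def)
  have c: "cos \<theta> = sqrt (1 - \<mu>\<^sup>2)" "sin \<theta> = \<mu>"
    using \<mu>_bounds by (auto simp: \<theta>_def cos_arcsin)
  have "pi / (real N * 2) \<le> \<mu> / 5" using k_ge N_pos pi_bounds by (simp add: \<mu>_def field_simps)
  with \<delta> have \<delta>': "\<delta> \<le> \<mu> / 5" by simp
  have c0: "0 \<le> cos \<theta>" using c \<mu>_bounds by (simp add: abs_square_le_1)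
  have "sin (half_angle (M + 1)) = sin (\<theta> + \<delta>)" by (simp add: \<delta>_def)
  also have "\<dots> = \<mu> * cos \<delta> + cos \<theta> * sin \<delta>" by (simp add: sin_add c)
  also have "\<dots> \<le> \<mu> * 1 + cos \<theta> * (\<mu> / 5)"
    using \<mu>_bounds c0 \<delta> \<delta>' sin_x_le_x[of \<delta>] by (intro add_mono mult_left_mono) auto
  finally show ?thesis by (simp add: c algebra_simps)
qed

text \<open>Frequencies below $k^h$ are compared with $k_-^h$, those above with $k_+^h$.\<close>

lemma rel_symb_err_le_M:
  assumes "m \<in> {1..<N}"
  shows "rel_symb_err (real m * pi) \<le> rel_symb_err (real (if m \<le> M then M else M + 1) * pi)"
proof (cases "m \<le> M")
  case True
  have "sinc_quot \<mu> (half_angle m) \<le> sinc_quot \<mu> (half_angle M)"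
    using half_angle_bounds[OF assms] half_angle_bounds[of M] M_bounds True sin_half_angle_M
    by (intro sinc_quot_mono_left half_angle_mono) auto
  then show ?thesis using True assms M_bounds by (auto simp: rel_symb_err_eq(1) intro!: divide_right_mono)
next
  case False
  have "sinc_quot \<mu> (half_angle m) \<le> sinc_quot \<mu> (half_angle (M + 1))"
    using half_angle_bounds[OF assms] half_angle_bounds[of "M+1"] M_bounds False sin_half_angle_M
      sin_half_angle_M_upper \<mu>_bounds
    by (intro sinc_quot_le_at_right half_angle_mono) auto
  then show ?thesis using False assms M_bounds
    using rel_symb_err_eq(1)[of "M+1"] by (auto simp: rel_symb_err_eq(1) intro!: divide_right_mono)
qed

lemma C_rel_eq_Max: "C_rel k N = Max ((\<lambda>m. rel_symb_err (real m * pi)) ` {1..<N})"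
  by (simp add: C_rel_def rel_symb_err_def low_freqs_def image_image)

lemma rel_symb_err_le_C_rel: "m \<in> {1..<N} \<Longrightarrow> rel_symb_err (real m * pi) \<le> C_rel k N"
  unfolding C_rel_eq_Max by (intro Max_ge) auto

lemma C_rel_attained:
  obtains m where "m \<in> {M, M + 1}" "C_rel k N = rel_symb_err (real m * pi)"
proof -
  have "C_rel k N \<in> (\<lambda>m. rel_symb_err (real m * pi)) ` {1..<N}"
    unfolding C_rel_eq_Max using N_ge by (intro Max_in) auto
  then obtain n where n: "n \<in> {1..<N}" "C_rel k N = rel_symb_err (real n * pi)" by auto
  define m where "m = (if n \<le> M then M else M + 1)"
  have m: "m \<in> {M, M + 1}" by (auto simp: m_def)
  have "C_rel k N \<le> rel_symb_err (real m * pi)"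
    using rel_symb_err_le_M[OF n(1)] n(2) by (simp add: m_def)
  moreover have "rel_symb_err (real m * pi) \<le> C_rel k N"
    using M_freq_bounds(1)[OF m] by (rule rel_symb_err_le_C_rel)
  ultimately show ?thesis using that m by auto
qed

lemma sigma_h_pos: "m \<in> {1..<N} \<Longrightarrow> 0 < sigma_h k N (real m * pi)"
  using nonres_mesh[of m] by (simp add: sigma_h_def)

text \<open>At $\xi = k_\pm^h$ the half angle lies between $\frac25 kh$ and $\frac9{10} kh$, so
  \<open>sinc_defect\<close> is comparable to $(kh)^2$, while $|\lambda^h| = \tilde\sigma_\pm^h (k + s)$
  with a discrete frequency \<open>s\<close> between \<open>0\<close> and \<open>9/5 *
  k\<close>.\<close>

lemma rel_symb_err_bounds:
  assumes "m \<in> {M, M + 1}"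
  defines "\<sigma> \<equiv> sigma_h k N (real m * pi)"
  shows "1 / 200 * (k * (mesh N)\<^sup>2 / \<sigma>) < rel_symb_err (real m * pi)"
    and "rel_symb_err (real m * pi) < k * (mesh N)\<^sup>2 / \<sigma>"
proof -
  define t where "t = half_angle m"
  note mb = M_freq_bounds[OF assms(1)]
  have t: "0 < t" "t < pi / 2" using half_angle_bounds[OF mb(1)] by (auto simp: t_def)
  have \<sigma>: "0 < \<sigma>" unfolding \<sigma>_def by (rule sigma_h_pos[OF mb(1)])
  have e: "rel_symb_err (real m * pi) = sinc_defect t / (\<sigma> * (k + disc_freq m))"
    using rel_symb_err_eq(2)[OF mb(1)] by (simp add: \<sigma>_def t_def)
  have s: "0 < disc_freq m" "disc_freq m \<le> 9 / 5 * k" using disc_freq_pos[OF mb(1)] disc_freq_le[of m] mb by auto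
  define x where "x = k / real N"
  have x: "0 < x" "k * (k * (mesh N)\<^sup>2) = x\<^sup>2"
    using k_ge N_pos by (auto simp: x_def power_divide power2_eq_square)
  have tb: "2 / 5 * x \<le> t" "t \<le> 9 / 10 * x"
    using mb N_pos by (auto simp: t_def half_angle_def x_def field_simps)
  have "sinc_defect t \<le> (9 / 10 * x)\<^sup>2"
    using sinc_defect_le[OF t] power_mono[OF tb(2), of 2] t by simp
  also have "\<dots> < k * (k * (mesh N)\<^sup>2)"
    using x by (simp add: power_mult_distrib power_divide)
  finally have "rel_symb_err (real m * pi) < k * (k * (mesh N)\<^sup>2) / (\<sigma> * (k + disc_freq m))"
    unfolding e using \<sigma> s k_ge by (intro divide_strict_right_mono mult_pos_pos) auto
  also have "\<dots> \<le> k * (k * (mesh N)\<^sup>2) / (\<sigma> * k)"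
    using \<sigma> s k_ge by (intro divide_left_mono mult_left_mono mult_pos_pos) auto
  finally show "rel_symb_err (real m * pi) < k * (mesh N)\<^sup>2 / \<sigma>" using k_ge by simp
  have "2 / 3.15 * t \<le> 2 / pi * t" using pi_bounds t by (intro mult_right_mono frac_le) auto
  also have "\<dots> \<le> sin t" using t by (intro sin_ge_Jordan) auto
  finally have "(2 / 3.15 * (2 / 5 * x))\<^sup>2 \<le> (sin t)\<^sup>2"
    using tb x by (intro power_mono) auto
  then have d: "(2 / 3.15 * (2 / 5 * x))\<^sup>2 / 3 \<le> sinc_defect t"
    using sinc_defect_ge[OF t] by simp
  have "1 / 200 * (k * (mesh N)\<^sup>2 / \<sigma>) = (1/200 * k * (mesh N)\<^sup>2 * (14 / 5 * k)) / (\<sigma> * (14 / 5 * k))"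
    using k_ge by simp
  also have "\<dots> \<le> (1/200 * k * (mesh N)\<^sup>2 * (14 / 5 * k)) / (\<sigma> * (k + disc_freq m))"
    using \<sigma> s k_ge by (intro divide_left_mono mult_left_mono mult_pos_pos) auto
  also have "1/200 * k * (mesh N)\<^sup>2 * (14 / 5 * k) = 14 / 1000 * x\<^sup>2"
    unfolding x(2)[symmetric] by simp
  also have "14 / 1000 * x\<^sup>2 / (\<sigma> * (k + disc_freq m)) < (2 / 3.15 * (2 / 5 * x))\<^sup>2 / 3 / (\<sigma> * (k + disc_freq m))"
    using \<sigma> s k_ge x
    by (intro divide_strict_right_mono mult_pos_pos) (auto simp: power_mult_distrib power_divide)
  also have "\<dots> \<le> rel_symb_err (real m * pi)"
    unfolding e using \<sigma> s k_ge d by (intro divide_right_mono) auto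
  finally show "1 / 200 * (k * (mesh N)\<^sup>2 / \<sigma>) < rel_symb_err (real m * pi)" .
qed

lemma sigma_min_eq: "sigma_min k N = min (sigma_h k N (real M * pi)) (sigma_h k N (real (M + 1) * pi))"
  by (simp add: sigma_min_def k_minus_eq k_plus_eq)

lemma sigma_min_pos: "0 < sigma_min k N"
  using sigma_h_pos[of M] sigma_h_pos[of "M+1"] M_bounds by (simp add: sigma_min_eq)

lemma C_rel_bounds:
  "1 / 200 * (k * (mesh N)\<^sup>2 / sigma_min k N) < C_rel k N"
  "C_rel k N < k * (mesh N)\<^sup>2 / sigma_min k N"
proof -
  obtain m where m: "m \<in> {M, M + 1}" "C_rel k N = rel_symb_err (real m * pi)"
    by (rule C_rel_attained)
  have "rel_symb_err (real m * pi) < k * (mesh N)\<^sup>2 / sigma_h k N (real m * pi)"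
    by (rule rel_symb_err_bounds[OF m(1)])
  also have "\<dots> \<le> k * (mesh N)\<^sup>2 / sigma_min k N"
    using m(1) sigma_min_pos k_ge sigma_h_pos[OF M_freq_bounds(1)[OF m(1)]]
    by (intro divide_left_mono) (auto simp: sigma_min_eq)
  finally show "C_rel k N < k * (mesh N)\<^sup>2 / sigma_min k N" by (simp add: m(2))
  obtain n where n: "n \<in> {M, M + 1}" "sigma_min k N = sigma_h k N (real n * pi)"
  proof (cases "sigma_h k N (real M * pi) \<le> sigma_h k N (real (M + 1) * pi)")
    case True then show ?thesis using that[of M] by (simp add: sigma_min_eq)
  next
    case False then show ?thesis using that[of "M+1"] by (simp add: sigma_min_eq)
  qed
  show "1 / 200 * (k * (mesh N)\<^sup>2 / sigma_min k N) < C_rel k N"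
    using rel_symb_err_bounds(1)[OF n(1)] rel_symb_err_le_C_rel[OF M_freq_bounds(1)[OF n(1)]] n(2)
    by simp
qed

end

section \<open>The discrete sine transform and the difference scheme\<close>

text \<open>Multiplication by $2\sin(\theta/2)$, where $\theta = l\pi/N$, makes the sum telescope. The
  summand has period \<open>2 * N\<close> in the index, and the sum runs over half of it; this leaves
  \<open>1\<close> for odd \<open>l\<close>.\<close>

lemma cos_sum_grid:
  fixes l :: int
  assumes "0 < N"
  shows "(\<Sum>i<N. cos (of_int l * pi / real N * real i))
    = (if 2 * int N dvd l then real N else if even l then 0 else 1)"
proof (cases "2 * int N dvd l")
  case True
  then obtain q where q: "l = 2 * int N * q" by (auto simp: dvd_def)
  have "cos (of_int l * pi / real N * real i) = 1" for i
  proof -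
    have "of_int l * pi / real N * real i = 2 * pi * of_int (q * int i)"
      using assms by (simp add: q)
    then show ?thesis by (simp only: cos_int_2pin)
  qed
  then show ?thesis using True by simp
next
  case False
  define \<theta> where "\<theta> = of_int l * pi / real N"
  \<comment> \<open>This is $2\sin(\theta/2)\cos(\theta i) = \sin((i+\frac12)\theta) - \sin((i-\frac12)\theta)$, summed.\<close>
  have tel: "(\<Sum>i<n. 2 * sin (\<theta> / 2) * cos (\<theta> * real i)) = sin (\<theta> * real n - \<theta> / 2) + sin (\<theta> / 2)" for n
  proof (induction n)
    case (Suc n)
    have e: "\<theta> * real (Suc n) - \<theta> / 2 = \<theta> * real n + \<theta> / 2" by (simp add: algebra_simps)
    show ?case unfolding sum.lessThan_Suc Suc e by (simp add: sin_add sin_diff algebra_simps)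
  qed simp
  have nz: "sin (\<theta> / 2) \<noteq> 0"
  proof
    assume "sin (\<theta> / 2) = 0"
    then obtain q :: int where "\<theta> / 2 = of_int q * pi" by (auto simp: sin_zero_iff_int2)
    then have "of_int l = (of_int (2 * int N * q) :: real)"
      using assms by (simp add: \<theta>_def field_simps)
    then have "l = 2 * int N * q" by (simp only: of_int_eq_iff)
    with False show False by simp
  qed
  have N\<theta>: "\<theta> * real N = of_int l * pi" using assms by (simp add: \<theta>_def)
  have "sin (\<theta> * real N - \<theta> / 2) = - (if even l then 1 else - 1) * sin (\<theta> / 2)"
  proof -
    have "sin (of_int l * pi) = 0" by (simp add: sin_zero_iff_int2)
    moreover have "cos (of_int l * pi) = (if even l then 1 else - 1)"
      using cos_npi_int[of l] by (simp add: mult.commute)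
    ultimately show ?thesis unfolding N\<theta> sin_diff by simp
  qed
  with tel[of N] have "2 * sin (\<theta> / 2) * (\<Sum>i<N. cos (\<theta> * real i))
      = 2 * sin (\<theta> / 2) * (if even l then 0 else 1)"
    by (simp add: sum_distrib_left)
  with nz False show ?thesis unfolding \<theta>_def by (simp only: mult_cancel_left if_False) auto
qed

text \<open>The discrete sine coefficient at frequency \<open>j * pi\<close> of the grid values of
  $\sin(m\pi x)$.\<close>

definition alias_sign :: "nat \<Rightarrow> nat \<Rightarrow> nat \<Rightarrow> real" where
  "alias_sign N j m = of_bool (2 * int N dvd int m - int j) - of_bool (2 * int N dvd int m + int j)"

lemma grid_sine_orthogonality:
  assumes "0 < N"
  shows "2 * (\<Sum>i\<in>{1..<N}. mesh N * sin (real j * pi * (real i * mesh N)) * sin (real m * pi * (real i * mesh N)))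
    = alias_sign N j m"
proof -
  define h where "h = mesh N"
  have h: "h * real N = 1" using assms by (simp add: h_def)
  have "2 * (\<Sum>i\<in>{1..<N}. h * sin (real j * pi * (real i * h)) * sin (real m * pi * (real i * h)))
    = (\<Sum>i\<in>{1..<N}. h * (cos (of_int (int m - int j) * pi / real N * real i)
        - cos (of_int (int m + int j) * pi / real N * real i)))"
    unfolding sum_distrib_left
  proof (intro sum.cong refl)
    fix i
    have d: "x * pi / real N * real i = x * pi * (real i * h)" for x
      by (simp add: h_def)
    have 1: "of_int (int m - int j) * pi / real N * real i = real m * pi * (real i * h) - real j * pi * (real i * h)"
      unfolding d by (simp add: left_diff_distrib)
    have 2: "of_int (int m + int j) * pi / real N * real i = real m * pi * (real i * h) + real j * pi * (real i * h)"
      unfolding d by (simp add: distrib_right)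
    show "2 * (h * sin (real j * pi * (real i * h)) * sin (real m * pi * (real i * h))) =
      h * (cos (of_int (int m - int j) * pi / real N * real i) - cos (of_int (int m + int j) * pi / real N * real i))"
      unfolding 1 2 cos_diff cos_add by (simp add: algebra_simps)
  qed
  also have "\<dots> = (\<Sum>i<N. h * (cos (of_int (int m - int j) * pi / real N * real i)
        - cos (of_int (int m + int j) * pi / real N * real i)))"
    by (intro sum.mono_neutral_left) (auto simp: not_le)
  also have "\<dots> = h * ((\<Sum>i<N. cos (of_int (int m - int j) * pi / real N * real i))
        - (\<Sum>i<N. cos (of_int (int m + int j) * pi / real N * real i)))"
    by (simp only: sum_distrib_left sum_subtractf right_diff_distrib)
  also have "\<dots> = alias_sign N j m"
  proof -
    have ev: "even (int m - int j) \<longleftrightarrow> even (int m + int j)" by simp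
    define a b e where "a \<longleftrightarrow> 2 * int N dvd int m - int j" and "b \<longleftrightarrow> 2 * int N dvd int m + int j"
      and "e \<longleftrightarrow> even (int m + int j)"
    have "a \<longrightarrow> e" "b \<longrightarrow> e" unfolding a_def b_def e_def ev[symmetric]
      using ev by (meson dvd_mult_left)+
    then have "h * ((if a then real N else if e then 0 else 1) - (if b then real N else if e then 0 else 1))
        = of_bool a - of_bool b"
      using h by auto
    then show ?thesis
      unfolding cos_sum_grid[OF assms] alias_sign_def ev a_def b_def e_def .
  qed
  finally show ?thesis unfolding h_def .
qed

lemma small_multiple_zero: "\<bar>x\<bar> < \<bar>y\<bar> \<Longrightarrow> y dvd x \<Longrightarrow> x = 0" for x y :: int
  using dvd_imp_le_int[of x y] by linarith

lemma alias_sign_low: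
  assumes "j \<in> {1..<N}" "m \<in> {1..<N}"
  shows "alias_sign N j m = of_bool (m = j)"
proof -
  have "2 * int N dvd int m - int j \<longleftrightarrow> m = j"
  proof
    assume "2 * int N dvd int m - int j"
    then have "int m - int j = 0"
      by (intro small_multiple_zero[of _ "2 * int N"]) (use assms in auto)
    then show "m = j" by simp
  qed auto
  moreover have "\<not> 2 * int N dvd int m + int j"
    using small_multiple_zero[of "int m + int j" "2 * int N"] assms by auto
  ultimately show ?thesis by (simp add: alias_sign_def)
qed

lemma grid_sine_coeff_sum:
  "grid_sine_coeff N (\<lambda>i. \<Sum>m\<in>I. c m * sin (real m * pi * (real i * mesh N))) (real j * pi)
    = (\<Sum>m\<in>I. c m * alias_sign N j m)" if "0 < N"
proof -
  have "2 * (\<Sum>i\<in>A. h * f i * (\<Sum>m\<in>I. c m * g m i)) = (\<Sum>m\<in>I. c m * (2 * (\<Sum>i\<in>A. h * f i * g m i)))"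
    for A :: "nat set" and h :: real and f g
  proof -
    have "2 * (\<Sum>i\<in>A. h * f i * (\<Sum>m\<in>I. c m * g m i)) = (\<Sum>i\<in>A. \<Sum>m\<in>I. c m * (2 * (h * f i * g m i)))"
     unfolding sum_distrib_left by (intro sum.cong refl) simp
    also have "\<dots> = (\<Sum>m\<in>I. \<Sum>i\<in>A. c m * (2 * (h * f i * g m i)))" by (rule sum.swap)
    finally show ?thesis unfolding sum_distrib_left .
  qed
  then show ?thesis
    unfolding grid_sine_coeff_def by (simp only: grid_sine_orthogonality[OF that])
qed

text \<open>The matrix of grid values $\sin(m\pi i/N)$ is symmetric in \<open>m\<close> and
  \<open>i\<close>, so orthogonality of its rows is orthogonality of its columns.\<close>

lemma grid_sine_inversion:
  assumes "i \<in> {1..<N}"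
  shows "(\<Sum>m\<in>{1..<N}. grid_sine_coeff N U (real m * pi) * sin (real m * pi * (real i * mesh N))) = U i"
proof -
  have N: "0 < N" using assms by auto
  define S where "S m l = sin (real m * pi * (real l * mesh N))" for m l :: nat
  have sym: "S m l = S l m" for m l by (simp add: S_def mult_ac)
  have swap: "(\<Sum>m\<in>A. (2 * (\<Sum>l\<in>A. h * f m l * U l)) * g m) = (\<Sum>l\<in>A. U l * (2 * (\<Sum>m\<in>A. h * g m * f m l)))"
    for A :: "nat set" and h :: real and f g
  proof -
    have "(\<Sum>m\<in>A. (2 * (\<Sum>l\<in>A. h * f m l * U l)) * g m) = (\<Sum>m\<in>A. \<Sum>l\<in>A. U l * (2 * (h * g m * f m l)))"
     unfolding sum_distrib_left sum_distrib_right by (intro sum.cong refl) simp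
    also have "\<dots> = (\<Sum>l\<in>A. \<Sum>m\<in>A. U l * (2 * (h * g m * f m l)))" by (rule sum.swap)
    finally show ?thesis unfolding sum_distrib_left .
  qed
  have "(\<Sum>m\<in>{1..<N}. grid_sine_coeff N U (real m * pi) * sin (real m * pi * (real i * mesh N)))
    = (\<Sum>l\<in>{1..<N}. U l * (2 * (\<Sum>m\<in>{1..<N}. mesh N * S m i * S m l)))"
    unfolding grid_sine_coeff_def S_def[symmetric] swap ..
  also have "\<dots> = (\<Sum>l\<in>{1..<N}. U l * (2 * (\<Sum>m\<in>{1..<N}. mesh N * S i m * S l m)))"
    by (simp only: sym)
  also have "\<dots> = (\<Sum>l\<in>{1..<N}. U l * of_bool (l = i))"
    unfolding S_def by (intro sum.cong refl) (simp only: grid_sine_orthogonality[OF N] alias_sign_low[OF assms])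
  also have "\<dots> = (\<Sum>l\<in>{1..<N}. if l = i then U l else 0)"
    by (intro sum.cong) auto
  also have "\<dots> = U i"
    using assms by (subst sum.delta) auto
  finally show ?thesis .
qed

lemma sum_low_freqs: "(\<Sum>\<xi>\<in>low_freqs N. g \<xi>) = (\<Sum>m\<in>{1..<N}. g (real m * pi))"
  unfolding low_freqs_def by (subst sum.reindex) (auto simp: inj_on_def)

lemma shift_sum:
  fixes S U :: "nat \<Rightarrow> real"
  assumes "U 0 = 0" "S N = 0"
  shows "(\<Sum>j\<in>{1..<N}. S j * U (j - 1)) = (\<Sum>j\<in>{1..<N}. S (j + 1) * U j)"
proof (cases N)
  case (Suc n)
  have "(\<Sum>j\<in>{1..<N}. S j * U (j - 1)) = (\<Sum>j<n. S (Suc j) * U j)"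
    unfolding Suc by (simp only: One_nat_def sum.atLeast_Suc_lessThan_Suc_shift atLeast0LessThan) simp
  also have "\<dots> = (\<Sum>j<N. S (Suc j) * U j)" using assms(2) by (simp add: Suc)
  also have "\<dots> = (\<Sum>j\<in>{1..<N}. S (j + 1) * U j)"
    by (rule sum.mono_neutral_cong_right) (use assms in \<open>auto simp: not_le\<close>)
  finally show ?thesis .
qed simp

lemma sum_by_parts_second_difference:
  fixes S U :: "nat \<Rightarrow> real"
  assumes "U 0 = 0" "S N = 0" "S 0 = 0" "U N = 0"
  shows "(\<Sum>j\<in>{1..<N}. S j * (U (j - 1) + U (j + 1))) = (\<Sum>j\<in>{1..<N}. (S (j - 1) + S (j + 1)) * U j)"
proof -
  have "(\<Sum>j\<in>{1..<N}. S j * (U (j - 1) + U (j + 1)))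
      = (\<Sum>j\<in>{1..<N}. S j * U (j - 1)) + (\<Sum>j\<in>{1..<N}. U (j + 1) * S j)"
    by (simp only: distrib_left sum.distrib mult.commute)
  also have "\<dots> = (\<Sum>j\<in>{1..<N}. S (j + 1) * U j) + (\<Sum>j\<in>{1..<N}. U j * S (j - 1))"
    using shift_sum[of U S N] shift_sum[of S U N] assms by simp
  also have "\<dots> = (\<Sum>j\<in>{1..<N}. (S (j - 1) + S (j + 1)) * U j)"
    by (simp only: distrib_right distrib_left sum.distrib mult.commute add.commute)
  finally show ?thesis .
qed

text \<open>The grid sines diagonalize the difference operator, with the discrete symbol as
  eigenvalue.\<close>

lemma symb_h_eigen:
  fixes \<xi> :: real and N :: nat
  assumes "0 < N" "1 \<le> j"
  defines "S \<equiv> \<lambda>j::nat. sin (\<xi> * (real j * mesh N))"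
  shows "(k\<^sup>2 - 2 / (mesh N)\<^sup>2) * S j + 1 / (mesh N)\<^sup>2 * (S (j - 1) + S (j + 1)) = symb_h k N \<xi> * S j"
proof -
  have 1: "\<xi> * (real (j - 1) * mesh N) = \<xi> * (real j * mesh N) - \<xi> * mesh N"
    using assms by (simp add: of_nat_diff algebra_simps diff_divide_distrib)
  have 2: "\<xi> * (real (j + 1) * mesh N) = \<xi> * (real j * mesh N) + \<xi> * mesh N"
    by (simp add: algebra_simps add_divide_distrib)
  have "cos (\<xi> * mesh N) = 1 - 2 * (sin (\<xi> * mesh N / 2))\<^sup>2"
    using cos_double_sin[of "\<xi> * mesh N / 2"] by simp
  then have e: "S (j - 1) + S (j + 1) = 2 * (1 - 2 * (sin (\<xi> * mesh N / 2))\<^sup>2) * S j"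
    unfolding S_def 1 2 sin_add sin_diff by simp
  define q b where "q = (sin (\<xi> * mesh N / 2))\<^sup>2" and "b = 1 / (mesh N)\<^sup>2"
  have b: "2 / (mesh N)\<^sup>2 = 2 * b" "4 / (mesh N)\<^sup>2 = 4 * b" by (auto simp: b_def)
  show ?thesis unfolding e symb_h_def b b_def[symmetric] q_def[symmetric]
    by (simp add: algebra_simps)
qed

context fd_mesh begin

text \<open>Summation by parts moves the second difference onto the grid sine, which is an
  eigenvector.\<close>

lemma grid_sine_coeff_fd_sol:
  assumes U: "fd_sol k f N U" and m: "m \<in> {1..<N}"
  shows "grid_sine_coeff N U (real m * pi)
    = grid_sine_coeff N (\<lambda>j. f (real j * mesh N)) (real m * pi) / symb_h k N (real m * pi)"
proof -
  define S where "S j = sin (real m * pi * (real j * mesh N))" for j :: nat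
  have S0: "S 0 = 0" "S N = 0" using N_pos by (auto simp: S_def)
  have U0: "U 0 = 0" "U N = 0" using U by (auto simp: fd_sol_def)
  have "(\<Sum>j\<in>{1..<N}. S j * f (real j * mesh N))
      = (\<Sum>j\<in>{1..<N}. (k\<^sup>2 - 2 / (mesh N)\<^sup>2) * (S j * U j) + 1 / (mesh N)\<^sup>2 * (S j * (U (j - 1) + U (j + 1))))"
  proof (intro sum.cong refl)
    fix j assume "j \<in> {1..<N}"
    then have f: "f (real j * mesh N) = (k\<^sup>2 - 2 / (mesh N)\<^sup>2) * U j + 1 / (mesh N)\<^sup>2 * U (j - 1) + 1 / (mesh N)\<^sup>2 * U (j + 1)"
      using U by (auto simp: fd_sol_def)
    show "S j * f (real j * mesh N) = (k\<^sup>2 - 2 / (mesh N)\<^sup>2) * (S j * U j) + 1 / (mesh N)\<^sup>2 * (S j * (U (j - 1) + U (j + 1)))"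
      unfolding f by (simp only: algebra_simps)
  qed
  also have "\<dots> = (\<Sum>j\<in>{1..<N}. ((k\<^sup>2 - 2 / (mesh N)\<^sup>2) * S j + 1 / (mesh N)\<^sup>2 * (S (j - 1) + S (j + 1))) * U j)"
  proof -
    have "(\<Sum>j\<in>{1..<N}. a * (S j * U j) + b * (S j * (U (j - 1) + U (j + 1))))
      = (\<Sum>j\<in>{1..<N}. (a * S j + b * (S (j - 1) + S (j + 1))) * U j)" for a b
    proof -
      have "(\<Sum>j\<in>{1..<N}. a * (S j * U j) + b * (S j * (U (j - 1) + U (j + 1))))
        = a * (\<Sum>j\<in>{1..<N}. S j * U j) + b * (\<Sum>j\<in>{1..<N}. (S (j - 1) + S (j + 1)) * U j)"
        unfolding sum.distrib sum_distrib_left[symmetric]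
          sum_by_parts_second_difference[OF U0(1) S0(2) S0(1) U0(2)] ..
      then show ?thesis by (simp only: sum_distrib_left sum.distrib[symmetric] distrib_right mult.assoc)
    qed
    then show ?thesis .
  qed
  also have "\<dots> = (\<Sum>j\<in>{1..<N}. (symb_h k N (real m * pi) * S j) * U j)"
    unfolding S_def using symb_h_eigen[OF N_pos] by (intro sum.cong refl) (metis atLeastLessThan_iff)
  finally have "(\<Sum>j\<in>{1..<N}. S j * f (real j * mesh N)) = symb_h k N (real m * pi) * (\<Sum>j\<in>{1..<N}. S j * U j)"
    by (simp only: sum_distrib_left mult.assoc)
  then have "2 * mesh N * (\<Sum>j\<in>{1..<N}. S j * f (real j * mesh N))
      = symb_h k N (real m * pi) * (2 * mesh N * (\<Sum>j\<in>{1..<N}. S j * U j))"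
    by simp
  moreover have g: "grid_sine_coeff N V (real m * pi) = 2 * mesh N * (\<Sum>j\<in>{1..<N}. S j * V j)" for V
    unfolding grid_sine_coeff_def S_def by (simp add: sum_distrib_left mult_ac)
  ultimately have "grid_sine_coeff N (\<lambda>j. f (real j * mesh N)) (real m * pi)
      = symb_h k N (real m * pi) * grid_sine_coeff N U (real m * pi)"
    by (simp only: g)
  then show ?thesis using symb_h_nonzero[OF m] by simp
qed

lemma sine_interp_fd_sol:
  assumes "fd_sol k f N U"
  shows "sine_interp N U x = (\<Sum>m\<in>{1..<N}. grid_sine_coeff N (\<lambda>j. f (real j * mesh N)) (real m * pi)
    / symb_h k N (real m * pi) * sin (real m * pi * x))"
  unfolding sine_interp_def sum_low_freqs
  by (intro sum.cong refl) (simp only: grid_sine_coeff_fd_sol[OF assms])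

lemma fd_sol_unique_values:
  assumes "fd_sol k f N U" "fd_sol k f N V" "j \<le> N"
  shows "U j = V j"
proof (cases "j = 0 \<or> j = N")
  case True
  then show ?thesis using assms by (auto simp: fd_sol_def)
next
  case False
  then have j: "j \<in> {1..<N}" using assms by auto
  have "U j = (\<Sum>m\<in>{1..<N}. grid_sine_coeff N U (real m * pi) * sin (real m * pi * (real j * mesh N)))"
    by (rule grid_sine_inversion[OF j, symmetric])
  also have "\<dots> = (\<Sum>m\<in>{1..<N}. grid_sine_coeff N V (real m * pi) * sin (real m * pi * (real j * mesh N)))"
    by (intro sum.cong refl) (simp only: grid_sine_coeff_fd_sol[OF assms(1)] grid_sine_coeff_fd_sol[OF assms(2)])
  also have "\<dots> = V j" by (rule grid_sine_inversion[OF j])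
  finally show ?thesis .
qed

lemma fd_sol_exists: "fd_sol k f N (\<lambda>j. \<Sum>m\<in>{1..<N}. grid_sine_coeff N (\<lambda>j. f (real j * mesh N)) (real m * pi)
    / symb_h k N (real m * pi) * sin (real m * pi * (real j * mesh N)))"
proof -
  define F where "F m = grid_sine_coeff N (\<lambda>j. f (real j * mesh N)) (real m * pi)" for m
  define L where "L m = symb_h k N (real m * pi)" for m
  define S where "S m j = sin (real m * pi * (real j * mesh N))" for m j :: nat
  define U where "U j = (\<Sum>m\<in>{1..<N}. F m / L m * S m j)" for j
  have "(k\<^sup>2 - 2 / (mesh N)\<^sup>2) * U j + 1 / (mesh N)\<^sup>2 * U (j - 1) + 1 / (mesh N)\<^sup>2 * U (j + 1) = f (real j * mesh N)"
    if j: "j \<in> {1..<N}" for j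
  proof -
    have "(k\<^sup>2 - 2 / (mesh N)\<^sup>2) * U j + 1 / (mesh N)\<^sup>2 * U (j - 1) + 1 / (mesh N)\<^sup>2 * U (j + 1)
      = (\<Sum>m\<in>{1..<N}. F m / L m * ((k\<^sup>2 - 2 / (mesh N)\<^sup>2) * S m j + 1 / (mesh N)\<^sup>2 * (S m (j - 1) + S m (j + 1))))"
    proof -
      have "a * U j + b * U (j - 1) + b * U (j + 1)
        = (\<Sum>m\<in>{1..<N}. F m / L m * (a * S m j + b * (S m (j - 1) + S m (j + 1))))" for a b
        unfolding U_def by (simp only: sum_distrib_left sum.distrib[symmetric] distrib_left mult.left_commute add.assoc)
      then show ?thesis .
    qed
    also have "\<dots> = (\<Sum>m\<in>{1..<N}. F m / L m * (L m * S m j))"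
      using symb_h_eigen[OF N_pos, of j] j unfolding S_def L_def
      by (intro sum.cong refl arg_cong[where f = "\<lambda>x. _ * x"]) simp
    also have "\<dots> = (\<Sum>m\<in>{1..<N}. F m * S m j)"
      using symb_h_nonzero by (intro sum.cong refl) (simp add: L_def)
    also have "\<dots> = f (real j * mesh N)"
      unfolding F_def S_def by (rule grid_sine_inversion[OF j])
    finally show ?thesis .
  qed
  moreover have "U 0 = 0" "U N = 0" using N_pos by (auto simp: U_def S_def)
  ultimately have "fd_sol k f N U" by (simp add: fd_sol_def)
  then show ?thesis by (simp add: U_def[abs_def] F_def L_def S_def)
qed

lemma fd_sol_cong:
  assumes "\<And>j. j \<le> N \<Longrightarrow> U j = V j"
  shows "fd_sol k f N U \<longleftrightarrow> fd_sol k f N V"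
proof -
  have "U (j - 1) = V (j - 1)" "U j = V j" "U (j + 1) = V (j + 1)" if "j \<in> {1..<N}" for j
    using that assms by auto
  then show ?thesis unfolding fd_sol_def by (simp only: assms order_refl zero_le cong: ball_cong)
qed

text \<open>Only the values on the grid \<open>{0..N}\<close> are determined by the scheme, so
  uniqueness refers to grid functions fixed outside of it.\<close>

lemma fd_sol_ex1: "\<exists>!U. U \<in> extensional {0..N} \<and> fd_sol k f N U"
proof -
  obtain U where U: "fd_sol k f N U" using fd_sol_exists by blast
  show ?thesis
  proof (rule ex1I)
    show "restrict U {0..N} \<in> extensional {0..N} \<and> fd_sol k f N (restrict U {0..N})"
      using U fd_sol_cong[of "restrict U {0..N}" U] by auto
  next
    fix V assume V: "V \<in> extensional {0..N} \<and> fd_sol k f N V"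
    show "V = restrict U {0..N}"
      using V fd_sol_unique_values[OF conjunct2[OF V] U] by (intro extensionalityI[of _ "{0..N}"]) auto
  qed
qed

end

section \<open>Aliasing\<close>

lemma sum_inverse_squares_le: "finite A \<Longrightarrow> 0 \<notin> A \<Longrightarrow> (\<Sum>l\<in>A. 1 / (real l)\<^sup>2) \<le> 2"
proof -
  assume A: "finite A" "0 \<notin> A"
  have b: "(\<Sum>l\<in>{1..Suc n}. 1 / (real l)\<^sup>2) \<le> 2 - 1 / real (Suc n)" for n
  proof (induction n)
    case (Suc n)
    have "1 / (real (Suc (Suc n)))\<^sup>2 \<le> 1 / real (Suc n) - 1 / real (Suc (Suc n))"
    proof -
      have "1 / (real (Suc (Suc n)))\<^sup>2 \<le> 1 / (real (Suc n) * real (Suc (Suc n)))"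
        by (intro divide_left_mono) (auto simp: power2_eq_square)
      also have "\<dots> = 1 / real (Suc n) - 1 / real (Suc (Suc n))" by (simp add: field_simps)
      finally show ?thesis .
    qed
    then show ?case using Suc by (simp add: sum.atLeast_Suc_atMost)
  qed simp
  obtain n where "A \<subseteq> {1..Suc n}"
    using finite_nat_set_iff_bounded_le[of A] A by (metis Suc_leI atLeastAtMost_iff le_SucI not_gr_zero One_nat_def subsetI)
  then have "(\<Sum>l\<in>A. 1 / (real l)\<^sup>2) \<le> (\<Sum>l\<in>{1..Suc n}. 1 / (real l)\<^sup>2)"
    by (intro sum_mono2) auto
  also have "\<dots> \<le> 2 - 1 / real (Suc n)" by (rule b)
  finally show ?thesis by (smt (verit) divide_nonneg_nonneg of_nat_0_le_iff)
qed

definition aliases :: "nat \<Rightarrow> nat \<Rightarrow> nat \<Rightarrow> bool" where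
  "aliases N j m \<longleftrightarrow> 2 * int N dvd int m - int j \<or> 2 * int N dvd int m + int j"

lemma alias_sign_abs_le: "\<bar>alias_sign N j m\<bar> \<le> of_bool (aliases N j m)"
  by (auto simp: alias_sign_def aliases_def)

text \<open>Aliases of \<open>j\<close> are congruent to \<open>j\<close> or \<open>-j\<close> modulo
  \<open>2 * N\<close>; the first residue lies in the first half of the period, the second in the other
  half.\<close>

lemma aliases_block_unique:
  assumes j: "j \<in> {1..<N}" and m: "aliases N j m" "aliases N j n" "m div N = n div N"
  shows "m = n"
proof -
  define l where "l = int (m div N)"
  have r: "int m = l * int N + int (m mod N)" "int n = l * int N + int (n mod N)"
    "m mod N < N" "n mod N < N"
    unfolding l_def using j m(3)
    by (metis div_mult_mod_eq of_nat_add of_nat_mult, metis div_mult_mod_eq m(3) of_nat_add of_nat_mult, auto)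
  have d: "int m = int n" if "2 * int N dvd int m - int n"
  proof -
    have "\<bar>int m - int n\<bar> < \<bar>2 * int N\<bar>" using r by linarith
    from small_multiple_zero[OF this that] show ?thesis by simp
  qed
  \<comment> \<open>A frequency and a mirrored one in the same block would force the offset \<open>r\<close> in the block to vanish, so that \<open>N\<close> would divide \<open>j\<close>.\<close>
  have cross: False if "2 * int N dvd int m' - int j" "2 * int N dvd int n' + int j"
    "int m' = l * int N + int r" "int n' = l * int N + int r'" "r < N" "r' < N" for m' n' r r'
  proof -
    have "2 * int N dvd (int m' - int j) + (int n' + int j)" using that(1,2) by (rule dvd_add)
    then have "2 * int N dvd 2 * int N * l + (int r + int r')" using that by (simp add: algebra_simps)
    then have "2 * int N dvd int r + int r'" by (simp add: dvd_add_right_iff)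
    then have "int r + int r' = 0" using that by (intro small_multiple_zero[of _ "2 * int N"]) auto
    then have "r = 0" by simp
    then have "int N dvd l * int N - int j" using that(1,3) by (metis add.right_neutral dvd_mult_right of_nat_0)
    then have "int N dvd int j" by (metis dvd_diff_commute dvd_minus_add dvd_triv_right dvd_add_left_iff diff_add_cancel)
    then show False using j by (auto dest: zdvd_imp_le)
  qed
  show ?thesis using m(1,2) unfolding aliases_def
  proof (elim disjE)
    assume "2 * int N dvd int m - int j" "2 * int N dvd int n - int j"
    then have "2 * int N dvd (int m - int j) - (int n - int j)" by (rule dvd_diff)
    then show ?thesis using d by simp
  next
    assume "2 * int N dvd int m + int j" "2 * int N dvd int n + int j"
    then have "2 * int N dvd (int m + int j) - (int n + int j)" by (rule dvd_diff)
    then show ?thesis using d by simp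
  qed (use cross r in blast)+
qed

lemma aliases_low_unique:
  assumes "i \<in> {1..<N}" "j \<in> {1..<N}" "aliases N i m" "aliases N j m"
  shows "i = j"
proof -
  have d: "i = j" if "2 * int N dvd int i - int j"
    using small_multiple_zero[OF _ that] assms by auto
  have s: False if "2 * int N dvd int i + int j"
    using small_multiple_zero[OF _ that] assms by auto
  show ?thesis using assms(3,4) unfolding aliases_def
  proof (elim disjE)
    assume "2 * int N dvd int m - int i" "2 * int N dvd int m - int j"
    then have "2 * int N dvd (int m - int j) - (int m - int i)" by (simp only: dvd_diff)
    then show ?thesis using d by simp
  next
    assume "2 * int N dvd int m + int i" "2 * int N dvd int m + int j"
    then have "2 * int N dvd (int m + int i) - (int m + int j)" by (simp only: dvd_diff)
    then show ?thesis using d by simp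
  next
    assume "2 * int N dvd int m - int i" "2 * int N dvd int m + int j"
    then have "2 * int N dvd (int m + int j) - (int m - int i)" by (simp only: dvd_diff)
    then show ?thesis using s by (simp add: add.commute)
  next
    assume "2 * int N dvd int m + int i" "2 * int N dvd int m - int j"
    then have "2 * int N dvd (int m + int i) - (int m - int j)" by (simp only: dvd_diff)
    then show ?thesis using s by (simp add: add.commute)
  qed
qed

text \<open>For each \<open>j\<close>, Cauchy--Schwarz with the weights $(m/N)^p$ separates the
  coefficients from the sum of the inverse squared weights over the aliases of \<open>j\<close>. The
  latter is at most $\sum_l l^{-2} \le 2$, one alias per block; and each \<open>m\<close> is an alias of
  at most one \<open>j\<close>, so summing over \<open>j\<close> counts every coefficient at most
  once.\<close>

lemma aliasing_sum_bound:
  fixes a :: "nat \<Rightarrow> real"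
  assumes N: "0 < N" and I: "finite I" "\<And>m. m \<in> I \<Longrightarrow> N \<le> m" and p: "1 \<le> p"
  shows "(\<Sum>j\<in>{1..<N}. (\<Sum>m\<in>I. a m * alias_sign N j m)\<^sup>2) \<le> 2 * (\<Sum>m\<in>I. (a m * (real m / real N) ^ p)\<^sup>2)"
proof -
  define w where "w m = (real m / real N) ^ p" for m
  define A where "A j = {m \<in> I. aliases N j m}" for j
  have finA: "finite (A j)" for j using I by (simp add: A_def)
  have w1: "1 \<le> real m / real N" if "m \<in> I" for m using I(2)[OF that] N by simp
  \<comment> \<open>The index of the block serves as the integer \<open>l\<close> with $l \le m/N \le w_m$.\<close>
  have row: "(\<Sum>m\<in>I. a m * alias_sign N j m)\<^sup>2 \<le> 2 * (\<Sum>m\<in>A j. (a m * w m)\<^sup>2)"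
    if j: "j \<in> {1..<N}" for j
  proof -
    have "\<bar>\<Sum>m\<in>I. a m * alias_sign N j m\<bar> \<le> (\<Sum>m\<in>I. \<bar>a m\<bar> * of_bool (aliases N j m))"
      by (rule order_trans[OF sum_abs])
        (auto simp: abs_mult intro!: sum_mono mult_left_mono alias_sign_abs_le)
    also have "\<dots> = (\<Sum>m\<in>A j. \<bar>a m\<bar>)"
      unfolding A_def using I by (intro sum.mono_neutral_cong_right) auto
    also have "\<dots> = (\<Sum>m\<in>A j. \<bar>a m * w m\<bar> * (1 / w m))"
      using w1 by (intro sum.cong refl) (force simp: A_def w_def abs_mult)
    finally have "(\<Sum>m\<in>I. a m * alias_sign N j m)\<^sup>2 \<le> (\<Sum>m\<in>A j. \<bar>a m * w m\<bar> * (1 / w m))\<^sup>2"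
      by (metis abs_ge_zero power2_abs power_mono)
    also have "\<dots> \<le> (\<Sum>m\<in>A j. \<bar>a m * w m\<bar>\<^sup>2) * (\<Sum>m\<in>A j. (1 / w m)\<^sup>2)"
      by (rule Cauchy_Schwarz_ineq_sum)
    also have "\<dots> \<le> (\<Sum>m\<in>A j. \<bar>a m * w m\<bar>\<^sup>2) * 2"
    proof (intro mult_left_mono sum_nonneg)
      have "(\<Sum>m\<in>A j. (1 / w m)\<^sup>2) \<le> (\<Sum>m\<in>A j. 1 / (real (m div N))\<^sup>2)"
      proof (intro sum_mono)
        fix m assume m: "m \<in> A j"
        have "1 \<le> m div N" using I(2)[of m] N m by (simp add: A_def div_greater_zero_iff Suc_le_eq)
        moreover have "real (m div N) \<le> real m / real N" by (rule of_nat_div_le_of_nat)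
        moreover have "real m / real N \<le> w m"
          unfolding w_def using w1[of m] m p by (intro self_le_power) (auto simp: A_def)
        ultimately have "(real (m div N))\<^sup>2 \<le> (w m)\<^sup>2" "0 < (real (m div N))\<^sup>2" by (auto intro!: power_mono)
        then show "(1 / w m)\<^sup>2 \<le> 1 / (real (m div N))\<^sup>2"
          unfolding power_divide by (auto intro!: divide_left_mono mult_pos_pos)
      qed
      also have "\<dots> = (\<Sum>l\<in>(\<lambda>m. m div N) ` A j. 1 / (real l)\<^sup>2)"
        by (subst sum.reindex) (auto simp: inj_on_def A_def intro: aliases_block_unique[OF j])
      also have "\<dots> \<le> 2"
        using I N finA by (intro sum_inverse_squares_le) (auto simp: A_def div_eq_0_iff dest!: I(2))
      finally show "(\<Sum>m\<in>A j. (1 / w m)\<^sup>2) \<le> 2" .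
    qed auto
    finally show ?thesis by (simp add: mult.commute)
  qed
  have "(\<Sum>j\<in>{1..<N}. (\<Sum>m\<in>I. a m * alias_sign N j m)\<^sup>2) \<le> (\<Sum>j\<in>{1..<N}. 2 * (\<Sum>m\<in>A j. (a m * w m)\<^sup>2))"
    by (intro sum_mono row)
  also have "\<dots> = 2 * (\<Sum>j\<in>{1..<N}. \<Sum>m\<in>A j. (a m * w m)\<^sup>2)" by (simp add: sum_distrib_left)
  also have "(\<Sum>j\<in>{1..<N}. \<Sum>m\<in>A j. (a m * w m)\<^sup>2) = (\<Sum>x\<in>(SIGMA j:{1..<N}. A j). (a (snd x) * w (snd x))\<^sup>2)"
    using finA by (subst sum.Sigma) (auto simp: case_prod_beta)
  also have "\<dots> = (\<Sum>m\<in>snd ` (SIGMA j:{1..<N}. A j). (a m * w m)\<^sup>2)"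
    by (subst sum.reindex) (auto simp: inj_on_def A_def intro: aliases_low_unique)
  also have "\<dots> \<le> (\<Sum>m\<in>I. (a m * w m)\<^sup>2)"
    using I by (intro sum_mono2) (auto simp: A_def)
  finally show ?thesis by (simp add: w_def)
qed

section \<open>Square-integrable functions on the unit interval\<close>

text \<open>Integrals over the open unit interval become integrals over the whole space of a finite
  measure.\<close>

definition I01 :: "real measure" where
  "I01 = restrict_space lborel {0<..<1}"

lemma space_I01 [simp]: "space I01 = {0<..<1}"
  by (simp add: I01_def space_restrict_space)

lemma I01_Int [simp]: "{0<..<1::real} \<inter> space lborel \<in> sets lborel"
  by simp

lemma set_integral_eq_I01: "(LBINT x:{0<..<1}. f x) = (\<integral>x. f x \<partial>I01)" for f :: "real \<Rightarrow> real"
  unfolding set_lebesgue_integral_def I01_def by (subst integral_restrict_space) simp_all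

lemma set_integrable_eq_I01: "set_integrable lborel {0<..<1} f \<longleftrightarrow> integrable I01 f" for f :: "real \<Rightarrow> real"
  unfolding set_integrable_def I01_def by (subst integrable_restrict_space) simp_all

lemma set_measurable_eq_I01: "set_borel_measurable lborel {0<..<1} f \<longleftrightarrow> f \<in> borel_measurable I01" for f :: "real \<Rightarrow> real"
  unfolding set_borel_measurable_def I01_def by (subst borel_measurable_restrict_space_iff) simp_all

lemmas to_I01 = set_integral_eq_I01 set_integrable_eq_I01 set_measurable_eq_I01

interpretation I01: finite_measure I01
proof
  have "emeasure I01 (space I01) = 1" unfolding I01_def
    by (simp add: emeasure_restrict_space space_restrict_space)
  then show "emeasure I01 (space I01) \<noteq> \<infinity>" by simp
qed

lemma borel_imp_I01: "f \<in> borel_measurable borel \<Longrightarrow> f \<in> borel_measurable I01"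
  unfolding I01_def by (intro measurable_restrict_space1) simp

lemma continuous_imp_I01_measurable: "continuous_on {0<..<1} f \<Longrightarrow> f \<in> borel_measurable I01" for f :: "real \<Rightarrow> real"
  using borel_measurable_continuous_on_restrict[of "{0<..<1}" f]
  by (simp add: I01_def measurable_def space_restrict_space sets_restrict_space)

lemma I01_integrable_bounded:
  assumes "f \<in> borel_measurable I01" "\<And>x. 0 < x \<Longrightarrow> x < 1 \<Longrightarrow> \<bar>f x\<bar> \<le> (B::real)"
  shows "integrable I01 f"
  by (rule I01.integrable_const_bound[of _ B]) (use assms in auto)

lemma continuous_bounded_01:
  assumes "continuous_on {0..1::real} f"
  obtains B :: real where "\<And>x. 0 \<le> x \<Longrightarrow> x \<le> 1 \<Longrightarrow> \<bar>f x\<bar> \<le> B"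
proof -
  have "bounded (f ` {0..1})"
    using assms by (intro compact_imp_bounded compact_continuous_image) auto
  then show ?thesis using that unfolding bounded_iff by (metis atLeastAtMost_iff image_eqI real_norm_def)
qed

lemma continuous_imp_I01_integrable:
  assumes "continuous_on {0..1} f"
  shows "integrable I01 (f :: real \<Rightarrow> real)"
proof -
  obtain B where "\<And>x. 0 \<le> x \<Longrightarrow> x \<le> 1 \<Longrightarrow> \<bar>f x\<bar> \<le> B" using continuous_bounded_01[OF assms] by blast
  then show ?thesis
    by (intro I01_integrable_bounded[of _ B] continuous_imp_I01_measurable continuous_on_subset[OF assms]) auto
qed

lemma I01_FTC:
  fixes F f :: "real \<Rightarrow> real"
  assumes "\<And>x. 0 \<le> x \<Longrightarrow> x \<le> 1 \<Longrightarrow> (F has_real_derivative f x) (at x)" "continuous_on {0..1} f"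
  shows "(\<integral>x. f x \<partial>I01) = F 1 - F 0"
proof -
  have "(\<integral>x. f x \<partial>I01) = integral\<^sup>L lborel (\<lambda>x. indicator {0<..<1} x *\<^sub>R f x)"
    unfolding I01_def by (subst integral_restrict_space) simp_all
  also have "\<dots> = integral\<^sup>L lborel (\<lambda>x. indicator {0..1} x *\<^sub>R f x)"
  proof (rule integral_cong_AE)
    show "(\<lambda>x. indicator {0<..<1} x *\<^sub>R f x) \<in> borel_measurable lborel"
      using borel_measurable_continuous_on_indicator[of "{0<..<1}" f] continuous_on_subset[OF assms(2), of "{0<..<1}"]
      by (simp add: greaterThanLessThan_subseteq_atLeastAtMost_iff)
    show "(\<lambda>x. indicator {0..1} x *\<^sub>R f x) \<in> borel_measurable lborel"
      using borel_measurable_continuous_on_indicator[of "{0..1}" f] assms(2) by auto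
    have "AE x in lborel. x \<noteq> (0::real)" "AE x in lborel. x \<noteq> (1::real)" by (rule AE_lborel_singleton)+
    then show "AE x in lborel. indicator {0<..<1} x *\<^sub>R f x = indicator {0..1} x *\<^sub>R f x"
      by eventually_elim (auto simp: indicator_def)
  qed
  also have "\<dots> = F 1 - F 0"
    using assms by (intro integral_FTC_atLeastAtMost)
      (auto simp: has_real_derivative_iff_has_vector_derivative[symmetric] intro: has_field_derivative_at_within)
  finally show ?thesis .
qed

lemma L2_fun_I01: "L2_fun v \<longleftrightarrow> v \<in> borel_measurable I01 \<and> integrable I01 (\<lambda>x. (v x)\<^sup>2)"
  by (simp add: L2_fun_def to_I01)

lemma L2_norm_I01: "L2_norm v = sqrt (\<integral>x. (v x)\<^sup>2 \<partial>I01)"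
  by (simp add: L2_norm_def to_I01)

lemma L2_norm_nonneg [simp]: "0 \<le> L2_norm v"
  by (simp add: L2_norm_I01)

lemma L2_norm_sq: "(L2_norm v)\<^sup>2 = (\<integral>x. (v x)\<^sup>2 \<partial>I01)"
  by (simp add: L2_norm_I01)

lemma I01_integral_cong: "(\<And>x. 0 < x \<Longrightarrow> x < 1 \<Longrightarrow> f x = g x) \<Longrightarrow> (\<integral>x. f x \<partial>I01) = (\<integral>x. g x \<partial>I01)"
  for f :: "real \<Rightarrow> real"
  by (intro Bochner_Integration.integral_cong) auto

lemma L2_norm_cong: "(\<And>x. 0 < x \<Longrightarrow> x < 1 \<Longrightarrow> f x = g x) \<Longrightarrow> L2_norm f = L2_norm g"
  unfolding L2_norm_I01 by (intro arg_cong[where f = sqrt] I01_integral_cong) auto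

lemma L2_fun_cong: "(\<And>x. 0 < x \<Longrightarrow> x < 1 \<Longrightarrow> f x = g x) \<Longrightarrow> L2_fun f \<longleftrightarrow> L2_fun g"
  unfolding L2_fun_I01 by (intro conj_cong measurable_cong Bochner_Integration.integrable_cong) auto

lemma L2_mult_integrable:
  assumes "L2_fun f" "L2_fun g"
  shows "integrable I01 (\<lambda>x. f x * g x)"
proof (rule Bochner_Integration.integrable_bound)
  show "integrable I01 (\<lambda>x. (f x)\<^sup>2 + (g x)\<^sup>2)" using assms by (auto simp: L2_fun_I01)
  show "(\<lambda>x. f x * g x) \<in> borel_measurable I01" using assms by (auto simp: L2_fun_I01)
  have "\<bar>a * b\<bar> \<le> a\<^sup>2 + b\<^sup>2" for a b :: real
  proof -
    have "2 * \<bar>a * b\<bar> \<le> a\<^sup>2 + b\<^sup>2"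
      using sum_squares_bound[of "\<bar>a\<bar>" "\<bar>b\<bar>"] by (simp add: abs_mult mult.assoc)
    then show ?thesis using abs_ge_zero[of "a * b"] by linarith
  qed
  then show "AE x in I01. norm (f x * g x) \<le> norm ((f x)\<^sup>2 + (g x)\<^sup>2)" by auto
qed

lemma L2_fun_const: "L2_fun (\<lambda>x. c)"
  unfolding L2_fun_I01 by auto

lemma L2_integrable: "L2_fun f \<Longrightarrow> integrable I01 f"
  using L2_mult_integrable[OF _ L2_fun_const[of 1]] by simp

lemma L2_fun_add: "L2_fun f \<Longrightarrow> L2_fun g \<Longrightarrow> L2_fun (\<lambda>x. f x + g x)"
  using L2_mult_integrable[of f g]
  unfolding L2_fun_I01 power2_sum by (auto simp: mult.assoc)

lemma L2_fun_scale: "L2_fun f \<Longrightarrow> L2_fun (\<lambda>x. c * f x)"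
  unfolding L2_fun_I01 power_mult_distrib by auto

lemma L2_fun_diff: "L2_fun f \<Longrightarrow> L2_fun g \<Longrightarrow> L2_fun (\<lambda>x. f x - g x)"
  using L2_fun_add[OF _ L2_fun_scale[of g "-1"]] by simp

lemma continuous_imp_L2: "continuous_on {0..1} f \<Longrightarrow> L2_fun f"
  unfolding L2_fun_I01
  by (auto intro!: continuous_imp_I01_integrable continuous_imp_I01_measurable continuous_intros
      intro: continuous_on_subset)

lemma L2_Cauchy_Schwarz:
  assumes f: "L2_fun f" and g: "L2_fun g"
  shows "\<bar>\<integral>x. f x * g x \<partial>I01\<bar> \<le> L2_norm f * L2_norm g"
proof -
  define A B C where "A = (\<integral>x. (f x)\<^sup>2 \<partial>I01)" and "B = (\<integral>x. f x * g x \<partial>I01)" and "C = (\<integral>x. (g x)\<^sup>2 \<partial>I01)"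
  have C0: "0 \<le> C" by (simp add: C_def)
  have A0: "0 \<le> A" by (simp add: A_def)
  \<comment> \<open>The square norm of \<open>f - t * g\<close> is a nonnegative quadratic polynomial in \<open>t\<close>.\<close>
  have q: "0 \<le> A - 2 * t * B + t\<^sup>2 * C" for t
  proof -
    have "0 \<le> (\<integral>x. (f x - t * g x)\<^sup>2 \<partial>I01)" by simp
    also have "\<dots> = (\<integral>x. (f x)\<^sup>2 - 2 * t * (f x * g x) + t\<^sup>2 * (g x)\<^sup>2 \<partial>I01)"
      by (intro I01_integral_cong) (simp add: power2_eq_square algebra_simps)
    also have "\<dots> = A - 2 * t * B + t\<^sup>2 * C"
      using f g L2_mult_integrable[OF f g] by (simp add: A_def B_def C_def L2_fun_I01)
    finally show ?thesis .
  qed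
  have "B\<^sup>2 \<le> A * C"
  proof (cases "C = 0")
    case True
    have "B = 0"
    proof (rule ccontr)
      assume "B \<noteq> 0"
      then show False using q[of "(A + 1) / (2 * B)"] True by (simp add: field_simps)
    qed
    then show ?thesis using A0 C0 by simp
  next
    case False
    then show ?thesis using q[of "B / C"] C0 by (simp add: field_simps power2_eq_square)
  qed
  then have "sqrt (B\<^sup>2) \<le> sqrt (A * C)" by (rule real_sqrt_le_mono)
  then show ?thesis by (simp add: A_def B_def C_def L2_norm_I01 real_sqrt_mult)
qed

lemma L2_norm_triangle:
  assumes f: "L2_fun f" and g: "L2_fun g"
  shows "L2_norm (\<lambda>x. f x + g x) \<le> L2_norm f + L2_norm g"
proof -
  have "(L2_norm (\<lambda>x. f x + g x))\<^sup>2 = (\<integral>x. (f x)\<^sup>2 + 2 * (f x * g x) + (g x)\<^sup>2 \<partial>I01)"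
    unfolding L2_norm_sq by (intro I01_integral_cong) (simp add: power2_eq_square algebra_simps)
  also have "\<dots> = (L2_norm f)\<^sup>2 + 2 * (\<integral>x. f x * g x \<partial>I01) + (L2_norm g)\<^sup>2"
    using f g L2_mult_integrable[OF f g] by (simp add: L2_norm_sq L2_fun_I01)
  also have "\<dots> \<le> (L2_norm f)\<^sup>2 + 2 * (L2_norm f * L2_norm g) + (L2_norm g)\<^sup>2"
    using L2_Cauchy_Schwarz[OF f g] by simp
  also have "\<dots> = (L2_norm f + L2_norm g)\<^sup>2" by (simp add: power2_sum)
  finally show ?thesis by (rule power2_le_imp_le) simp
qed

section \<open>Smooth cutoffs and the fundamental lemma of the calculus of variations\<close>

text \<open>Up to linear combinations the family in \<open>m\<close> is closed under differentiation,
  which is why it contains the negative powers of \<open>y\<close>.\<close>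

definition exp_bump :: "nat \<Rightarrow> real \<Rightarrow> real" where
  "exp_bump m y = (if y \<le> 0 then 0 else (1 / y) ^ m * exp (- (1 / y)))"

lemma power_le_fact_exp: "0 \<le> t \<Longrightarrow> t ^ n \<le> fact n * exp t" for t :: real
proof -
  assume t: "0 \<le> t"
  have "t ^ n /\<^sub>R fact n \<le> (\<Sum>i<Suc n. t ^ i /\<^sub>R fact i)"
    using t by (simp add: sum_nonneg)
  also have "\<dots> \<le> exp t"
    unfolding exp_def using t summable_exp_generic[of t] by (intro sum_le_suminf) auto
  finally show ?thesis by (simp add: field_simps)
qed

lemma exp_bump_bound: "\<bar>exp_bump m y\<bar> \<le> fact (m + 2) * y\<^sup>2"
proof (cases "y \<le> 0")
  case False
  then have y: "0 < y" by simp
  have "(1 / y) ^ (m + 2) \<le> fact (m + 2) * exp (1 / y)"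
    using y by (intro power_le_fact_exp) auto
  then have "(1 / y) ^ (m + 2) * exp (- (1 / y)) \<le> fact (m + 2) * exp (1 / y) * exp (- (1 / y))"
    by (intro mult_right_mono) auto
  then have "(1 / y) ^ (m + 2) * exp (- (1 / y)) \<le> fact (m + 2)"
    by (simp only: mult.assoc exp_minus_inverse mult_1_right)
  then have "(1 / y) ^ (m + 2) * exp (- (1 / y)) * y\<^sup>2 \<le> fact (m + 2) * y\<^sup>2"
    by (intro mult_right_mono) auto
  moreover have "(1 / y) ^ (m + 2) * exp (- (1 / y)) * y\<^sup>2 = exp_bump m y"
    using y by (simp add: exp_bump_def power_add power2_eq_square)
  moreover have "0 \<le> exp_bump m y" using y by (simp add: exp_bump_def)
  ultimately show ?thesis by simp
qed (simp add: exp_bump_def)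

lemma exp_bump_deriv:
  "(exp_bump m has_real_derivative exp_bump (m + 2) y - real m * exp_bump (m + 1) y) (at y)"
proof -
  consider "y < 0" | "y = 0" | "0 < y" by linarith
  then show ?thesis
  proof cases
    case 1
    have "((\<lambda>_. 0) has_real_derivative 0) (at y)" by simp
    then have "(exp_bump m has_real_derivative 0) (at y)"
      by (rule has_field_derivative_transform_within_open[of _ _ _ "{..<0}"]) (use 1 in \<open>auto simp: exp_bump_def\<close>)
    then show ?thesis using 1 by (simp add: exp_bump_def)
  next
    case 2
    have "((\<lambda>h. (exp_bump m (0 + h) - exp_bump m 0) / h) \<longlongrightarrow> 0) (at 0)"
    proof (rule Lim_null_comparison)
      have "\<bar>exp_bump m h / h\<bar> \<le> fact (m + 2) * \<bar>h\<bar>" if "h \<noteq> 0" for h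
        using exp_bump_bound[of m h] that by (simp add: abs_divide pos_divide_le_eq power2_eq_square abs_mult[symmetric] mult.assoc)
      then show "\<forall>\<^sub>F h in at 0. norm ((exp_bump m (0 + h) - exp_bump m 0) / h) \<le> fact (m + 2) * \<bar>h\<bar>"
        unfolding eventually_at by (intro exI[of _ 1]) (auto simp: exp_bump_def[of m 0])
      have "((\<lambda>h::real. fact (m + 2) * \<bar>h\<bar>) \<longlongrightarrow> fact (m + 2) * \<bar>0\<bar>) (at 0)" by (intro tendsto_intros)
      then show "((\<lambda>h::real. fact (m + 2) * \<bar>h\<bar>) \<longlongrightarrow> 0) (at 0)" by simp
    qed
    then show ?thesis using 2 by (simp add: DERIV_def exp_bump_def)
  next
    case 3
    have "((\<lambda>y. (1 / y) ^ m * exp (- (1 / y))) has_real_derivative exp_bump (m + 2) y - real m * exp_bump (m + 1) y) (at y)"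
    proof -
      define z where "z = 1 / y"
      have dz: "((\<lambda>y. 1 / y) has_real_derivative - (z ^ 2)) (at y)"
        using 3 by (auto intro!: derivative_eq_intros simp: z_def power2_eq_square)
      have de: "((\<lambda>y. exp (- (1 / y))) has_real_derivative exp (- z) * z ^ 2) (at y)"
        by (rule DERIV_cong[OF DERIV_fun_exp[OF DERIV_minus[OF dz]]]) (simp add: z_def)
      have "real m * (- (z ^ 2) * z ^ (m - Suc 0)) * exp (- z) + exp (- z) * z ^ 2 * z ^ m
        = z ^ (m + 2) * exp (- z) - real m * (z ^ (m + 1) * exp (- z))"
        by (cases m) (simp_all add: power_add power2_eq_square algebra_simps)
      with 3 show ?thesis
        by (intro DERIV_cong[OF DERIV_mult[OF DERIV_power[OF dz] de]])
          (simp add: exp_bump_def z_def[symmetric])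
    qed
    then show ?thesis
      by (rule has_field_derivative_transform_within_open[of _ _ _ "{0<..}"]) (use 3 in \<open>auto simp: exp_bump_def\<close>)
  qed
qed

text \<open>A class of functions in which every member has a derivative belonging to the class consists
  of smooth functions.\<close>

lemma smooth_by_closure:
  assumes "P f" and step: "\<And>g. P g \<Longrightarrow> \<exists>g'. P g' \<and> (\<forall>x::real. (g has_real_derivative g' x) (at x))"
  shows "(deriv ^^ n) f differentiable (at x)"
proof -
  have "P ((deriv ^^ n) f)"
  proof (induction n)
    case (Suc n)
    obtain g' where g: "P g'" "\<And>x. ((deriv ^^ n) f has_real_derivative g' x) (at x)" using step[OF Suc] by blast
    have "deriv ((deriv ^^ n) f) = g'" using g(2) by (intro ext DERIV_imp_deriv)
    then show ?case using g(1) by simp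
  qed (simp add: assms(1))
  then show ?thesis using step real_differentiable_def by metis
qed

text \<open>A class of functions closed under differentiation that contains the cutoffs below.\<close>

inductive bump_comb :: "real \<Rightarrow> real \<Rightarrow> real \<Rightarrow> real \<Rightarrow> (real \<Rightarrow> real) \<Rightarrow> bool" for a b c d where
  prod: "bump_comb a b c d (\<lambda>x. C * (exp_bump m (a * x + b) * exp_bump n (c * x + d)))"
| add: "bump_comb a b c d f \<Longrightarrow> bump_comb a b c d g \<Longrightarrow> bump_comb a b c d (\<lambda>x. f x + g x)"

lemma bump_comb_deriv:
  "bump_comb a b c d g \<Longrightarrow> \<exists>g'. bump_comb a b c d g' \<and> (\<forall>x. (g has_real_derivative g' x) (at x))"
proof (induction rule: bump_comb.induct)
  case (prod C m n)
  let ?e = "\<lambda>m x. exp_bump m (a * x + b)" and ?f = "\<lambda>n x. exp_bump n (c * x + d)"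
  have de: "(?e m has_real_derivative (?e (m + 2) x - real m * ?e (m + 1) x) * a) (at x)" for x
    by (rule DERIV_chain2[OF exp_bump_deriv]) (auto intro!: derivative_eq_intros)
  have df: "(?f n has_real_derivative (?f (n + 2) x - real n * ?f (n + 1) x) * c) (at x)" for x
    by (rule DERIV_chain2[OF exp_bump_deriv]) (auto intro!: derivative_eq_intros)
  define g' where "g' x = ((C * a) * (?e (m + 2) x * ?f n x) + (- C * a * real m) * (?e (m + 1) x * ?f n x))
     + ((C * c) * (?e m x * ?f (n + 2) x) + (- C * c * real n) * (?e m x * ?f (n + 1) x))" for x
  have "bump_comb a b c d g'" unfolding g'_def by (intro bump_comb.intros)
  moreover have "((\<lambda>x. C * (?e m x * ?f n x)) has_real_derivative g' x) (at x)" for x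
    by (rule DERIV_cong[OF DERIV_cmult[OF DERIV_mult[OF de df]]]) (simp add: g'_def algebra_simps)
  ultimately show ?case by blast
next
  case (add f g)
  then obtain f' g' where "bump_comb a b c d f'" "bump_comb a b c d g'"
    "\<forall>x. (f has_real_derivative f' x) (at x)" "\<forall>x. (g has_real_derivative g' x) (at x)" by blast
  then show ?case by (intro exI[of _ "\<lambda>x. f' x + g' x"]) (auto intro: bump_comb.add DERIV_add)
qed

text \<open>Approximates the indicator of \<open>{a..b}\<close> as \<open>n\<close> grows. The shift by
  \<open>1\<close> keeps the support at distance \<open>1/n\<close> from the endpoints, hence compact
  inside the unit interval even for \<open>a = 0\<close> and \<open>b = 1\<close>.\<close>

definition cutoff :: "real \<Rightarrow> real \<Rightarrow> nat \<Rightarrow> real \<Rightarrow> real" where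
  "cutoff a b n x = exp_bump 0 (real n * (x - a) - 1) * exp_bump 0 (real n * (b - x) - 1)"

lemma cutoff_test_fun:
  assumes "0 \<le> a" "b \<le> 1"
  shows "test_fun (cutoff a b (Suc n))"
proof -
  have "bump_comb (real (Suc n)) (- (real (Suc n) * a) - 1) (- real (Suc n)) (real (Suc n) * b - 1)
    (\<lambda>x. 1 * (exp_bump 0 (real (Suc n) * x + (- (real (Suc n) * a) - 1)) * exp_bump 0 (- real (Suc n) * x + (real (Suc n) * b - 1))))"
    by (rule bump_comb.prod)
  moreover have "cutoff a b (Suc n) = (\<lambda>x. 1 * (exp_bump 0 (real (Suc n) * x + (- (real (Suc n) * a) - 1)) * exp_bump 0 (- real (Suc n) * x + (real (Suc n) * b - 1))))"
    unfolding cutoff_def by (simp add: algebra_simps)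
  ultimately have "(deriv ^^ m) (cutoff a b (Suc n)) differentiable (at x)" for m x
    using smooth_by_closure[OF _ bump_comb_deriv] by metis
  moreover have "\<exists>K. compact K \<and> K \<subseteq> {0<..<1} \<and> (\<forall>x. x \<notin> K \<longrightarrow> cutoff a b (Suc n) x = 0)"
  proof (intro exI conjI allI impI)
    let ?K = "{a + 1 / real (Suc n)..b - 1 / real (Suc n)}"
    show "compact ?K" by simp
    have "{a + \<delta>..b - \<delta>} \<subseteq> {0<..<1}" if "0 < \<delta>" for \<delta> using assms that by auto
    then show "?K \<subseteq> {0<..<1}" by simp
    fix x assume "x \<notin> ?K"
    then have "x - a < 1 / real (Suc n) \<or> b - x < 1 / real (Suc n)" by (auto simp del: of_nat_Suc)
    then have "real (Suc n) * (x - a) - 1 \<le> 0 \<or> real (Suc n) * (b - x) - 1 \<le> 0"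
      by (auto simp: field_simps)
    then show "cutoff a b (Suc n) x = 0" by (auto simp: cutoff_def exp_bump_def)
  qed
  ultimately show ?thesis by (simp add: test_fun_def)
qed

lemma exp_bump_0_bounds: "0 \<le> exp_bump 0 y" "exp_bump 0 y \<le> 1"
  by (auto simp: exp_bump_def)

lemma exp_bump_0_tendsto: "filterlim g at_top F \<Longrightarrow> ((\<lambda>x. exp_bump 0 (g x)) \<longlongrightarrow> 1) F"
proof -
  assume g: "filterlim g at_top F"
  have "((\<lambda>x. exp (- (inverse (g x)))) \<longlongrightarrow> exp (- 0)) F"
    by (intro tendsto_intros filterlim_compose[OF tendsto_inverse_0_at_top g] filterlim_ident)
  moreover have "\<forall>\<^sub>F x in F. exp (- (inverse (g x))) = exp_bump 0 (g x)"
    using filterlim_at_top_dense[THEN iffD1, OF g, rule_format, of 0]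
    by eventually_elim (auto simp: exp_bump_def inverse_eq_divide)
  ultimately show ?thesis by (simp add: tendsto_cong)
qed

lemma cutoff_tendsto:
  assumes "x \<noteq> a" "x \<noteq> b"
  shows "(\<lambda>n. cutoff a b (Suc n) x) \<longlonglongrightarrow> indicator {a..b} x"
proof (cases "a < x \<and> x < b")
  case True
  have lim: "filterlim (\<lambda>n. real (Suc n) * c - 1) at_top sequentially" if "0 < c" for c
  proof -
    have "filterlim (\<lambda>n. real (Suc n)) at_top sequentially"
      by (rule filterlim_compose[OF filterlim_real_sequentially filterlim_Suc])
    then have "filterlim (\<lambda>n. c * real (Suc n)) at_top sequentially"
      using that by (intro filterlim_tendsto_pos_mult_at_top[OF tendsto_const])
    then have "filterlim (\<lambda>n. -1 + c * real (Suc n)) at_top sequentially"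
      by (intro filterlim_tendsto_add_at_top[OF tendsto_const])
    then show ?thesis by (simp add: algebra_simps)
  qed
  have "(\<lambda>n. cutoff a b (Suc n) x) \<longlonglongrightarrow> 1 * 1"
    unfolding cutoff_def using True by (intro tendsto_mult exp_bump_0_tendsto lim) auto
  then show ?thesis using True by simp
next
  case False
  then have "x < a \<or> b < x" using assms by auto
  then have "cutoff a b (Suc n) x = 0" for n
  proof
    assume "x < a"
    then have "real (Suc n) * (x - a) \<le> 0" by (intro mult_nonneg_nonpos) auto
    then show ?thesis by (simp add: cutoff_def exp_bump_def)
  next
    assume "b < x"
    then have "real (Suc n) * (b - x) \<le> 0" by (intro mult_nonneg_nonpos) auto
    then show ?thesis by (simp add: cutoff_def exp_bump_def)
  qed
  then show ?thesis using False assms by (auto simp: indicator_def)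
qed

text \<open>Testing with the cutoffs shows by dominated convergence that the integral over every
  interval vanishes, hence over every Borel set.\<close>

lemma fundamental_lemma_calculus_of_variations:
  assumes d: "integrable I01 d" and z: "\<And>\<phi>. test_fun \<phi> \<Longrightarrow> (\<integral>x. d x * \<phi> x \<partial>I01) = 0"
  shows "AE x in I01. d x = 0"
proof -
  have meas: "indicator A \<in> borel_measurable I01" if "A \<in> sets borel" for A :: "real set"
    using that by (intro borel_imp_I01) auto
  have intA: "integrable I01 (\<lambda>x. indicator A x * d x)" if "A \<in> sets borel" for A
  proof (rule Bochner_Integration.integrable_bound[OF d])
    show "(\<lambda>x. indicator A x * d x) \<in> borel_measurable I01"
      using meas[OF that] d by (intro borel_measurable_times) auto
  qed (auto simp: indicator_def)
  have int0: "(\<integral>x. indicator {a..b} x * d x \<partial>I01) = 0" if "0 \<le> a" "b \<le> 1" for a b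
  proof -
    have AE: "AE x in I01. x \<noteq> c" for c
      unfolding I01_def by (subst AE_restrict_space_iff) (auto intro: AE_mp[OF AE_lborel_singleton[of c]])
    have "(\<lambda>n. \<integral>x. cutoff a b (Suc n) x * d x \<partial>I01) \<longlonglongrightarrow> (\<integral>x. indicator {a..b} x * d x \<partial>I01)"
    proof (rule integral_dominated_convergence[where w = "\<lambda>x. \<bar>d x\<bar>"])
      show "(\<lambda>x. indicator {a..b} x * d x) \<in> borel_measurable I01" using intA[of "{a..b}"] by auto
      have "continuous_on UNIV (exp_bump 0)"
        using exp_bump_deriv by (intro DERIV_continuous_on) (auto intro: has_field_derivative_at_within)
      then have [measurable]: "exp_bump 0 \<in> borel_measurable borel" by (rule borel_measurable_continuous_onI)
      have "cutoff a b (Suc n) \<in> borel_measurable I01" for n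
        unfolding cutoff_def[abs_def] by (intro borel_imp_I01) measurable
      then show "(\<lambda>x. cutoff a b (Suc n) x * d x) \<in> borel_measurable I01" for n using d by auto
      show "integrable I01 (\<lambda>x. \<bar>d x\<bar>)" using d by auto
      show "AE x in I01. (\<lambda>n. cutoff a b (Suc n) x * d x) \<longlonglongrightarrow> indicator {a..b} x * d x"
        using AE[of a] AE[of b] by eventually_elim (intro tendsto_intros cutoff_tendsto)
      show "AE x in I01. norm (cutoff a b (Suc n) x * d x) \<le> \<bar>d x\<bar>" for n
      proof (rule AE_I2)
        fix x
        have "\<bar>cutoff a b (Suc n) x\<bar> \<le> 1" unfolding cutoff_def abs_mult
          using exp_bump_0_bounds by (intro mult_le_one) auto
        then show "norm (cutoff a b (Suc n) x * d x) \<le> \<bar>d x\<bar>"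
          by (simp add: abs_mult mult_left_le_one_le)
      qed
    qed
    moreover have "(\<integral>x. cutoff a b (Suc n) x * d x \<partial>I01) = 0" for n
      using z[OF cutoff_test_fun[OF that, of n]] by (simp add: mult.commute)
    ultimately show ?thesis by (simp add: LIMSEQ_const_iff)
  qed
  have all0: "(\<integral>x. indicator A x * d x \<partial>I01) = 0" if "A \<in> sets borel" for A :: "real set"
    using that
  proof (induction rule: borel_set_induct)
    case (interval a b)
    have "(\<integral>x. indicator {a..b} x * d x \<partial>I01) = (\<integral>x. indicator {max a 0..min b 1} x * d x \<partial>I01)"
      by (intro I01_integral_cong) (auto simp: indicator_def)
    then show ?case by (simp add: int0)
  next
    case (compl A)
    have "(\<integral>x. d x \<partial>I01) = (\<integral>x. indicator {0..1} x * d x \<partial>I01)"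
      by (intro I01_integral_cong) (auto simp: indicator_def)
    then have "(\<integral>x. d x \<partial>I01) = 0" by (simp add: int0)
    moreover have "(\<integral>x. indicator (- A) x * d x \<partial>I01) = (\<integral>x. d x - indicator A x * d x \<partial>I01)"
      by (intro I01_integral_cong) (auto simp: indicator_def)
    ultimately show ?case using compl d intA by simp
  next
    case (union f)
    have "(\<lambda>n. \<integral>x. indicator (\<Union>i<n. f i) x * d x \<partial>I01) \<longlonglongrightarrow> (\<integral>x. indicator (\<Union>i. f i) x * d x \<partial>I01)"
    proof (rule integral_dominated_convergence[where w = "\<lambda>x. \<bar>d x\<bar>"])
      show "(\<lambda>x. indicator (\<Union>i. f i) x * d x) \<in> borel_measurable I01" using intA[of "\<Union>i. f i"] union by auto
      show "(\<lambda>x. indicator (\<Union>i<n. f i) x * d x) \<in> borel_measurable I01" for n using intA[of "\<Union>i<n. f i"] union by auto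
      show "integrable I01 (\<lambda>x. \<bar>d x\<bar>)" using d by auto
      show "AE x in I01. (\<lambda>n. indicator (\<Union>i<n. f i) x * d x) \<longlonglongrightarrow> indicator (\<Union>i. f i) x * d x"
        by (intro AE_I2 tendsto_intros LIMSEQ_indicator_UN)
      show "AE x in I01. norm (indicator (\<Union>i<n. f i) x * d x) \<le> \<bar>d x\<bar>" for n
        by (auto simp: indicator_def)
    qed
    moreover have "(\<integral>x. indicator (\<Union>i<n. f i) x * d x \<partial>I01) = 0" for n
    proof (induction n)
      case (Suc n)
      have "f n \<inter> f i = {}" if "i < n" for i
        using union(1) that by (simp add: disjoint_family_on_def)
      then have disj: "f n \<inter> (\<Union>i<n. f i) = {}" by auto
      have "(\<integral>x. indicator (\<Union>i<Suc n. f i) x * d x \<partial>I01)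
        = (\<integral>x. indicator (f n) x * d x + indicator (\<Union>i<n. f i) x * d x \<partial>I01)"
        unfolding lessThan_Suc UN_insert
        by (intro I01_integral_cong) (simp only: indicator_add[OF disj, symmetric] distrib_right)
      also have "\<dots> = (\<integral>x. indicator (f n) x * d x \<partial>I01) + (\<integral>x. indicator (\<Union>i<n. f i) x * d x \<partial>I01)"
        using union(2) by (intro Bochner_Integration.integral_add intA) auto
      also have "\<dots> = 0" by (simp only: Suc union(3) add_0_left)
      finally show ?case .
    qed simp
    ultimately show ?case by (simp add: LIMSEQ_const_iff)
  qed simp
  show ?thesis
  proof (rule density_unique_real[OF d])
    show "integrable I01 (\<lambda>x. 0)" by simp
    fix A assume "A \<in> sets I01"
    then have "A \<in> sets borel" by (auto simp: I01_def sets_restrict_space)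
    then show "(LINT x:A|I01. d x) = (LINT x:A|I01. 0)"
      using all0[of A] by (simp add: set_lebesgue_integral_def)
  qed
qed

section \<open>Weak derivatives\<close>

lemma test_fun_deriv: "test_fun \<phi> \<Longrightarrow> (\<phi> has_real_derivative deriv \<phi> x) (at x)"
proof -
  assume "test_fun \<phi>"
  then have "(deriv ^^ 0) \<phi> differentiable (at x)" unfolding test_fun_def by blast
  then show ?thesis by (simp add: DERIV_deriv_iff_real_differentiable)
qed

lemma test_fun_deriv_closed:
  assumes "test_fun \<phi>"
  shows "test_fun (deriv \<phi>)"
proof -
  obtain K where K: "compact K" "K \<subseteq> {0<..<1}" "\<And>x. x \<notin> K \<Longrightarrow> \<phi> x = 0"
    using assms by (auto simp: test_fun_def)
  have "deriv \<phi> x = 0" if "x \<notin> K" for x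
  proof (rule DERIV_imp_deriv)
    have "((\<lambda>_. 0) has_real_derivative 0) (at x)" by simp
    then show "(\<phi> has_real_derivative 0) (at x)"
      by (rule has_field_derivative_transform_within_open[of _ _ _ "- K"])
        (use K that compact_imp_closed[OF K(1)] in auto)
  qed
  moreover have "(deriv ^^ n) (deriv \<phi>) differentiable (at x)" for n x
    using assms unfolding test_fun_def by (metis funpow_Suc_right o_apply)
  ultimately show ?thesis using K unfolding test_fun_def by blast
qed

lemma test_fun_funpow_deriv: "test_fun \<phi> \<Longrightarrow> test_fun ((deriv ^^ n) \<phi>)"
  by (induction n) (auto intro: test_fun_deriv_closed)

lemma test_fun_boundary: "test_fun \<phi> \<Longrightarrow> \<phi> 0 = 0 \<and> \<phi> 1 = 0"
  unfolding test_fun_def by (metis greaterThanLessThan_iff less_irrefl subsetD)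

lemma test_fun_continuous: "test_fun \<phi> \<Longrightarrow> continuous_on A \<phi>"
  using test_fun_deriv by (intro DERIV_continuous_on[of A \<phi> "deriv \<phi>"]) (auto intro: has_field_derivative_at_within)

lemma test_fun_L2: "test_fun \<phi> \<Longrightarrow> L2_fun \<phi>"
  by (intro continuous_imp_L2 test_fun_continuous)

lemma integration_by_parts_test_fun:
  assumes g: "\<And>x. (g has_real_derivative g' x) (at x)" "continuous_on UNIV g'" and \<phi>: "test_fun \<phi>"
  shows "(\<integral>x. g x * deriv \<phi> x \<partial>I01) = - (\<integral>x. g' x * \<phi> x \<partial>I01)"
proof -
  have cg: "continuous_on {0..1} g"
    using g by (intro DERIV_continuous_on[of _ g g']) (auto intro: has_field_derivative_at_within)
  have cg': "continuous_on {0..1} g'" using g(2) by (rule continuous_on_subset) simp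
  note c\<phi> = test_fun_continuous[OF \<phi>] test_fun_continuous[OF test_fun_deriv_closed[OF \<phi>]]
  have i: "integrable I01 (\<lambda>x. g x * deriv \<phi> x)" "integrable I01 (\<lambda>x. g' x * \<phi> x)"
    using cg cg' c\<phi> by (auto intro!: continuous_imp_I01_integrable continuous_intros)
  have "(\<integral>x. g x * deriv \<phi> x + g' x * \<phi> x \<partial>I01) = g 1 * \<phi> 1 - g 0 * \<phi> 0"
  proof (rule I01_FTC)
    show "((\<lambda>x. g x * \<phi> x) has_real_derivative g x * deriv \<phi> x + g' x * \<phi> x) (at x)" for x
      by (rule DERIV_cong[OF DERIV_mult[OF g(1) test_fun_deriv[OF \<phi>]]]) simp
    show "continuous_on {0..1} (\<lambda>x. g x * deriv \<phi> x + g' x * \<phi> x)"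
      using cg cg' c\<phi> by (intro continuous_intros)
  qed
  then show ?thesis using i test_fun_boundary[OF \<phi>] by simp
qed

definition derivative_chain :: "nat \<Rightarrow> (nat \<Rightarrow> real \<Rightarrow> real) \<Rightarrow> bool" where
  "derivative_chain q G \<longleftrightarrow> (\<forall>j<q. \<forall>x. (G j has_real_derivative G (Suc j) x) (at x)) \<and> (\<forall>j\<le>q. continuous_on UNIV (G j))"

lemma derivative_chain_by_parts:
  "derivative_chain q G \<Longrightarrow> test_fun \<phi> \<Longrightarrow>
    (\<integral>x. G 0 x * (deriv ^^ q) \<phi> x \<partial>I01) = (- 1) ^ q * (\<integral>x. G q x * \<phi> x \<partial>I01)"
proof (induction q arbitrary: G)
  case (Suc q)
  have "derivative_chain q (\<lambda>j. G (Suc j))" using Suc.prems(1) by (auto simp: derivative_chain_def)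
  from Suc.IH[OF this Suc.prems(2)]
  have IH: "(\<integral>x. G 1 x * (deriv ^^ q) \<phi> x \<partial>I01) = (- 1) ^ q * (\<integral>x. G (Suc q) x * \<phi> x \<partial>I01)" by simp
  have "(\<integral>x. G 0 x * deriv ((deriv ^^ q) \<phi>) x \<partial>I01) = - (\<integral>x. G 1 x * (deriv ^^ q) \<phi> x \<partial>I01)"
    using Suc.prems test_fun_funpow_deriv
    by (intro integration_by_parts_test_fun) (auto simp: derivative_chain_def)
  then show ?case using IH by simp
qed simp

lemma derivative_chain_L2: "derivative_chain q G \<Longrightarrow> j \<le> q \<Longrightarrow> L2_fun (G j)"
  unfolding derivative_chain_def by (intro continuous_imp_L2) (auto intro: continuous_on_subset)

lemma weak_deriv_I01: "weak_deriv q v w \<longleftrightarrow> L2_fun v \<and> L2_fun w \<and>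
  (\<forall>\<phi>. test_fun \<phi> \<longrightarrow> (\<integral>x. v x * (deriv ^^ q) \<phi> x \<partial>I01) = (- 1) ^ q * (\<integral>x. w x * \<phi> x \<partial>I01))"
  by (simp add: weak_deriv_def to_I01)

lemma weak_deriv_chain: "derivative_chain q G \<Longrightarrow> weak_deriv q (G 0) (G q)"
  unfolding weak_deriv_I01 by (auto intro: derivative_chain_L2 derivative_chain_by_parts)

lemma weak_deriv_cong:
  assumes "\<And>x. 0 < x \<Longrightarrow> x < 1 \<Longrightarrow> v x = v' x"
  shows "weak_deriv q v w \<longleftrightarrow> weak_deriv q v' w"
proof -
  have "(\<integral>x. v x * (deriv ^^ q) \<phi> x \<partial>I01) = (\<integral>x. v' x * (deriv ^^ q) \<phi> x \<partial>I01)" for \<phi>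
    using assms by (intro I01_integral_cong) simp
  then show ?thesis unfolding weak_deriv_I01 using L2_fun_cong[of v v'] assms by simp
qed

lemma seminorm_cong:
  assumes "\<And>x. 0 < x \<Longrightarrow> x < 1 \<Longrightarrow> v x = v' x"
  shows "seminorm q v = seminorm q v'"
  unfolding seminorm_def using weak_deriv_cong[OF assms] by presburger

text \<open>The difference of two weak derivatives is orthogonal to all test functions.\<close>

lemma weak_deriv_unique:
  assumes "weak_deriv q v w" "weak_deriv q v w'"
  shows "L2_norm w = L2_norm w'"
proof -
  have w: "L2_fun w" "L2_fun w'" using assms by (auto simp: weak_deriv_def)
  have "AE x in I01. w x - w' x = 0"
  proof (rule fundamental_lemma_calculus_of_variations)
    show "integrable I01 (\<lambda>x. w x - w' x)" using w by (intro L2_integrable L2_fun_diff)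
    fix \<phi> assume \<phi>: "test_fun \<phi>"
    have "(\<integral>x. w x * \<phi> x \<partial>I01) = (\<integral>x. w' x * \<phi> x \<partial>I01)"
      using assms \<phi> by (auto simp: weak_deriv_I01)
    then show "(\<integral>x. (w x - w' x) * \<phi> x \<partial>I01) = 0"
      using w test_fun_L2[OF \<phi>] by (simp add: left_diff_distrib L2_mult_integrable)
  qed
  then have "(\<integral>x. (w x)\<^sup>2 \<partial>I01) = (\<integral>x. (w' x)\<^sup>2 \<partial>I01)"
    using w by (intro integral_cong_AE) (auto simp: L2_fun_I01)
  then show ?thesis by (simp add: L2_norm_I01)
qed

text \<open>The seminorm is defined through an arbitrary choice of the weak derivative; by uniqueness
  any weak derivative computes it.\<close>

lemma seminorm_eq: "weak_deriv q v w \<Longrightarrow> seminorm q v = L2_norm w"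
  unfolding seminorm_def by (rule weak_deriv_unique[OF someI[of "weak_deriv q v" w]])

lemma seminorm_chain:
  assumes "derivative_chain q G" "\<And>x. 0 < x \<Longrightarrow> x < 1 \<Longrightarrow> v x = G 0 x"
  shows "seminorm q v = L2_norm (G q)"
  using seminorm_cong[OF assms(2)] seminorm_eq[OF weak_deriv_chain[OF assms(1)]] by simp

lemma weak_deriv_diff:
  assumes "weak_deriv q v w" "weak_deriv q v' w'"
  shows "weak_deriv q (\<lambda>x. v x - v' x) (\<lambda>x. w x - w' x)"
  unfolding weak_deriv_I01
proof (intro conjI allI impI)
  have L: "L2_fun v" "L2_fun v'" "L2_fun w" "L2_fun w'" using assms by (auto simp: weak_deriv_def)
  then show "L2_fun (\<lambda>x. v x - v' x)" "L2_fun (\<lambda>x. w x - w' x)" by (auto intro: L2_fun_diff)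
  fix \<phi> assume \<phi>: "test_fun \<phi>"
  show "(\<integral>x. (v x - v' x) * (deriv ^^ q) \<phi> x \<partial>I01) = (- 1) ^ q * (\<integral>x. (w x - w' x) * \<phi> x \<partial>I01)"
    using assms \<phi> L test_fun_L2[OF \<phi>] test_fun_L2[OF test_fun_funpow_deriv[OF \<phi>]]
    by (simp add: weak_deriv_I01 left_diff_distrib L2_mult_integrable right_diff_distrib)
qed

lemma derivative_chain_test_fun: "test_fun \<phi> \<Longrightarrow> derivative_chain q (\<lambda>j. (deriv ^^ j) \<phi>)"
  unfolding derivative_chain_def
  using test_fun_deriv[OF test_fun_funpow_deriv] test_fun_continuous[OF test_fun_funpow_deriv] by auto

lemma weak_deriv_test_fun: "test_fun \<phi> \<Longrightarrow> weak_deriv q \<phi> ((deriv ^^ q) \<phi>)"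
  using weak_deriv_chain[OF derivative_chain_test_fun, of \<phi> q] by simp

lemma sobolev_norm_ge: "j \<le> p \<Longrightarrow> seminorm j v \<le> sobolev_norm p v"
proof -
  assume j: "j \<le> p"
  have "(seminorm j v)\<^sup>2 \<le> (\<Sum>j\<le>p. (seminorm j v)\<^sup>2)"
    by (rule member_le_sum) (use j in auto)
  then have "sqrt ((seminorm j v)\<^sup>2) \<le> sobolev_norm p v"
    unfolding sobolev_norm_def by (rule real_sqrt_le_mono)
  then show ?thesis by (simp add: seminorm_def)
qed

lemma sobolev_L2: "sobolev p f \<Longrightarrow> L2_fun f"
  unfolding sobolev_def weak_deriv_def by (meson le0)

text \<open>For test functions this is repeated integration by parts without boundary terms, whatever
  the boundary values of \<open>G\<close>. Both sides are continuous with respect to the Sobolev norm,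
  in which test functions approximate \<open>f\<close>.\<close>

lemma sobolev0_by_parts:
  assumes f: "sobolev0 p f" and w: "weak_deriv p f w" and G: "derivative_chain p G"
  shows "(\<integral>x. w x * G 0 x \<partial>I01) = (- 1) ^ p * (\<integral>x. f x * G p x \<partial>I01)"
proof -
  have Lf: "L2_fun f" using f sobolev_L2 by (auto simp: sobolev0_def)
  have Lw: "L2_fun w" using w by (simp add: weak_deriv_def)
  have LG: "L2_fun (G 0)" "L2_fun (G p)" using derivative_chain_L2[OF G] by auto
  define X where "X = \<bar>(\<integral>x. w x * G 0 x \<partial>I01) - (- 1) ^ p * (\<integral>x. f x * G p x \<partial>I01)\<bar>"
  define Y where "Y = L2_norm (G 0) + L2_norm (G p)"
  have bound: "X \<le> \<epsilon> * Y" if \<epsilon>: "\<epsilon> > 0" for \<epsilon>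
  proof -
    obtain \<phi> where \<phi>: "test_fun \<phi>" "sobolev_norm p (\<lambda>x. f x - \<phi> x) < \<epsilon>"
      using f \<epsilon> unfolding sobolev0_def by blast
    let ?\<phi>p = "(deriv ^^ p) \<phi>"
    note L\<phi> = test_fun_L2[OF \<phi>(1)] test_fun_L2[OF test_fun_funpow_deriv[OF \<phi>(1)], of p]
    have "weak_deriv 0 f f" using Lf by (simp add: weak_deriv_I01)
    from seminorm_eq[OF weak_deriv_diff[OF this weak_deriv_test_fun[OF \<phi>(1)]]]
    have n0: "L2_norm (\<lambda>x. f x - \<phi> x) \<le> \<epsilon>"
      using sobolev_norm_ge[of 0 p "\<lambda>x. f x - \<phi> x"] \<phi>(2) by simp
    have np: "L2_norm (\<lambda>x. w x - ?\<phi>p x) \<le> \<epsilon>"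
      using seminorm_eq[OF weak_deriv_diff[OF w weak_deriv_test_fun[OF \<phi>(1)]]]
        sobolev_norm_ge[of p p "\<lambda>x. f x - \<phi> x"] \<phi>(2) by simp
    have e1: "(\<integral>x. ?\<phi>p x * G 0 x \<partial>I01) = (- 1) ^ p * (\<integral>x. \<phi> x * G p x \<partial>I01)"
      using derivative_chain_by_parts[OF G \<phi>(1)] by (simp add: mult.commute)
    have e2: "(\<integral>x. (w x - ?\<phi>p x) * G 0 x \<partial>I01) = (\<integral>x. w x * G 0 x \<partial>I01) - (\<integral>x. ?\<phi>p x * G 0 x \<partial>I01)"
      using Lw LG L\<phi> by (simp add: left_diff_distrib L2_mult_integrable)
    have e3: "(\<integral>x. (f x - \<phi> x) * G p x \<partial>I01) = (\<integral>x. f x * G p x \<partial>I01) - (\<integral>x. \<phi> x * G p x \<partial>I01)"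
      using Lf LG L\<phi> by (simp add: left_diff_distrib L2_mult_integrable)
    have "X = \<bar>(\<integral>x. (w x - ?\<phi>p x) * G 0 x \<partial>I01) - (- 1) ^ p * (\<integral>x. (f x - \<phi> x) * G p x \<partial>I01)\<bar>"
      unfolding X_def e1 e2 e3 right_diff_distrib by simp
    also have "\<dots> \<le> \<bar>\<integral>x. (w x - ?\<phi>p x) * G 0 x \<partial>I01\<bar> + \<bar>(- 1) ^ p * (\<integral>x. (f x - \<phi> x) * G p x \<partial>I01)\<bar>"
      by (rule abs_triangle_ineq4)
    also have "\<dots> = \<bar>\<integral>x. (w x - ?\<phi>p x) * G 0 x \<partial>I01\<bar> + \<bar>\<integral>x. (f x - \<phi> x) * G p x \<partial>I01\<bar>"
      by (simp add: abs_mult power_abs)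
    also have "\<dots> \<le> L2_norm (\<lambda>x. w x - ?\<phi>p x) * L2_norm (G 0) + L2_norm (\<lambda>x. f x - \<phi> x) * L2_norm (G p)"
      using Lw Lf LG L\<phi> by (intro add_mono L2_Cauchy_Schwarz L2_fun_diff)
    also have "\<dots> \<le> \<epsilon> * L2_norm (G 0) + \<epsilon> * L2_norm (G p)"
      using n0 np by (intro add_mono mult_right_mono) auto
    finally show ?thesis by (simp add: Y_def algebra_simps)
  qed
  have "X \<le> 0"
  proof (rule field_le_epsilon)
    fix e :: real assume "0 < e"
    have Y: "0 \<le> Y" by (simp add: Y_def)
    have "X \<le> e / (Y + 1) * Y" using \<open>0 < e\<close> Y by (intro bound) auto
    also have "\<dots> \<le> e" using \<open>0 < e\<close> Y by (simp add: field_simps)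
    finally show "X \<le> 0 + e" by simp
  qed
  then show ?thesis by (simp add: X_def)
qed

section \<open>Completeness of the sines\<close>

text \<open>Orthogonality to all sines means orthogonality to $\sin(\pi x)\cos^n(\pi x)$ for all
  \<open>n\<close>, by the addition theorem. Since polynomials in $\cos(\pi x)$ are uniformly dense,
  $d(x)\sin(\pi x)$ is orthogonal to all test functions.\<close>

lemma sines_complete:
  assumes d: "integrable I01 d" and z: "\<And>m::nat. (\<integral>x. d x * sin (real m * pi * x) \<partial>I01) = 0"
  shows "AE x in I01. d x = 0"
proof -
  have int_bdd: "integrable I01 (\<lambda>x. d x * g x)" if g: "continuous_on {0..1} g" for g
  proof -
    obtain B where B: "\<And>x. 0 \<le> x \<Longrightarrow> x \<le> 1 \<Longrightarrow> \<bar>g x\<bar> \<le> B" using continuous_bounded_01[OF g] by blast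
    have B0: "0 \<le> B" using B[of 0] by simp
    have gm: "g \<in> borel_measurable I01"
      by (intro continuous_imp_I01_measurable continuous_on_subset[OF g]) auto
    show ?thesis
    proof (rule Bochner_Integration.integrable_bound)
      show "integrable I01 (\<lambda>x. B * d x)" using d by simp
      show "(\<lambda>x. d x * g x) \<in> borel_measurable I01" using d gm by auto
      show "AE x in I01. norm (d x * g x) \<le> norm (B * d x)"
      proof (rule AE_I2)
        fix x assume "x \<in> space I01"
        then have "\<bar>g x\<bar> \<le> B" by (intro B) auto
        then have "\<bar>d x\<bar> * \<bar>g x\<bar> \<le> \<bar>d x\<bar> * B" by (intro mult_left_mono) auto
        then show "norm (d x * g x) \<le> norm (B * d x)" using B0 by (simp add: abs_mult mult.commute)
      qed
    qed
  qed
  have mono: "(\<integral>x. d x * (sin (real m * pi * x) * cos (pi * x) ^ n) \<partial>I01) = 0" for m n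
  proof (induction n arbitrary: m)
    case (Suc n)
    show ?case
    proof (cases m)
      case (Suc m')
      have *: "sin (real m * pi * x) * cos (pi * x) = (sin (real (m + 1) * pi * x) + sin (real m' * pi * x)) / 2" for x
      proof -
        have 1: "real (m + 1) * pi * x = real m * pi * x + pi * x" by (simp add: algebra_simps)
        have 2: "real m' * pi * x = real m * pi * x - pi * x" by (simp add: Suc algebra_simps)
        show ?thesis unfolding 1 2 sin_add sin_diff by simp
      qed
      then have "d x * (sin (real m * pi * x) * cos (pi * x) ^ Suc n)
        = (1 / 2) * (d x * (sin (real (m + 1) * pi * x) * cos (pi * x) ^ n)) + (1 / 2) * (d x * (sin (real m' * pi * x) * cos (pi * x) ^ n))" for x
      proof -
        have "e * (u * c ^ Suc n) = (1 / 2) * (e * (v * c ^ n)) + (1 / 2) * (e * (w * c ^ n))"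
          if "u * c = (v + w) / 2" for e u v w c :: real
        proof -
          have "e * (u * c ^ Suc n) = e * (u * c) * c ^ n" by simp
          then show ?thesis unfolding that by (simp add: algebra_simps add_divide_distrib)
        qed
        then show ?thesis by (simp only: *)
      qed
      then show ?thesis
        using Suc.IH[of "m + 1"] Suc.IH[of m'] int_bdd
        by (simp add: continuous_intros del: mult_eq_0_iff)
    qed simp
  qed (simp add: z)
  have "AE x in I01. d x * sin (pi * x) = 0"
  proof (rule fundamental_lemma_calculus_of_variations)
    show "integrable I01 (\<lambda>x. d x * sin (pi * x))" by (intro int_bdd continuous_intros)
    fix \<phi> assume \<phi>: "test_fun \<phi>"
    \<comment> \<open>The substitution $y = \cos(\pi x)$ turns the test function into a continuous function on \<open>{-1..1}\<close>.\<close>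
    define H where "H y = \<phi> (arccos y / pi)" for y
    have cH: "continuous_on {-1..1} H" unfolding H_def
      by (rule continuous_on_compose2[OF test_fun_continuous[OF \<phi>, of UNIV]]) (auto intro!: continuous_intros)
    define X where "X = (\<integral>x. d x * sin (pi * x) * \<phi> x \<partial>I01)"
    define D where "D = (\<integral>x. \<bar>d x\<bar> \<partial>I01)"
    have "\<bar>X\<bar> \<le> e * D" if e: "0 < e" for e
    proof -
      obtain g where g: "real_polynomial_function g" "\<And>y. y \<in> {-1..1} \<Longrightarrow> \<bar>H y - g y\<bar> < e"
        using Stone_Weierstrass_real_polynomial_function[OF _ cH e] by auto
      obtain a n where gs: "g = (\<lambda>y. \<Sum>i\<le>n. a i * y ^ i)" using g(1) real_polynomial_function_iff_sum by blast
      have cg: "continuous_on {0..1} (\<lambda>x. g (cos (pi * x)))" unfolding gs by (intro continuous_intros)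
      have "(\<integral>x. d x * (sin (pi * x) * g (cos (pi * x))) \<partial>I01)
        = (\<integral>x. (\<Sum>i\<le>n. a i * (d x * (sin (real 1 * pi * x) * cos (pi * x) ^ i))) \<partial>I01)"
        unfolding gs by (intro I01_integral_cong) (simp add: sum_distrib_left mult_ac)
      also have "\<dots> = (\<Sum>i\<le>n. \<integral>x. a i * (d x * (sin (real 1 * pi * x) * cos (pi * x) ^ i)) \<partial>I01)"
        by (intro Bochner_Integration.integral_sum integrable_mult_right int_bdd continuous_intros)
      also have "\<dots> = 0" using mono[of 1] by simp
      finally have g0: "(\<integral>x. d x * (sin (pi * x) * g (cos (pi * x))) \<partial>I01) = 0" .
      have ig: "integrable I01 (\<lambda>x. d x * (sin (pi * x) * g (cos (pi * x))))"
        by (intro int_bdd continuous_intros cg)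
      have i\<phi>: "integrable I01 (\<lambda>x. d x * (sin (pi * x) * \<phi> x))"
        by (intro int_bdd continuous_intros test_fun_continuous \<phi>)
      have "X = (\<integral>x. d x * (sin (pi * x) * \<phi> x) \<partial>I01) - (\<integral>x. d x * (sin (pi * x) * g (cos (pi * x))) \<partial>I01)"
        unfolding g0 by (simp add: X_def mult.assoc)
      also have "\<dots> = (\<integral>x. d x * (sin (pi * x) * (\<phi> x - g (cos (pi * x)))) \<partial>I01)"
        using ig i\<phi> by (simp add: right_diff_distrib)
      finally have "\<bar>X\<bar> = \<bar>\<integral>x. d x * (sin (pi * x) * (\<phi> x - g (cos (pi * x)))) \<partial>I01\<bar>" by simp
      also have "\<dots> \<le> (\<integral>x. \<bar>d x * (sin (pi * x) * (\<phi> x - g (cos (pi * x))))\<bar> \<partial>I01)"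
        using integral_norm_bound[of I01 "\<lambda>x. d x * (sin (pi * x) * (\<phi> x - g (cos (pi * x))))"] by simp
      also have "\<dots> \<le> (\<integral>x. e * \<bar>d x\<bar> \<partial>I01)"
      proof (rule integral_mono)
        show "integrable I01 (\<lambda>x. \<bar>d x * (sin (pi * x) * (\<phi> x - g (cos (pi * x))))\<bar>)"
          by (intro integrable_abs int_bdd continuous_intros cg test_fun_continuous \<phi>)
        show "integrable I01 (\<lambda>x. e * \<bar>d x\<bar>)" using d by simp
        fix x assume "x \<in> space I01"
        then have x: "0 < x" "x < 1" by auto
        have "arccos (cos (pi * x)) = pi * x" using x by (intro arccos_cos) auto
        then have "\<bar>\<phi> x - g (cos (pi * x))\<bar> < e" using g(2)[of "cos (pi * x)"] by (simp add: H_def)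
        then have "\<bar>sin (pi * x)\<bar> * \<bar>\<phi> x - g (cos (pi * x))\<bar> \<le> 1 * e"
          by (intro mult_mono) auto
        then have "\<bar>d x\<bar> * (\<bar>sin (pi * x)\<bar> * \<bar>\<phi> x - g (cos (pi * x))\<bar>) \<le> \<bar>d x\<bar> * e"
          by (intro mult_left_mono) auto
        then show "\<bar>d x * (sin (pi * x) * (\<phi> x - g (cos (pi * x))))\<bar> \<le> e * \<bar>d x\<bar>"
          by (simp add: abs_mult mult.commute)
      qed
      finally show ?thesis by (simp add: D_def)
    qed
    note bound = this
    have "\<bar>X\<bar> \<le> 0"
    proof (rule field_le_epsilon)
      fix e :: real assume "0 < e"
      have D: "0 \<le> D" by (simp add: D_def)
      have "\<bar>X\<bar> \<le> e / (D + 1) * D" using \<open>0 < e\<close> D by (intro bound) auto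
      also have "\<dots> \<le> e" using \<open>0 < e\<close> D by (simp add: field_simps)
      finally show "\<bar>X\<bar> \<le> 0 + e" by simp
    qed
    then show "(\<integral>x. d x * sin (pi * x) * \<phi> x \<partial>I01) = 0" by (simp add: X_def)
  qed
  moreover have "AE x in I01. sin (pi * x) \<noteq> 0"
  proof (rule AE_I2)
    fix x assume "x \<in> space I01"
    then have "0 < sin (pi * x)" by (intro sin_gt_zero) auto
    then show "sin (pi * x) \<noteq> 0" by simp
  qed
  ultimately show ?thesis by eventually_elim simp
qed

lemma AE_zero_continuous_imp_zero:
  assumes "AE x in I01. d x = 0" "continuous_on {0<..<1} d" "0 < x" "x < 1"
  shows "d x = (0::real)"
proof (rule ccontr)
  assume nz: "d x \<noteq> 0"
  define U where "U = d -` (- {0}) \<inter> {0<..<1}"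
  have "open U" unfolding U_def using assms(2)
    by (metis continuous_on_open_vimage open_Compl finite.emptyI finite.insertI finite_imp_closed open_greaterThanLessThan)
  moreover have "U \<noteq> {}" using nz assms by (auto simp: U_def)
  ultimately have "\<not> U \<in> null_sets lborel"
    using open_not_negligible[of U] by (auto simp: negligible_iff_null_sets null_sets_completionI)
  moreover have "AE x in lborel. x \<in> {0<..<1} \<longrightarrow> d x = 0"
    using assms(1) unfolding I01_def by (subst (asm) AE_restrict_space_iff) auto
  then have "AE x in lborel. x \<notin> U" by eventually_elim (auto simp: U_def)
  then have "U \<in> null_sets lborel"
    using \<open>open U\<close> by (subst (asm) AE_iff_null_sets[symmetric]) auto
  ultimately show False by blast
qed

section \<open>Sine series and their derivatives\<close>

text \<open>The \<open>q\<close>-th derivative of $\sin(m\pi x)$ divided by $(m\pi)^q$. The phase shift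
  treats sines and cosines, and the signs of the derivatives, at once.\<close>

definition trig :: "nat \<Rightarrow> nat \<Rightarrow> real \<Rightarrow> real" where
  "trig q m x = sin (real m * pi * x + real q * (pi / 2))"

text \<open>The \<open>q\<close>-th derivative of the sine series with coefficients
  \<open>a\<close>.\<close>

definition fourier :: "nat \<Rightarrow> (nat \<Rightarrow> real) \<Rightarrow> real \<Rightarrow> real" where
  "fourier q a x = (\<Sum>m. (real m * pi) ^ q * a m * trig q m x)"

text \<open>Absolute convergence of the \<open>q\<close>-th derivative. The coefficient of the vanishing
  function $\sin(0 x)$ is set to \<open>0\<close>, so that coefficients are unique.\<close>

definition abs_conv :: "nat \<Rightarrow> (nat \<Rightarrow> real) \<Rightarrow> bool" where
  "abs_conv q a \<longleftrightarrow> a 0 = 0 \<and> summable (\<lambda>m. \<bar>(real m * pi) ^ q * a m\<bar>)"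

lemma trig_0: "trig 0 m x = sin (real m * pi * x)"
  by (simp add: trig_def)

lemma trig_deriv: "(trig q m has_real_derivative real m * pi * trig (Suc q) m x) (at x)"
proof -
  have e: "real m * pi * x + real (Suc q) * (pi / 2) = (real m * pi * x + real q * (pi / 2)) + pi / 2"
    by (simp add: algebra_simps add_divide_distrib)
  have "trig (Suc q) m x = cos (real m * pi * x + real q * (pi / 2))"
    unfolding trig_def e by (simp add: sin_add)
  then show ?thesis unfolding trig_def[of q m, abs_def]
    by (auto intro!: derivative_eq_intros)
qed

lemma trig_bound: "\<bar>trig q m x\<bar> \<le> 1"
  by (simp add: trig_def)

lemma trig_continuous: "continuous_on A (trig q m)"
  unfolding trig_def by (intro continuous_intros)

lemma trig_L2: "L2_fun (trig q m)"
  by (intro continuous_imp_L2 trig_continuous)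

lemma trig_double: "trig (p + p) m x = (- 1) ^ p * sin (real m * pi * x)"
proof -
  have "real (p + p) * (pi / 2) = real p * pi" by (simp add: field_simps)
  then show ?thesis by (simp add: trig_def sin_add)
qed

lemma integral_cos_01:
  fixes l :: int
  assumes "l \<noteq> 0"
  shows "(\<integral>x. cos (of_int l * pi * x + real q * pi) \<partial>I01) = 0"
proof -
  have "(\<integral>x. cos (of_int l * pi * x + real q * pi) \<partial>I01)
    = sin (of_int l * pi * 1 + real q * pi) / (of_int l * pi) - sin (of_int l * pi * 0 + real q * pi) / (of_int l * pi)"
    by (rule I01_FTC[of "\<lambda>x. sin (of_int l * pi * x + real q * pi) / (of_int l * pi)"])
      (use assms in \<open>auto intro!: derivative_eq_intros continuous_intros\<close>)
  moreover have "sin (of_int l * pi) = 0" by (simp add: sin_zero_iff_int2)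
  ultimately show ?thesis by (simp add: sin_add)
qed

lemma trig_orthogonality:
  assumes "0 < m + n"
  shows "(\<integral>x. trig q m x * trig q n x \<partial>I01) = (if m = n then 1 / 2 else 0)"
proof -
  have e: "trig q m x * trig q n x
    = (1 / 2) * cos (of_int (int m - int n) * pi * x + real 0 * pi) - (1 / 2) * cos (of_int (int m + int n) * pi * x + real q * pi)" for x
  proof -
    define A B where "A = real m * pi * x + real q * (pi / 2)" and "B = real n * pi * x + real q * (pi / 2)"
    have 1: "of_int (int m - int n) * pi * x + real 0 * pi = A - B" by (simp add: A_def B_def algebra_simps)
    have 2: "of_int (int m + int n) * pi * x + real q * pi = A + B" by (simp add: A_def B_def field_simps)
    show ?thesis unfolding trig_def A_def[symmetric] B_def[symmetric] 1 2 cos_add cos_diff by (simp add: field_simps)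
  qed
  have i: "integrable I01 (\<lambda>x. cos (of_int l * pi * x + real q * pi))" for l q
    by (intro continuous_imp_I01_integrable continuous_intros)
  have "(\<integral>x. trig q m x * trig q n x \<partial>I01)
    = (1 / 2) * (\<integral>x. cos (of_int (int m - int n) * pi * x + real 0 * pi) \<partial>I01)
      - (1 / 2) * (\<integral>x. cos (of_int (int m + int n) * pi * x + real q * pi) \<partial>I01)"
    unfolding e using i by (subst Bochner_Integration.integral_diff) (auto simp del: of_nat_0 of_int_diff of_int_add)
  also have "(\<integral>x. cos (of_int (int m + int n) * pi * x + real q * pi) \<partial>I01) = 0"
    by (rule integral_cos_01) (use assms in auto)
  also have "(\<integral>x. cos (of_int (int m - int n) * pi * x + real 0 * pi) \<partial>I01) = (if m = n then 1 else 0)"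
  proof (cases "m = n")
    case True
    have "measure I01 {0<..<1} = 1"
      unfolding I01_def by (simp add: measure_restrict_space)
    then show ?thesis using True by simp
  next
    case False
    then show ?thesis using integral_cos_01[of "int m - int n" 0] by auto
  qed
  finally show ?thesis by (cases "m = n") simp_all
qed

lemma fourier_term_bound: "\<bar>(real m * pi) ^ q * a m * trig q m x\<bar> \<le> \<bar>(real m * pi) ^ q * a m\<bar>"
  using mult_left_mono[OF trig_bound[of q m x] abs_ge_zero[of "(real m * pi) ^ q * a m"]] by (simp add: abs_mult)

lemma fourier_summable: "abs_conv q a \<Longrightarrow> summable (\<lambda>m. (real m * pi) ^ q * a m * trig q m x)"
  unfolding abs_conv_def
  by (elim conjE, erule summable_comparison_test'[where N = 0]) (use fourier_term_bound in auto)

lemma abs_conv_mono: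
  assumes "abs_conv q a" "j \<le> q"
  shows "abs_conv j a"
  unfolding abs_conv_def
proof
  show "a 0 = 0" using assms by (simp add: abs_conv_def)
  have "summable (\<lambda>m. \<bar>(real m * pi) ^ q * a m\<bar>)" using assms by (simp add: abs_conv_def)
  then show "summable (\<lambda>m. \<bar>(real m * pi) ^ j * a m\<bar>)"
  proof (rule summable_comparison_test'[where N = 1])
    fix m :: nat assume m: "1 \<le> m"
    have "1 * 1 \<le> real m * pi" using m pi_gt3 by (intro mult_mono) auto
    then have "(real m * pi) ^ j \<le> (real m * pi) ^ q" using assms(2) by (intro power_increasing) auto
    then show "norm \<bar>(real m * pi) ^ j * a m\<bar> \<le> \<bar>(real m * pi) ^ q * a m\<bar>"
      by (auto simp: abs_mult intro!: mult_right_mono)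
  qed
qed

lemma fourier_uniform_limit:
  assumes "abs_conv q a"
  shows "uniform_limit A (\<lambda>n x. \<Sum>m<n. (real m * pi) ^ q * a m * trig q m x) (fourier q a) sequentially"
  unfolding fourier_def
  by (rule Weierstrass_m_test[where M = "\<lambda>m. \<bar>(real m * pi) ^ q * a m\<bar>"])
    (use assms fourier_term_bound in \<open>auto simp: abs_conv_def\<close>)

lemma fourier_continuous: "abs_conv q a \<Longrightarrow> continuous_on A (fourier q a)"
  by (rule uniform_limit_theorem[OF _ fourier_uniform_limit])
    (auto intro!: always_eventually continuous_intros trig_continuous)

lemma fourier_L2: "abs_conv q a \<Longrightarrow> L2_fun (fourier q a)"
  by (intro continuous_imp_L2 fourier_continuous)

lemma fourier_deriv:
  assumes "abs_conv (Suc q) a"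
  shows "(fourier q a has_real_derivative fourier (Suc q) a x) (at x)"
proof -
  have "((\<lambda>x. \<Sum>m. (real m * pi) ^ q * a m * trig q m x) has_real_derivative
      (\<Sum>m. (real m * pi) ^ Suc q * a m * trig (Suc q) m x)) (at x)"
  proof (rule has_field_derivative_series'(2)[of UNIV _ _ 0])
    show "((\<lambda>x. (real m * pi) ^ q * a m * trig q m x) has_real_derivative
      (real m * pi) ^ Suc q * a m * trig (Suc q) m x) (at x within UNIV)" for m x
      by (rule DERIV_cong[OF DERIV_cmult[OF trig_deriv]]) simp
    show "uniformly_convergent_on UNIV (\<lambda>n x. \<Sum>m<n. (real m * pi) ^ Suc q * a m * trig (Suc q) m x)"
      using fourier_uniform_limit[OF assms] by (auto simp: uniformly_convergent_on_def)
    show "summable (\<lambda>m. (real m * pi) ^ q * a m * trig q m 0)"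
      by (rule fourier_summable[OF abs_conv_mono[OF assms]]) simp
  qed auto
  then show ?thesis by (simp add: fourier_def[abs_def])
qed

lemma fourier_chain: "abs_conv q a \<Longrightarrow> derivative_chain q (\<lambda>j. fourier j a)"
  unfolding derivative_chain_def
  by (auto intro!: fourier_deriv fourier_continuous intro: abs_conv_mono Suc_leI)

text \<open>The series may be integrated termwise against \<open>h\<close> because it converges
  absolutely and \<open>h\<close> is integrable.\<close>

lemma fourier_inner:
  assumes "abs_conv q a" and h: "L2_fun h"
  shows "(\<lambda>m. (real m * pi) ^ q * a m * (\<integral>x. h x * trig q m x \<partial>I01)) sums (\<integral>x. h x * fourier q a x \<partial>I01)"
proof -
  define b where "b m = (real m * pi) ^ q * a m" for m
  have b: "summable (\<lambda>m. \<bar>b m\<bar>)" using assms by (simp add: abs_conv_def b_def)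
  have ih: "integrable I01 h" by (rule L2_integrable[OF h])
  have int: "integrable I01 (\<lambda>x. h x * (b m * trig q m x))" for m
    using L2_mult_integrable[OF h L2_fun_scale[OF trig_L2]] .
  have pt: "norm (h x * (b m * trig q m x)) \<le> \<bar>b m\<bar> * \<bar>h x\<bar>" for m x
    using mult_left_mono[OF trig_bound[of q m x], of "\<bar>b m\<bar> * \<bar>h x\<bar>"] by (simp add: abs_mult mult_ac)
  have "(\<lambda>m. \<integral>x. h x * (b m * trig q m x) \<partial>I01) sums (\<integral>x. (\<Sum>m. h x * (b m * trig q m x)) \<partial>I01)"
  proof (rule sums_integral[OF int])
    show "AE x in I01. summable (\<lambda>m. norm (h x * (b m * trig q m x)))"
      by (intro AE_I2 summable_comparison_test'[OF summable_mult2[OF b]]) (use pt in auto)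
    show "summable (\<lambda>m. \<integral>x. norm (h x * (b m * trig q m x)) \<partial>I01)"
    proof (rule summable_comparison_test'[OF summable_mult2[OF b, of "\<integral>x. \<bar>h x\<bar> \<partial>I01"], of 0])
      fix m
      have "(\<integral>x. norm (h x * (b m * trig q m x)) \<partial>I01) \<le> (\<integral>x. \<bar>b m\<bar> * \<bar>h x\<bar> \<partial>I01)"
        using int[of m] ih pt by (intro integral_mono) auto
      then show "norm (\<integral>x. norm (h x * (b m * trig q m x)) \<partial>I01) \<le> \<bar>b m\<bar> * (\<integral>x. \<bar>h x\<bar> \<partial>I01)" by simp
    qed
  qed
  moreover have "(\<Sum>m. h x * (b m * trig q m x)) = h x * fourier q a x" for x
    unfolding fourier_def b_def using fourier_summable[OF assms(1), of x] by (rule suminf_mult)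
  moreover have "(\<integral>x. h x * (b m * trig q m x) \<partial>I01) = b m * (\<integral>x. h x * trig q m x \<partial>I01)" for m
    by (subst integral_mult_right_zero[symmetric]) (intro I01_integral_cong, simp)
  ultimately show ?thesis by (simp add: b_def)
qed

lemma fourier_coeff:
  assumes "abs_conv q a"
  shows "2 * (\<integral>x. fourier q a x * trig q n x \<partial>I01) = (real n * pi) ^ q * a n"
proof (cases "n = 0")
  case False
  have "(real m * pi) ^ q * a m * (\<integral>x. trig q n x * trig q m x \<partial>I01)
      = (if m = n then (real m * pi) ^ q * a m / 2 else 0)" for m
    using trig_orthogonality[of n m q] False by simp
  then have "(\<lambda>m. if m = n then (real m * pi) ^ q * a m / 2 else 0) sums (\<integral>x. trig q n x * fourier q a x \<partial>I01)"
    using fourier_inner[OF assms trig_L2[of q n]] by simp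
  then have "(\<integral>x. trig q n x * fourier q a x \<partial>I01) = (real n * pi) ^ q * a n / 2"
    using sums_unique2 sums_single[of n "\<lambda>m. (real m * pi) ^ q * a m / 2"] by blast
  then show ?thesis by (simp add: mult.commute)
next
  case True
  have "(\<lambda>m. (real m * pi) ^ q * a m * (\<integral>x. trig q 0 x * trig q m x \<partial>I01)) sums (\<integral>x. trig q 0 x * fourier q a x \<partial>I01)"
    by (rule fourier_inner[OF assms trig_L2])
  moreover have "(real m * pi) ^ q * a m * (\<integral>x. trig q 0 x * trig q m x \<partial>I01) = 0" for m
    using trig_orthogonality[of 0 m q] assms by (cases "m = 0") (auto simp: abs_conv_def)
  ultimately have "(\<integral>x. trig q 0 x * fourier q a x \<partial>I01) = 0"
    using sums_unique2[OF _ sums_zero] by simp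
  then show ?thesis using True assms by (simp add: mult.commute abs_conv_def)
qed

lemma fourier_Parseval:
  assumes "abs_conv q a"
  shows "(\<lambda>m. ((real m * pi) ^ q * a m)\<^sup>2 / 2) sums (L2_norm (fourier q a))\<^sup>2"
proof -
  have "(\<lambda>m. (real m * pi) ^ q * a m * (\<integral>x. fourier q a x * trig q m x \<partial>I01)) sums (\<integral>x. fourier q a x * fourier q a x \<partial>I01)"
    by (rule fourier_inner[OF assms fourier_L2[OF assms]])
  moreover have "(\<integral>x. fourier q a x * trig q m x \<partial>I01) = (real m * pi) ^ q * a m / 2" for m
    using fourier_coeff[OF assms, of m] by simp
  ultimately show ?thesis unfolding L2_norm_sq by (simp add: power2_eq_square)
qed

lemma fourier_seminorm:
  assumes "abs_conv q a" "\<And>x. 0 < x \<Longrightarrow> x < 1 \<Longrightarrow> v x = fourier 0 a x"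
  shows "seminorm q v = L2_norm (fourier q a)"
  by (rule seminorm_chain[OF fourier_chain[OF assms(1)]]) (use assms in auto)

lemma sine_coeff_I01: "sine_coeff v (real m * pi) = 2 * (\<integral>x. v x * trig 0 m x \<partial>I01)"
  by (simp add: sine_coeff_def to_I01 trig_0)

lemma sine_coeff_cong: "(\<And>x. 0 < x \<Longrightarrow> x < 1 \<Longrightarrow> v x = v' x) \<Longrightarrow> sine_coeff v (real m * pi) = sine_coeff v' (real m * pi)"
  unfolding sine_coeff_I01 by (intro arg_cong[where f = "\<lambda>x. 2 * x"] I01_integral_cong) simp

lemma sine_coeff_fourier:
  assumes "abs_conv 0 a" "\<And>x. 0 < x \<Longrightarrow> x < 1 \<Longrightarrow> v x = fourier 0 a x"
  shows "sine_coeff v (real m * pi) = a m"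
  using sine_coeff_cong[of v "fourier 0 a"] assms(2) fourier_coeff[OF assms(1), of m]
  by (simp add: sine_coeff_I01)

lemma abs_conv_add: "abs_conv q a \<Longrightarrow> abs_conv q b \<Longrightarrow> abs_conv q (\<lambda>m. a m + b m)"
  unfolding abs_conv_def
proof (elim conjE, intro conjI)
  assume s: "summable (\<lambda>m. \<bar>(real m * pi) ^ q * a m\<bar>)" "summable (\<lambda>m. \<bar>(real m * pi) ^ q * b m\<bar>)"
  show "summable (\<lambda>m. \<bar>(real m * pi) ^ q * (a m + b m)\<bar>)"
    by (rule summable_comparison_test'[OF summable_add[OF s], of 0]) (simp add: distrib_left abs_triangle_ineq)
qed auto

lemma fourier_add:
  "abs_conv q a \<Longrightarrow> abs_conv q b \<Longrightarrow> fourier q (\<lambda>m. a m + b m) x = fourier q a x + fourier q b x"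
  unfolding fourier_def using fourier_summable[of q a x] fourier_summable[of q b x]
  by (subst suminf_add) (auto simp: algebra_simps)

lemma abs_conv_dominated:
  assumes "abs_conv q a" "\<And>m. (real m * pi) ^ r * \<bar>b m\<bar> \<le> C * ((real m * pi) ^ q * \<bar>a m\<bar>)" "b 0 = 0"
  shows "abs_conv r b"
  unfolding abs_conv_def
proof
  show "summable (\<lambda>m. \<bar>(real m * pi) ^ r * b m\<bar>)"
    by (rule summable_comparison_test'[of "\<lambda>m. C * \<bar>(real m * pi) ^ q * a m\<bar>" 0])
      (use assms in \<open>auto simp: abs_conv_def abs_mult intro!: summable_mult\<close>)
qed fact

definition coeffs_on :: "nat set \<Rightarrow> (nat \<Rightarrow> real) \<Rightarrow> nat \<Rightarrow> real" where
  "coeffs_on S a m = (if m \<in> S then a m else 0)"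

lemma abs_conv_coeffs_on: "abs_conv q a \<Longrightarrow> abs_conv q (coeffs_on S a)"
proof -
  assume a: "abs_conv q a"
  then show ?thesis
    by (rule abs_conv_dominated[where C = 1]) (use a in \<open>auto simp: coeffs_on_def abs_conv_def\<close>)
qed

lemma abs_conv_finite:
  assumes "finite S" "0 \<notin> S"
  shows "abs_conv q (coeffs_on S a)"
  unfolding abs_conv_def using assms
  by (auto simp: coeffs_on_def intro!: summable_finite[of S])

lemma fourier_finite:
  assumes "finite S"
  shows "fourier q (coeffs_on S a) x = (\<Sum>m\<in>S. (real m * pi) ^ q * a m * trig q m x)"
  unfolding fourier_def by (subst suminf_finite[OF assms]) (auto simp: coeffs_on_def)

lemma fourier_finite_norm:
  assumes "finite S" "0 \<notin> S"
  shows "(L2_norm (fourier q (coeffs_on S a)))\<^sup>2 = (\<Sum>m\<in>S. ((real m * pi) ^ q * a m)\<^sup>2) / 2"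
proof -
  have "(L2_norm (fourier q (coeffs_on S a)))\<^sup>2 = (\<Sum>m. ((real m * pi) ^ q * coeffs_on S a m)\<^sup>2 / 2)"
    using fourier_Parseval[OF abs_conv_finite[OF assms]] by (rule sums_unique)
  also have "\<dots> = (\<Sum>m\<in>S. ((real m * pi) ^ q * coeffs_on S a m)\<^sup>2 / 2)"
    by (rule suminf_finite[OF assms(1)]) (auto simp: coeffs_on_def)
  finally show ?thesis by (simp add: coeffs_on_def sum_divide_distrib)
qed

section \<open>Sine coefficients of Sobolev functions\<close>

lemma Bessel_inequality:
  assumes w: "L2_fun w" and S: "finite S" "0 \<notin> S" and c: "\<And>m. m \<in> S \<Longrightarrow> c m = 2 * (\<integral>x. w x * trig q m x \<partial>I01)"
  shows "(\<Sum>m\<in>S. (c m)\<^sup>2) \<le> 2 * (L2_norm w)\<^sup>2"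
proof -
  define g where "g x = (\<Sum>m\<in>S. c m * trig q m x)" for x
  have Lg: "L2_fun g" unfolding g_def by (intro continuous_imp_L2 continuous_intros trig_continuous)
  have inner: "(\<integral>x. h x * g x \<partial>I01) = (\<Sum>m\<in>S. c m * (\<integral>x. h x * trig q m x \<partial>I01))" if h: "L2_fun h" for h
  proof -
    have "(\<integral>x. h x * g x \<partial>I01) = (\<integral>x. (\<Sum>m\<in>S. c m * (h x * trig q m x)) \<partial>I01)"
      unfolding g_def by (intro I01_integral_cong) (simp add: sum_distrib_left mult_ac)
    also have "\<dots> = (\<Sum>m\<in>S. \<integral>x. c m * (h x * trig q m x) \<partial>I01)"
      by (intro Bochner_Integration.integral_sum integrable_mult_right L2_mult_integrable h trig_L2)
    finally show ?thesis by simp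
  qed
  have gt: "(\<integral>x. g x * trig q n x \<partial>I01) = c n / 2" if "n \<in> S" for n
  proof -
    have "(\<integral>x. trig q n x * g x \<partial>I01) = (\<Sum>m\<in>S. c m * (if n = m then 1 / 2 else 0))"
      unfolding inner[OF trig_L2]
      by (intro sum.cong refl) (subst trig_orthogonality, use S that in \<open>auto intro: gr0I\<close>)
    also have "\<dots> = (\<Sum>m\<in>S. if n = m then c m / 2 else 0)" by (intro sum.cong) auto
    also have "\<dots> = c n / 2" using S that by (subst sum.delta') auto
    finally show ?thesis by (simp add: mult.commute)
  qed
  have wg: "(\<integral>x. w x * g x \<partial>I01) = (\<Sum>m\<in>S. (c m)\<^sup>2) / 2"
    unfolding inner[OF w] sum_divide_distrib by (intro sum.cong) (auto simp: c power2_eq_square)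
  have gg: "(\<integral>x. g x * g x \<partial>I01) = (\<Sum>m\<in>S. (c m)\<^sup>2) / 2"
    unfolding inner[OF Lg] sum_divide_distrib by (intro sum.cong) (auto simp: gt power2_eq_square)
  have "0 \<le> (\<integral>x. (w x - g x)\<^sup>2 \<partial>I01)" by simp
  also have "\<dots> = (\<integral>x. (w x)\<^sup>2 - 2 * (w x * g x) + g x * g x \<partial>I01)"
    by (intro I01_integral_cong) (simp add: power2_eq_square algebra_simps)
  also have "\<dots> = (L2_norm w)\<^sup>2 - 2 * (\<integral>x. w x * g x \<partial>I01) + (\<integral>x. g x * g x \<partial>I01)"
    using w L2_mult_integrable[OF w Lg] L2_mult_integrable[OF Lg Lg] by (simp add: L2_norm_sq L2_fun_I01)
  finally show ?thesis using wg gg by simp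
qed

text \<open>Integration by parts against the shifted sine \<open>trig p m\<close>: differentiating it
  \<open>p\<close> more times reproduces $\sin(m\pi x)$ up to the factor $(-m\pi)^p$, as
  \<open>trig_double\<close> states.\<close>

lemma weak_deriv_trig_coeff:
  assumes f: "sobolev0 p f" and w: "weak_deriv p f w"
  shows "2 * (\<integral>x. w x * trig p m x \<partial>I01) = (real m * pi) ^ p * sine_coeff f (real m * pi)"
proof -
  define G where "G j x = (real m * pi) ^ j * trig (p + j) m x" for j x
  have "derivative_chain p G" unfolding derivative_chain_def
  proof (intro conjI allI impI)
    show "(G j has_real_derivative G (Suc j) x) (at x)" for j x
      unfolding G_def by (rule DERIV_cong[OF DERIV_cmult[OF trig_deriv]]) simp
    show "continuous_on UNIV (G j)" for j unfolding G_def by (intro continuous_intros trig_continuous)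
  qed
  from sobolev0_by_parts[OF f w this]
  have "(\<integral>x. w x * trig p m x \<partial>I01) = (- 1) ^ p * (\<integral>x. f x * ((real m * pi) ^ p * ((- 1) ^ p * sin (real m * pi * x))) \<partial>I01)"
    by (simp add: G_def trig_double)
  also have "(\<integral>x. f x * ((real m * pi) ^ p * ((- 1) ^ p * sin (real m * pi * x))) \<partial>I01)
    = (real m * pi) ^ p * (- 1) ^ p * (\<integral>x. f x * sin (real m * pi * x) \<partial>I01)"
    by (subst integral_mult_right_zero[symmetric]) (intro I01_integral_cong, simp)
  also have "(- 1) ^ p * \<dots> = ((- 1) ^ p * (- 1) ^ p) * ((real m * pi) ^ p * (\<integral>x. f x * sin (real m * pi * x) \<partial>I01))"
    by (simp only: mult_ac)
  also have "(- 1) ^ p * (- 1) ^ p = (1 :: real)" by (simp flip: power_mult_distrib)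
  finally show ?thesis by (simp add: sine_coeff_I01 trig_0)
qed

text \<open>By Bessel the numbers $c_m = (m\pi)^p a_m$ are square summable, and $|a_m| \le |c_m|/m \le
  c_m^2 + m^{-2}$.\<close>

lemma sobolev0_abs_conv:
  assumes f: "sobolev0 p f" and p: "1 \<le> p"
  shows "abs_conv 0 (\<lambda>m. sine_coeff f (real m * pi))"
proof -
  define a where "a m = sine_coeff f (real m * pi)" for m
  obtain w where w: "weak_deriv p f w" using f by (auto simp: sobolev0_def sobolev_def)
  define c where "c m = (real m * pi) ^ p * a m" for m
  have a0: "a 0 = 0" using sine_coeff_I01[of f 0] by (simp add: a_def trig_0)
  have "summable (\<lambda>m. (c (Suc m))\<^sup>2)"
  proof (rule summableI_nonneg_bounded)
    fix n
    have "(\<Sum>m\<in>{1..<Suc n}. (c m)\<^sup>2) \<le> 2 * (L2_norm w)\<^sup>2"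
      using w weak_deriv_trig_coeff[OF f w]
      by (intro Bessel_inequality[where q = p]) (auto simp: weak_deriv_def c_def a_def)
    moreover have "(\<Sum>m<n. (c (Suc m))\<^sup>2) = (\<Sum>m\<in>{1..<Suc n}. (c m)\<^sup>2)"
      by (simp only: One_nat_def sum.atLeast_Suc_lessThan_Suc_shift atLeast0LessThan) simp
    ultimately show "(\<Sum>m<n. (c (Suc m))\<^sup>2) \<le> 2 * (L2_norm w)\<^sup>2" by simp
  qed simp
  moreover have "summable (\<lambda>m. 1 / (real (Suc m))\<^sup>2)"
    using summable_ignore_initial_segment[OF inverse_power_summable[of 2, where 'a = real], of 1]
    by (simp add: inverse_eq_divide)
  ultimately have "summable (\<lambda>m. (c (Suc m))\<^sup>2 + 1 / (real (Suc m))\<^sup>2)" by (rule summable_add)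
  then have "summable (\<lambda>m. \<bar>a (Suc m)\<bar>)"
  proof (rule summable_comparison_test'[of _ 0])
    fix m
    define x where "x = real (Suc m)"
    have x: "1 \<le> x" by (simp add: x_def)
    have "1 * x \<le> pi * x" using x pi_gt3 by (intro mult_right_mono) auto
    then have xp: "x \<le> x * pi" by (simp add: mult.commute)
    have "1 \<le> x * pi" using xp x by linarith
    then have "x * pi \<le> (x * pi) ^ p" using p by (intro self_le_power) auto
    with xp have "x \<le> (x * pi) ^ p" by linarith
    then have "x * \<bar>a (Suc m)\<bar> \<le> \<bar>c (Suc m)\<bar>"
      by (auto simp: c_def x_def abs_mult intro!: mult_right_mono)
    then have 1: "\<bar>a (Suc m)\<bar> \<le> \<bar>c (Suc m)\<bar> * (1 / x)" using x by (simp add: field_simps)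
    have "2 * \<bar>c (Suc m)\<bar> * (1 / x) \<le> (c (Suc m))\<^sup>2 + (1 / x)\<^sup>2"
      using sum_squares_bound[of "\<bar>c (Suc m)\<bar>" "1 / x"] by simp
    moreover have "0 \<le> \<bar>c (Suc m)\<bar> * (1 / x)" using x by simp
    ultimately have "\<bar>c (Suc m)\<bar> * (1 / x) \<le> (c (Suc m))\<^sup>2 + (1 / x)\<^sup>2" by linarith
    with 1 show "norm \<bar>a (Suc m)\<bar> \<le> (c (Suc m))\<^sup>2 + 1 / (real (Suc m))\<^sup>2"
      by (simp add: x_def power_divide)
  qed
  then have "summable (\<lambda>m. \<bar>a m\<bar>)" using summable_Suc_iff[of "\<lambda>m. \<bar>a m\<bar>"] by simp
  then show ?thesis using a0 by (simp add: abs_conv_def a_def)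
qed

lemma sine_series_represents:
  assumes L: "L2_fun f" and c: "continuous_on {0<..<1} f" and a: "abs_conv 0 (\<lambda>m. sine_coeff f (real m * pi))"
    and x: "0 < x" "x < 1"
  shows "f x = fourier 0 (\<lambda>m. sine_coeff f (real m * pi)) x"
proof -
  define g where "g = fourier 0 (\<lambda>m. sine_coeff f (real m * pi))"
  have Lg: "L2_fun g" unfolding g_def by (rule fourier_L2[OF a])
  have "AE x in I01. f x - g x = 0"
  proof (rule sines_complete)
    show "integrable I01 (\<lambda>x. f x - g x)" by (intro L2_integrable L2_fun_diff L Lg)
    fix m :: nat
    have "2 * (\<integral>x. g x * trig 0 m x \<partial>I01) = 2 * (\<integral>x. f x * trig 0 m x \<partial>I01)"
      using fourier_coeff[OF a, of m] by (simp add: g_def sine_coeff_I01)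
    then show "(\<integral>x. (f x - g x) * sin (real m * pi * x) \<partial>I01) = 0"
      using L2_mult_integrable[OF L trig_L2[of 0 m]] L2_mult_integrable[OF Lg trig_L2[of 0 m]]
      by (simp add: left_diff_distrib trig_0)
  qed
  moreover have "continuous_on {0<..<1} (\<lambda>x. f x - g x)"
    unfolding g_def by (intro continuous_intros c fourier_continuous a)
  ultimately have "f x - g x = 0" using x by (rule AE_zero_continuous_imp_zero)
  then show ?thesis by (simp add: g_def)
qed

section \<open>The boundary value problem\<close>

text \<open>The quantities $d^\prime\cos kx + kd\sin kx$ and $d^\prime\sin kx - kd\cos kx$ are constant
  on the open interval, so \<open>d\<close> is a combination of $\sin kx$ and $\cos kx$ there; by
  continuity the boundary conditions apply to it, and $\sin k \ne 0$.\<close>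

lemma helmholtz_homogeneous:
  assumes k: "0 < k" "\<And>m::nat. k \<noteq> real m * pi"
    and d: "continuous_on {0..1} d" "d 0 = 0" "d 1 = 0"
    and d': "\<And>x. 0 < x \<Longrightarrow> x < 1 \<Longrightarrow> (d has_real_derivative d' x) (at x)"
      "\<And>x. 0 < x \<Longrightarrow> x < 1 \<Longrightarrow> (d' has_real_derivative - k\<^sup>2 * d x) (at x)"
    and x: "0 \<le> x" "x \<le> 1"
  shows "d x = (0::real)"
proof -
  define P where "P x = d' x * cos (k * x) + k * d x * sin (k * x)" for x
  define Q where "Q x = d' x * sin (k * x) - k * d x * cos (k * x)" for x
  have dP: "(P has_real_derivative 0) (at x)" if "0 < x" "x < 1" for x
    unfolding P_def using d'[OF that]
    by (auto intro!: derivative_eq_intros simp: power2_eq_square algebra_simps)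
  have dQ: "(Q has_real_derivative 0) (at x)" if "0 < x" "x < 1" for x
    unfolding Q_def using d'[OF that]
    by (auto intro!: derivative_eq_intros simp: power2_eq_square algebra_simps)
  define A B where "A = P (1/2)" and "B = Q (1/2)"
  have PA: "P x = A" "Q x = B" if "0 < x" "x < 1" for x
    unfolding A_def B_def using that dP dQ
    by (auto intro!: DERIV_isconst3[of 0 1 x "1/2"])
  define e where "e x = k * d x - (A * sin (k * x) - B * cos (k * x))" for x
  have e0: "e x = 0" if "x \<in> {0<..<1}" for x
  proof -
    have "P x * sin (k * x) - Q x * cos (k * x) = k * d x * ((sin (k * x))\<^sup>2 + (cos (k * x))\<^sup>2)"
      unfolding P_def Q_def by algebra
    then show ?thesis using PA that by (simp add: e_def)
  qed
  have "continuous_on (closure {0<..<1::real}) e"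
    unfolding e_def using d(1) by (simp add: continuous_intros)
  then have e: "e x = 0" if "0 \<le> x" "x \<le> 1" for x
    using continuous_constant_on_closure[of "{0<..<1}" e 0 x] e0 that by simp
  have B0: "B = 0" using e[of 0] d by (simp add: e_def)
  have "sin k \<noteq> 0"
  proof
    assume "sin k = 0"
    then obtain i :: int where i: "k = of_int i * pi" by (auto simp: sin_zero_iff_int2)
    then have "0 < i" using k(1) by (simp add: zero_less_mult_iff)
    then have "k = real (nat i) * pi" using i by simp
    then show False using k(2) by blast
  qed
  then have "A = 0" using e[of 1] d B0 by (simp add: e_def)
  then show ?thesis using e[OF x] B0 k(1) by (simp add: e_def)
qed

lemma helmholtz_sol_unique:
  assumes k: "0 < k" "\<And>m::nat. k \<noteq> real m * pi" and u: "helmholtz_sol k f u" and v: "helmholtz_sol k f v"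
    and x: "0 \<le> x" "x \<le> 1"
  shows "u x = v x"
proof -
  obtain u' u'' where u': "\<forall>x\<in>{0<..<1}. (u has_real_derivative u' x) (at x) \<and> (u' has_real_derivative u'' x) (at x) \<and> u'' x + k\<^sup>2 * u x = f x"
    using u by (auto simp: helmholtz_sol_def)
  obtain v' v'' where v': "\<forall>x\<in>{0<..<1}. (v has_real_derivative v' x) (at x) \<and> (v' has_real_derivative v'' x) (at x) \<and> v'' x + k\<^sup>2 * v x = f x"
    using v by (auto simp: helmholtz_sol_def)
  have "u x - v x = 0"
  proof (rule helmholtz_homogeneous[OF k _ _ _ _ _ x, where d = "\<lambda>x. u x - v x" and d' = "\<lambda>x. u' x - v' x"])
    show "continuous_on {0..1} (\<lambda>x. u x - v x)" "u 0 - v 0 = 0" "u 1 - v 1 = 0"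
      using u v by (auto simp: helmholtz_sol_def intro!: continuous_intros)
    fix x :: real assume "0 < x" "x < 1"
    then have x: "x \<in> {0<..<1}" by simp
    show "((\<lambda>x. u x - v x) has_real_derivative u' x - v' x) (at x)"
      using u' v' x by (intro DERIV_diff) auto
    have "u'' x + k\<^sup>2 * u x = f x" "v'' x + k\<^sup>2 * v x = f x" using u' v' x by auto
    then have e: "u'' x - v'' x = - k\<^sup>2 * (u x - v x)" by (simp add: algebra_simps)
    show "((\<lambda>x. u' x - v' x) has_real_derivative - k\<^sup>2 * (u x - v x)) (at x)"
      unfolding e[symmetric] using u' v' x by (intro DERIV_diff) auto
  qed
  then show ?thesis by simp
qed

section \<open>Splitting of the discretization error\<close>

text \<open>The right-hand side enters only through an absolutely convergent sine series. This covers
  both right-hand sides in $H_0^p$ and single sines, which do not belong to $H_0^p$ for $p \ge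
  2$.\<close>

locale fd_problem = fd_mesh +
  fixes f :: "real \<Rightarrow> real" and a :: "nat \<Rightarrow> real"
  assumes a_conv: "abs_conv 0 a"
    and f_series: "\<And>x. 0 < x \<Longrightarrow> x < 1 \<Longrightarrow> f x = fourier 0 a x"
begin

abbreviation low :: "nat set" where "low \<equiv> {1..<N}"

definition u_coeff :: "nat \<Rightarrow> real" where "u_coeff m = a m / symb k (real m * pi)"

definition E1_coeff :: "nat \<Rightarrow> real" where
  "E1_coeff m = (1 / symb k (real m * pi) - 1 / symb_h k N (real m * pi)) * a m"

lemma a_0: "a 0 = 0"
  using a_conv by (simp add: abs_conv_def)

text \<open>The quotient $\xi^2/|k^2-\xi^2|$ is bounded: by \<open>4/3\<close> for $\xi \ge 2k$, and on
  the finitely many remaining frequencies by their sum.\<close>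

lemma u_coeff_conv: "abs_conv 2 u_coeff"
proof -
  define r where "r m = (real m * pi)\<^sup>2 / \<bar>symb k (real m * pi)\<bar>" for m :: nat
  define M0 where "M0 = nat \<lceil>k\<rceil>"
  define C where "C = 4 / 3 + (\<Sum>m<M0. r m)"
  have r0: "0 \<le> r m" for m by (simp add: r_def)
  have "r m \<le> C" for m
  proof (cases "m < M0")
    case True
    have "r m \<le> (\<Sum>m<M0. r m)" using True r0 by (intro member_le_sum) auto
    then show ?thesis by (simp add: C_def)
  next
    case False
    then have "k \<le> real m" unfolding M0_def using k_ge by linarith
    then have "k * 2 \<le> real m * pi" using k_ge pi_gt3 by (intro mult_mono) auto
    then have "(k * 2)\<^sup>2 \<le> (real m * pi)\<^sup>2" using k_ge by (intro power_mono) auto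
    then have "k\<^sup>2 * 4 \<le> (real m * pi)\<^sup>2" by (simp only: power_mult_distrib[of k 2]) simp
    then have "3 / 4 * (real m * pi)\<^sup>2 \<le> \<bar>symb k (real m * pi)\<bar>"
      unfolding symb_def by linarith
    then have "r m \<le> 4 / 3"
      unfolding r_def using symb_nonzero[of m] by (simp add: divide_le_eq)
    then show ?thesis using sum_nonneg[of "{..<M0}" r] r0 by (simp add: C_def)
  qed
  then have "r m * \<bar>a m\<bar> \<le> C * \<bar>a m\<bar>" for m by (rule mult_right_mono) simp
  then show ?thesis
    by (intro abs_conv_dominated[OF a_conv, where C = C]) (auto simp: u_coeff_def r_def a_0)
qed

lemma u_series_boundary: "fourier 0 u_coeff 0 = 0" "fourier 0 u_coeff 1 = 0"
  by (simp_all add: fourier_def trig_0)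

lemma u_series_solves: "helmholtz_sol k f (fourier 0 u_coeff)"
  unfolding helmholtz_sol_def
proof (intro conjI exI ballI)
  show "continuous_on {0..1} (fourier 0 u_coeff)"
    by (rule fourier_continuous[OF abs_conv_mono[OF u_coeff_conv]]) simp
  show "fourier 0 u_coeff 0 = 0" "fourier 0 u_coeff 1 = 0" by (rule u_series_boundary)+
  fix x :: real assume x: "x \<in> {0<..<1}"
  have c1: "abs_conv (Suc 0) u_coeff" and c2: "abs_conv (Suc (Suc 0)) u_coeff"
    using u_coeff_conv abs_conv_mono[OF u_coeff_conv, of 1] by (auto simp: numeral_2_eq_2)
  show "(fourier 0 u_coeff has_real_derivative fourier (Suc 0) u_coeff x) (at x)"
    by (rule fourier_deriv[OF c1])
  show "(fourier (Suc 0) u_coeff has_real_derivative fourier (Suc (Suc 0)) u_coeff x) (at x)"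
    by (rule fourier_deriv[OF c2])
  have s2: "summable (\<lambda>m. (real m * pi) ^ 2 * u_coeff m * trig 2 m x)"
    by (rule fourier_summable[OF u_coeff_conv])
  have s0: "summable (\<lambda>m. (real m * pi) ^ 0 * u_coeff m * trig 0 m x)"
    by (rule fourier_summable[OF abs_conv_mono[OF u_coeff_conv]]) simp
  have "fourier 2 u_coeff x + k\<^sup>2 * fourier 0 u_coeff x
    = (\<Sum>m. (real m * pi) ^ 2 * u_coeff m * trig 2 m x + k\<^sup>2 * ((real m * pi) ^ 0 * u_coeff m * trig 0 m x))"
    unfolding fourier_def using s2 s0 by (subst suminf_mult[symmetric]) (auto intro: suminf_add summable_mult)
  also have "\<dots> = fourier 0 a x"
    unfolding fourier_def
  proof (intro suminf_cong)
    fix m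
    have t2: "trig 2 m x = - trig 0 m x" using trig_double[of 1 m x] by (simp add: trig_0 numeral_2_eq_2)
    have "(real m * pi) ^ 2 * u_coeff m * trig 2 m x + k\<^sup>2 * ((real m * pi) ^ 0 * u_coeff m * trig 0 m x)
      = symb k (real m * pi) * u_coeff m * trig 0 m x"
      unfolding t2 symb_def by (simp add: algebra_simps)
    then show "(real m * pi) ^ 2 * u_coeff m * trig 2 m x + k\<^sup>2 * ((real m * pi) ^ 0 * u_coeff m * trig 0 m x)
      = (real m * pi) ^ 0 * a m * trig 0 m x"
      using symb_nonzero[of m] by (simp add: u_coeff_def)
  qed
  also have "\<dots> = f x" using x f_series by simp
  finally show "fourier (Suc (Suc 0)) u_coeff x + k\<^sup>2 * fourier 0 u_coeff x = f x"
    by (simp add: numeral_2_eq_2)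
qed

lemma helmholtz_sol_series:
  assumes "helmholtz_sol k f u" "0 \<le> x" "x \<le> 1"
  shows "u x = fourier 0 u_coeff x"
  using k_ge nonres by (intro helmholtz_sol_unique[OF _ _ assms(1) u_series_solves assms(2,3)]) auto

lemma sine_coeff_f: "sine_coeff f (real m * pi) = a m"
  by (rule sine_coeff_fourier[OF a_conv f_series])

lemma sine_coeff_u: "helmholtz_sol k f u \<Longrightarrow> sine_coeff u (real m * pi) = u_coeff m"
  by (rule sine_coeff_fourier[OF abs_conv_mono[OF u_coeff_conv]]) (auto intro: helmholtz_sol_series)

lemma finite_low: "finite low" "0 \<notin> low" by auto

lemma low_part_f: "low_part N f = fourier 0 (coeffs_on low a)"
  by (rule ext) (simp add: low_part_def sum_low_freqs sine_coeff_f fourier_finite trig_0 mult.assoc)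

lemma low_part_u: "helmholtz_sol k f u \<Longrightarrow> low_part N u = fourier 0 (coeffs_on low u_coeff)"
  by (rule ext) (simp add: low_part_def sum_low_freqs sine_coeff_u fourier_finite trig_0 mult.assoc)

lemma E1_series: "E1 k N f = fourier 0 (coeffs_on low E1_coeff)"
  by (rule ext) (simp add: E1_def sum_low_freqs sine_coeff_f fourier_finite trig_0 E1_coeff_def mult.assoc)

lemma high_part_series: "high_part N f = fourier 0 (coeffs_on {N..} a)"
proof
  fix x
  have "(\<Sum>m. (real m * pi) ^ 0 * coeffs_on {N..} a m * trig 0 m x)
    = (\<Sum>m. (real (m + N) * pi) ^ 0 * coeffs_on {N..} a (m + N) * trig 0 (m + N) x)
      + (\<Sum>m<N. (real m * pi) ^ 0 * coeffs_on {N..} a m * trig 0 m x)"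
    by (rule suminf_split_initial_segment[OF fourier_summable[OF abs_conv_coeffs_on[OF a_conv]]])
  also have "(\<Sum>m<N. (real m * pi) ^ 0 * coeffs_on {N..} a m * trig 0 m x) = 0"
    by (intro sum.neutral) (auto simp: coeffs_on_def)
  finally show "high_part N f x = fourier 0 (coeffs_on {N..} a) x"
    unfolding fourier_def high_part_def sine_coeff_f by (simp add: coeffs_on_def trig_0 add.commute)
qed

lemma f_split: "0 < x \<Longrightarrow> x < 1 \<Longrightarrow> f x = low_part N f x + high_part N f x"
proof -
  assume x: "0 < x" "x < 1"
  have "a = (\<lambda>m. coeffs_on low a m + coeffs_on {N..} a m)"
    by (rule ext) (auto simp: coeffs_on_def a_0 not_le not_less Suc_le_eq)
  then have "fourier 0 a x = fourier 0 (coeffs_on low a) x + fourier 0 (coeffs_on {N..} a) x"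
    using fourier_add[OF abs_conv_coeffs_on[OF a_conv, of low] abs_conv_coeffs_on[OF a_conv, of "{N..}"], of x] by simp
  then show ?thesis using f_series[OF x] by (simp add: low_part_f high_part_series)
qed

text \<open>The contribution of the high frequencies of \<open>f\<close> to the discrete sine
  coefficient at \<open>m * pi\<close>.\<close>

definition alias_coeff :: "nat \<Rightarrow> real" where
  "alias_coeff m = grid_sine_coeff N (\<lambda>j. high_part N f (real j * mesh N)) (real m * pi)"

lemma grid_sine_coeff_f:
  assumes m: "m \<in> low"
  shows "grid_sine_coeff N (\<lambda>j. f (real j * mesh N)) (real m * pi) = a m + alias_coeff m"
proof -
  have "grid_sine_coeff N (\<lambda>j. f (real j * mesh N)) (real m * pi)
    = grid_sine_coeff N (\<lambda>j. low_part N f (real j * mesh N) + high_part N f (real j * mesh N)) (real m * pi)"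
    unfolding grid_sine_coeff_def
    by (intro arg_cong[where f = "\<lambda>x. 2 * x"] sum.cong refl) (subst f_split, auto simp: field_simps)
  also have "\<dots> = grid_sine_coeff N (\<lambda>j. low_part N f (real j * mesh N)) (real m * pi) + alias_coeff m"
    by (simp add: alias_coeff_def grid_sine_coeff_def sum.distrib distrib_left)
  also have "grid_sine_coeff N (\<lambda>j. low_part N f (real j * mesh N)) (real m * pi) = (\<Sum>n\<in>low. a n * alias_sign N m n)"
    unfolding grid_sine_coeff_sum[OF N_pos, symmetric]
    by (simp add: low_part_f fourier_finite trig_0)
  also have "\<dots> = (\<Sum>n\<in>low. if n = m then a n else 0)"
    using m by (intro sum.cong) (auto simp: alias_sign_low)
  also have "\<dots> = a m" using m by (subst sum.delta) auto
  finally show ?thesis .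
qed

lemma alias_coeff_limit:
  "(\<lambda>L. \<Sum>n\<in>{N..<L}. a n * alias_sign N m n) \<longlonglongrightarrow> alias_coeff m"
proof -
  have lim: "(\<lambda>L. \<Sum>n\<in>{N..<L}. a n * sin (real n * pi * x)) \<longlonglongrightarrow> high_part N f x" for x
  proof -
    have "(\<lambda>L. \<Sum>n<L. (real n * pi) ^ 0 * coeffs_on {N..} a n * trig 0 n x) \<longlonglongrightarrow> high_part N f x"
      using fourier_summable[OF abs_conv_coeffs_on[OF a_conv, of "{N..}"], of x]
      unfolding high_part_series fourier_def by (rule summable_LIMSEQ)
    moreover have "(\<Sum>n<L. (real n * pi) ^ 0 * coeffs_on {N..} a n * trig 0 n x) = (\<Sum>n\<in>{N..<L}. a n * sin (real n * pi * x))" for L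
      by (rule sum.mono_neutral_cong_right) (auto simp: coeffs_on_def trig_0)
    ultimately show ?thesis by simp
  qed
  have "(\<lambda>L. grid_sine_coeff N (\<lambda>j. \<Sum>n\<in>{N..<L}. a n * sin (real n * pi * (real j * mesh N))) (real m * pi)) \<longlonglongrightarrow> alias_coeff m"
    unfolding alias_coeff_def grid_sine_coeff_def by (intro tendsto_intros lim)
  then show ?thesis by (simp only: grid_sine_coeff_sum[OF N_pos])
qed

text \<open>The finite aliasing estimate passes to the limit in the truncation \<open>L\<close>.\<close>

lemma alias_coeff_bound:
  assumes p: "1 \<le> p" and B: "\<And>L. (\<Sum>n\<in>{N..<L}. ((real n * pi) ^ p * a n)\<^sup>2) \<le> B"
  shows "(\<Sum>m\<in>low. (alias_coeff m)\<^sup>2) \<le> 2 * B / ((real N * pi) ^ p)\<^sup>2"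
proof (rule LIMSEQ_le_const2)
  show "(\<lambda>L. \<Sum>m\<in>low. (\<Sum>n\<in>{N..<L}. a n * alias_sign N m n)\<^sup>2) \<longlonglongrightarrow> (\<Sum>m\<in>low. (alias_coeff m)\<^sup>2)"
    by (intro tendsto_intros alias_coeff_limit)
  have "(\<Sum>m\<in>low. (\<Sum>n\<in>{N..<L}. a n * alias_sign N m n)\<^sup>2) \<le> 2 * B / ((real N * pi) ^ p)\<^sup>2" for L
  proof -
    have "(\<Sum>m\<in>low. (\<Sum>n\<in>{N..<L}. a n * alias_sign N m n)\<^sup>2)
      \<le> 2 * (\<Sum>n\<in>{N..<L}. (a n * (real n / real N) ^ p)\<^sup>2)"
      by (rule aliasing_sum_bound[OF N_pos _ _ p]) auto
    also have "\<dots> = 2 * (\<Sum>n\<in>{N..<L}. ((real n * pi) ^ p * a n)\<^sup>2) / ((real N * pi) ^ p)\<^sup>2"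
    proof -
      have "(a n * (real n / real N) ^ p)\<^sup>2 = ((real n * pi) ^ p * a n)\<^sup>2 / ((real N * pi) ^ p)\<^sup>2" for n
        using N_pos by (simp add: power_mult_distrib power_divide field_simps)
      then show ?thesis by (simp only: sum_divide_distrib[symmetric] times_divide_eq_right)
    qed
    also have "\<dots> \<le> 2 * B / ((real N * pi) ^ p)\<^sup>2"
      using B[of L] by (intro divide_right_mono) auto
    finally show ?thesis .
  qed
  then show "\<exists>K. \<forall>L\<ge>K. (\<Sum>m\<in>low. (\<Sum>n\<in>{N..<L}. a n * alias_sign N m n)\<^sup>2) \<le> 2 * B / ((real N * pi) ^ p)\<^sup>2" by blast
qed

definition alias_err_coeff :: "nat \<Rightarrow> real" where
  "alias_err_coeff m = - alias_coeff m / symb_h k N (real m * pi)"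

lemma error_series:
  assumes u: "helmholtz_sol k f u" and U: "fd_sol k f N U" and x: "0 < x" "x < 1"
  shows "u x - sine_interp N U x = fourier 0 (\<lambda>m. coeffs_on {N..} u_coeff m + (coeffs_on low E1_coeff m + coeffs_on low alias_err_coeff m)) x"
proof -
  define b where "b m = - ((a m + alias_coeff m) / symb_h k N (real m * pi))" for m
  have uc: "abs_conv 0 u_coeff" by (rule abs_conv_mono[OF u_coeff_conv]) simp
  have bc: "abs_conv 0 (coeffs_on low b)" by (rule abs_conv_finite[OF finite_low])
  have "sine_interp N U x = - fourier 0 (coeffs_on low b) x"
    unfolding sine_interp_fd_sol[OF U] fourier_finite[OF finite_low(1)] sum_negf[symmetric]
    by (intro sum.cong refl) (simp only: grid_sine_coeff_f b_def trig_0, simp)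
  then have "u x - sine_interp N U x = fourier 0 u_coeff x + fourier 0 (coeffs_on low b) x"
    using helmholtz_sol_series[OF u, of x] x by simp
  also have "\<dots> = fourier 0 (\<lambda>m. u_coeff m + coeffs_on low b m) x"
    by (rule fourier_add[OF uc bc, symmetric])
  also have "(\<lambda>m. u_coeff m + coeffs_on low b m) = (\<lambda>m. coeffs_on {N..} u_coeff m + (coeffs_on low E1_coeff m + coeffs_on low alias_err_coeff m))"
  proof
    fix m
    consider "m = 0" | "m \<in> low" | "m \<ge> N" by force
    then show "u_coeff m + coeffs_on low b m = coeffs_on {N..} u_coeff m + (coeffs_on low E1_coeff m + coeffs_on low alias_err_coeff m)"
    proof cases
      case 1
      then show ?thesis using N_pos by (simp add: coeffs_on_def u_coeff_def a_0)
    next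
      case 2
      then show ?thesis
        by (simp add: coeffs_on_def u_coeff_def b_def E1_coeff_def alias_err_coeff_def left_diff_distrib add_divide_distrib diff_divide_distrib)
    next
      case 3
      then show ?thesis by (simp add: coeffs_on_def)
    qed
  qed
  finally show ?thesis .
qed

end

section \<open>Norms of the parts of the error\<close>

lemma partial_sum_le_norm:
  assumes "abs_conv q b" "finite S"
  shows "(\<Sum>m\<in>S. ((real m * pi) ^ q * b m)\<^sup>2) / 2 \<le> (L2_norm (fourier q b))\<^sup>2"
proof -
  note P = fourier_Parseval[OF assms(1)]
  have "(\<Sum>m\<in>S. ((real m * pi) ^ q * b m)\<^sup>2 / 2) \<le> (\<Sum>m. ((real m * pi) ^ q * b m)\<^sup>2 / 2)"
    using P assms(2) by (intro sum_le_suminf) (auto simp: sums_iff)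
  then show ?thesis using P by (simp add: sums_iff sum_divide_distrib)
qed

context fd_problem begin

text \<open>The size of the symbol at the first unresolved frequency: an upper bound for it on low and a
  lower bound on high frequencies.\<close>

definition symb_gap :: real where "symb_gap = (real N * pi)\<^sup>2 - k\<^sup>2"

lemma symb_gap_ge: "3 * k\<^sup>2 \<le> symb_gap"
proof -
  have "k * 2 \<le> real N * pi"
  proof -
    have "k * 2 \<le> real N * 3" using k_le_N by simp
    also have "\<dots> \<le> real N * pi" using pi_gt3 by (intro mult_left_mono) auto
    finally show ?thesis .
  qed
  then have "(k * 2)\<^sup>2 \<le> (real N * pi)\<^sup>2" using k_ge by (intro power_mono) auto
  then show ?thesis unfolding symb_gap_def power_mult_distrib[of k 2] by simp
qed

lemma symb_gap_pos: "0 < symb_gap"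
  using symb_gap_ge k_ge by (smt (verit) zero_less_power)

lemma symb_low_le: "m \<in> low \<Longrightarrow> \<bar>symb k (real m * pi)\<bar> \<le> symb_gap"
proof -
  assume "m \<in> low"
  then have "(real m * pi)\<^sup>2 \<le> (real N * pi)\<^sup>2" by (intro power_mono mult_right_mono) auto
  then show ?thesis using symb_gap_ge zero_le_power2[of k] zero_le_power2[of "real m * pi"]
    unfolding symb_def symb_gap_def abs_le_iff by linarith
qed

lemma symb_high_ge: "N \<le> m \<Longrightarrow> symb_gap \<le> \<bar>symb k (real m * pi)\<bar>"
proof -
  assume "N \<le> m"
  then have "(real N * pi)\<^sup>2 \<le> (real m * pi)\<^sup>2" by (intro power_mono mult_right_mono) auto
  then show ?thesis unfolding symb_def symb_gap_def by linarith
qed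

lemma u_conv: "q \<le> 2 \<Longrightarrow> abs_conv q u_coeff"
  by (rule abs_conv_mono[OF u_coeff_conv])

lemma low_f_norm_le:
  assumes "q \<le> 2"
  shows "L2_norm (fourier q (coeffs_on low a)) \<le> symb_gap * L2_norm (fourier q u_coeff)"
proof (rule power2_le_imp_le)
  have "(L2_norm (fourier q (coeffs_on low a)))\<^sup>2 = (\<Sum>m\<in>low. ((real m * pi) ^ q * a m)\<^sup>2) / 2"
    by (rule fourier_finite_norm[OF finite_low])
  also have "\<dots> \<le> (\<Sum>m\<in>low. symb_gap\<^sup>2 * ((real m * pi) ^ q * u_coeff m)\<^sup>2) / 2"
  proof (intro divide_right_mono sum_mono)
    fix m assume m: "m \<in> low"
    have "a m = symb k (real m * pi) * u_coeff m" using symb_nonzero[of m] by (simp add: u_coeff_def)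
    then have "((real m * pi) ^ q * a m)\<^sup>2 = \<bar>symb k (real m * pi)\<bar>\<^sup>2 * ((real m * pi) ^ q * u_coeff m)\<^sup>2"
      by (simp add: power_mult_distrib)
    also have "\<dots> \<le> symb_gap\<^sup>2 * ((real m * pi) ^ q * u_coeff m)\<^sup>2"
      using symb_low_le[OF m] by (intro mult_right_mono power_mono) auto
    finally show "((real m * pi) ^ q * a m)\<^sup>2 \<le> symb_gap\<^sup>2 * ((real m * pi) ^ q * u_coeff m)\<^sup>2" .
  qed simp
  also have "\<dots> = symb_gap\<^sup>2 * ((\<Sum>m\<in>low. ((real m * pi) ^ q * u_coeff m)\<^sup>2) / 2)"
    by (simp add: sum_distrib_left)
  also have "\<dots> \<le> symb_gap\<^sup>2 * (L2_norm (fourier q u_coeff))\<^sup>2"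
    by (intro mult_left_mono partial_sum_le_norm u_conv assms) auto
  finally show "(L2_norm (fourier q (coeffs_on low a)))\<^sup>2 \<le> (symb_gap * L2_norm (fourier q u_coeff))\<^sup>2"
    by (simp add: power_mult_distrib)
qed (use symb_gap_pos in simp)

lemma high_u_norm_le:
  assumes q: "q \<le> 2" "q \<le> p" and B: "\<And>L. (\<Sum>n\<in>{N..<L}. ((real n * pi) ^ p * a n)\<^sup>2) \<le> 2 * F\<^sup>2" and F: "0 \<le> F"
  shows "L2_norm (fourier q (coeffs_on {N..} u_coeff)) \<le> F / (symb_gap * (real N * pi) ^ (p - q))"
proof (rule power2_le_imp_le)
  define d where "d = symb_gap * (real N * pi) ^ (p - q)"
  have d: "0 < d" using symb_gap_pos N_pos by (simp add: d_def)
  note P = fourier_Parseval[OF abs_conv_coeffs_on[OF u_conv[OF q(1)], of "{N..}"]]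
  have "(\<Sum>m. ((real m * pi) ^ q * coeffs_on {N..} u_coeff m)\<^sup>2 / 2) \<le> (F / d)\<^sup>2"
  proof (rule suminf_le_const)
    show "summable (\<lambda>m. ((real m * pi) ^ q * coeffs_on {N..} u_coeff m)\<^sup>2 / 2)" using P by (simp add: sums_iff)
    fix L
    have "(\<Sum>m<L. ((real m * pi) ^ q * coeffs_on {N..} u_coeff m)\<^sup>2 / 2) = (\<Sum>m\<in>{N..<L}. ((real m * pi) ^ q * u_coeff m)\<^sup>2 / 2)"
      by (rule sum.mono_neutral_cong_right) (auto simp: coeffs_on_def)
    also have "\<dots> \<le> (\<Sum>m\<in>{N..<L}. ((real m * pi) ^ p * a m)\<^sup>2 / d\<^sup>2 / 2)"
    proof (intro sum_mono divide_right_mono)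
      fix m assume "m \<in> {N..<L}"
      then have m: "N \<le> m" by simp
      have "d * (real m * pi) ^ q = symb_gap * ((real N * pi) ^ (p - q) * (real m * pi) ^ q)"
        by (simp add: d_def mult.assoc)
      also have "\<dots> \<le> \<bar>symb k (real m * pi)\<bar> * ((real m * pi) ^ (p - q) * (real m * pi) ^ q)"
        using symb_high_ge[OF m] m symb_gap_pos by (intro mult_mono power_mono mult_right_mono mult_nonneg_nonneg) auto
      also have "(real m * pi) ^ (p - q) * (real m * pi) ^ q = (real m * pi) ^ p"
        using q by (simp flip: power_add)
      finally have "d * (real m * pi) ^ q * \<bar>u_coeff m\<bar> \<le> \<bar>symb k (real m * pi)\<bar> * (real m * pi) ^ p * \<bar>u_coeff m\<bar>"
        by (rule mult_right_mono) simp
      also have "\<dots> = \<bar>(real m * pi) ^ p * a m\<bar>"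
        using symb_nonzero[of m] by (simp add: u_coeff_def abs_mult abs_divide)
      finally have "\<bar>d * ((real m * pi) ^ q * u_coeff m)\<bar> \<le> \<bar>(real m * pi) ^ p * a m\<bar>"
        using d by (simp add: abs_mult mult.assoc)
      then have "d\<^sup>2 * ((real m * pi) ^ q * u_coeff m)\<^sup>2 \<le> ((real m * pi) ^ p * a m)\<^sup>2"
        by (simp only: power_mult_distrib[symmetric] abs_le_square_iff)
      then show "((real m * pi) ^ q * u_coeff m)\<^sup>2 \<le> ((real m * pi) ^ p * a m)\<^sup>2 / d\<^sup>2"
        using d by (simp add: field_simps)
    qed simp
    also have "\<dots> = (\<Sum>m\<in>{N..<L}. ((real m * pi) ^ p * a m)\<^sup>2) / (2 * d\<^sup>2)"
      by (simp add: sum_divide_distrib mult.commute)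
    also have "\<dots> \<le> 2 * F\<^sup>2 / (2 * d\<^sup>2)" by (intro divide_right_mono B) auto
    finally show "(\<Sum>m<L. ((real m * pi) ^ q * coeffs_on {N..} u_coeff m)\<^sup>2 / 2) \<le> (F / d)\<^sup>2"
      by (simp add: power_divide)
  qed
  then show "(L2_norm (fourier q (coeffs_on {N..} u_coeff)))\<^sup>2 \<le> (F / (symb_gap * (real N * pi) ^ (p - q)))\<^sup>2"
    using P by (simp add: sums_iff d_def)
qed (use F symb_gap_pos in simp)

text \<open>Here \<open>c\<close> bounds the multiplier $\xi^q/\lambda^h(\xi)$ and \<open>F\<close>
  stands for $|f_{high}|_p$.\<close>

lemma alias_err_norm_le:
  assumes p: "1 \<le> p" and B: "\<And>L. (\<Sum>n\<in>{N..<L}. ((real n * pi) ^ p * a n)\<^sup>2) \<le> 2 * F\<^sup>2" and F: "0 \<le> F"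
    and c: "0 \<le> c" "\<And>m. m \<in> low \<Longrightarrow> (real m * pi) ^ q \<le> c * \<bar>symb_h k N (real m * pi)\<bar>"
  shows "L2_norm (fourier q (coeffs_on low alias_err_coeff)) \<le> c * (2 * F / (real N * pi) ^ p)"
proof (rule power2_le_imp_le)
  have "(L2_norm (fourier q (coeffs_on low alias_err_coeff)))\<^sup>2 = (\<Sum>m\<in>low. ((real m * pi) ^ q * alias_err_coeff m)\<^sup>2) / 2"
    by (rule fourier_finite_norm[OF finite_low])
  also have "\<dots> \<le> (\<Sum>m\<in>low. c\<^sup>2 * (alias_coeff m)\<^sup>2) / 2"
  proof (intro divide_right_mono sum_mono)
    fix m assume m: "m \<in> low"
    have "(real m * pi) ^ q * \<bar>alias_err_coeff m\<bar> \<le> c * \<bar>symb_h k N (real m * pi)\<bar> * \<bar>alias_err_coeff m\<bar>"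
      using c(2)[OF m] by (rule mult_right_mono) simp
    also have "\<dots> = \<bar>c * alias_coeff m\<bar>"
      using symb_h_nonzero[OF m] c(1) by (simp add: alias_err_coeff_def abs_mult abs_divide)
    finally have "\<bar>(real m * pi) ^ q * alias_err_coeff m\<bar> \<le> \<bar>c * alias_coeff m\<bar>"
      by (simp add: abs_mult)
    then show "((real m * pi) ^ q * alias_err_coeff m)\<^sup>2 \<le> c\<^sup>2 * (alias_coeff m)\<^sup>2"
      by (simp only: power_mult_distrib[symmetric, of c] abs_le_square_iff)
  qed simp
  also have "\<dots> = c\<^sup>2 / 2 * (\<Sum>m\<in>low. (alias_coeff m)\<^sup>2)" by (simp flip: sum_distrib_left)
  also have "\<dots> \<le> c\<^sup>2 / 2 * (2 * (2 * F\<^sup>2) / ((real N * pi) ^ p)\<^sup>2)"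
    by (intro mult_left_mono alias_coeff_bound p B) auto
  also have "\<dots> = 2 * (c\<^sup>2 * F\<^sup>2 / ((real N * pi) ^ p)\<^sup>2)" by simp
  also have "\<dots> \<le> 4 * (c\<^sup>2 * F\<^sup>2 / ((real N * pi) ^ p)\<^sup>2)" by (intro mult_right_mono) auto
  also have "\<dots> = (c * (2 * F / (real N * pi) ^ p))\<^sup>2" by (simp add: power_mult_distrib power_divide)
  finally show "(L2_norm (fourier q (coeffs_on low alias_err_coeff)))\<^sup>2 \<le> (c * (2 * F / (real N * pi) ^ p))\<^sup>2" .
qed (use F c in simp)

definition err_coeff :: "nat \<Rightarrow> real" where
  "err_coeff m = coeffs_on {N..} u_coeff m + (coeffs_on low E1_coeff m + coeffs_on low alias_err_coeff m)"

lemma low_conv: "abs_conv q (coeffs_on low b)"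
  by (rule abs_conv_finite[OF finite_low])

lemma err_conv: "q \<le> 2 \<Longrightarrow> abs_conv q err_coeff"
  unfolding err_coeff_def by (intro abs_conv_add low_conv abs_conv_coeffs_on u_conv)

lemma err_norm_triangle:
  assumes q: "q \<le> 2"
  shows "L2_norm (fourier q err_coeff) \<le> L2_norm (fourier q (coeffs_on {N..} u_coeff))
    + (L2_norm (fourier q (coeffs_on low E1_coeff)) + L2_norm (fourier q (coeffs_on low alias_err_coeff)))"
proof -
  have c: "abs_conv q (coeffs_on {N..} u_coeff)" by (intro abs_conv_coeffs_on u_conv q)
  have "fourier q err_coeff = (\<lambda>x. fourier q (coeffs_on {N..} u_coeff) x
      + (fourier q (coeffs_on low E1_coeff) x + fourier q (coeffs_on low alias_err_coeff) x))"
    unfolding err_coeff_def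
    by (rule ext) (simp only: fourier_add[OF c abs_conv_add[OF low_conv low_conv]] fourier_add[OF low_conv low_conv])
  then have "L2_norm (fourier q err_coeff) \<le> L2_norm (fourier q (coeffs_on {N..} u_coeff))
      + L2_norm (\<lambda>x. fourier q (coeffs_on low E1_coeff) x + fourier q (coeffs_on low alias_err_coeff) x)"
    by (simp only:) (intro L2_norm_triangle fourier_L2 L2_fun_add c low_conv)
  also have "\<dots> \<le> L2_norm (fourier q (coeffs_on {N..} u_coeff))
    + (L2_norm (fourier q (coeffs_on low E1_coeff)) + L2_norm (fourier q (coeffs_on low alias_err_coeff)))"
    by (intro add_left_mono L2_norm_triangle fourier_L2 low_conv)
  finally show ?thesis .
qed

lemma low_norm_pos:
  assumes "\<exists>x\<in>{0<..<1}. low_part N f x \<noteq> 0"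
  shows "0 < L2_norm (fourier q (coeffs_on low a))"
proof -
  obtain x where x: "low_part N f x \<noteq> 0" using assms by blast
  have "\<exists>m\<in>low. a m \<noteq> 0"
  proof (rule ccontr)
    assume "\<not> (\<exists>m\<in>low. a m \<noteq> 0)"
    then have "low_part N f x = 0" by (simp add: low_part_f fourier_finite)
    with x show False by simp
  qed
  then obtain m where m: "m \<in> low" "a m \<noteq> 0" by blast
  have "0 < (\<Sum>m\<in>low. ((real m * pi) ^ q * a m)\<^sup>2)"
    using m by (intro sum_pos2[of low m]) auto
  then have "0 < (L2_norm (fourier q (coeffs_on low a)))\<^sup>2"
    unfolding fourier_finite_norm[OF finite_low] by simp
  then show ?thesis using L2_norm_nonneg[of "fourier q (coeffs_on low a)"] by (simp add: order.order_iff_strict)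
qed

lemma u_norm_pos:
  assumes "\<exists>x\<in>{0<..<1}. low_part N f x \<noteq> 0" "q \<le> 2"
  shows "0 < L2_norm (fourier q u_coeff)"
proof -
  have "0 < symb_gap * L2_norm (fourier q u_coeff)"
    using low_norm_pos[OF assms(1), of q] low_f_norm_le[OF assms(2)] by linarith
  then show ?thesis using symb_gap_pos by (simp add: zero_less_mult_iff)
qed

text \<open>Covers the estimates of the error and of its derivative at once. Replacing $|u|_q$ by
  $|f_{low}|_q/\Lambda$ in the denominators, with the gap $\Lambda$, cancels the $\Lambda$ in the bound
  for the high part of \<open>u\<close>, and leaves $\Lambda \le (N\pi)^2$ in front of the aliasing
  term.\<close>

lemma relative_error_bound:
  assumes nz: "\<exists>x\<in>{0<..<1}. low_part N f x \<noteq> 0" and q: "q \<le> 2" "q \<le> p" and p: "1 \<le> p"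
    and B: "\<And>L. (\<Sum>n\<in>{N..<L}. ((real n * pi) ^ p * a n)\<^sup>2) \<le> 2 * F\<^sup>2" and F: "0 \<le> F"
    and c: "0 \<le> c" "\<And>m. m \<in> low \<Longrightarrow> (real m * pi) ^ q \<le> c * \<bar>symb_h k N (real m * pi)\<bar>"
  shows "L2_norm (fourier q err_coeff) / L2_norm (fourier q u_coeff)
    \<le> (1 / (real N * pi) ^ (p - q) + 2 * c * (real N * pi)\<^sup>2 / (real N * pi) ^ p) * (F / L2_norm (fourier q (coeffs_on low a)))
      + L2_norm (fourier q (coeffs_on low E1_coeff)) / L2_norm (fourier q u_coeff)"
proof -
  define U A where "U = L2_norm (fourier q u_coeff)" and "A = L2_norm (fourier q (coeffs_on low a))"
  define X Z where "X = F / (symb_gap * (real N * pi) ^ (p - q))" and "Z = c * (2 * F / (real N * pi) ^ p)"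
  have U: "0 < U" unfolding U_def by (rule u_norm_pos[OF nz q(1)])
  have A: "0 < A" unfolding A_def by (rule low_norm_pos[OF nz])
  have Np: "0 < real N * pi" using N_pos by simp
  have AU: "A \<le> symb_gap * U" unfolding A_def U_def by (rule low_f_norm_le[OF q(1)])
  then have inv: "1 / U \<le> symb_gap / A" using A U by (simp add: field_simps)
  have X0: "0 \<le> X" and Z0: "0 \<le> Z" using F c symb_gap_pos by (auto simp: X_def Z_def)
  have "L2_norm (fourier q err_coeff) \<le> X + (L2_norm (fourier q (coeffs_on low E1_coeff)) + Z)"
    using err_norm_triangle[OF q(1)] high_u_norm_le[OF q B F] alias_err_norm_le[OF p B F c]
    unfolding X_def Z_def by linarith
  then have "L2_norm (fourier q err_coeff) / U \<le> (X + (L2_norm (fourier q (coeffs_on low E1_coeff)) + Z)) / U"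
    using U by (intro divide_right_mono) auto
  also have "\<dots> = X * (1 / U) + Z * (1 / U) + L2_norm (fourier q (coeffs_on low E1_coeff)) / U"
    by (simp add: add_divide_distrib)
  also have "\<dots> \<le> X * (symb_gap / A) + Z * (symb_gap / A) + L2_norm (fourier q (coeffs_on low E1_coeff)) / U"
    using inv X0 Z0 by (intro add_mono mult_left_mono) auto
  also have "\<dots> \<le> X * (symb_gap / A) + Z * ((real N * pi)\<^sup>2 / A) + L2_norm (fourier q (coeffs_on low E1_coeff)) / U"
    using A Z0 by (intro add_mono order_refl mult_left_mono divide_right_mono) (auto simp: symb_gap_def)
  also have "X * (symb_gap / A) = 1 / (real N * pi) ^ (p - q) * (F / A)"
    using symb_gap_pos by (simp add: X_def)
  also have "Z * ((real N * pi)\<^sup>2 / A) = 2 * c * (real N * pi)\<^sup>2 / (real N * pi) ^ p * (F / A)"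
    by (simp add: Z_def)
  finally show ?thesis by (simp only: U_def A_def distrib_right)
qed

lemma E1_coeff_eq: "m \<in> low \<Longrightarrow> \<bar>E1_coeff m\<bar> = (real m * pi)\<^sup>2 * rel_symb_err (real m * pi) * \<bar>u_coeff m\<bar>"
proof -
  assume m: "m \<in> low"
  define l lh x where "l = symb k (real m * pi)" and "lh = symb_h k N (real m * pi)" and "x = real m * pi"
  have nz: "l \<noteq> 0" "lh \<noteq> 0" "x \<noteq> 0" using symb_nonzero[of m] symb_h_nonzero[OF m] m by (auto simp: l_def lh_def x_def)
  have "E1_coeff m = - (x\<^sup>2 * ((l - lh) / (x\<^sup>2 * lh)) * (a m / l))"
    using nz unfolding E1_coeff_def l_def[symmetric] lh_def[symmetric] by (simp add: field_simps)
  then have "\<bar>E1_coeff m\<bar> = x\<^sup>2 * \<bar>(l - lh) / (x\<^sup>2 * lh)\<bar> * \<bar>a m / l\<bar>"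
    by (simp only: abs_minus_cancel abs_mult) simp
  then show ?thesis by (simp only: rel_symb_err_def u_coeff_def l_def lh_def x_def)
qed

lemma E1_term_eq: "m \<in> low \<Longrightarrow>
  ((real m * pi) ^ q * E1_coeff m)\<^sup>2 = (rel_symb_err (real m * pi))\<^sup>2 * ((real m * pi) ^ (q + 2) * u_coeff m)\<^sup>2"
proof -
  assume m: "m \<in> low"
  have "((real m * pi) ^ q * E1_coeff m)\<^sup>2 = ((real m * pi) ^ q * \<bar>E1_coeff m\<bar>)\<^sup>2"
    by (simp add: power_mult_distrib)
  also have "\<dots> = (rel_symb_err (real m * pi) * ((real m * pi) ^ (q + 2) * \<bar>u_coeff m\<bar>))\<^sup>2"
    unfolding E1_coeff_eq[OF m] by (simp only: power_add mult_ac)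
  finally show ?thesis by (simp add: power_mult_distrib)
qed

lemma rel_symb_err_nonneg: "0 \<le> rel_symb_err \<xi>"
  by (simp add: rel_symb_err_def)

lemma C_rel_nonneg: "0 \<le> C_rel k N"
  using rel_symb_err_le_C_rel[of 1] rel_symb_err_nonneg[of "real 1 * pi"] N_ge by (auto intro: order_trans)

lemma E1_norm_le:
  "L2_norm (fourier q (coeffs_on low E1_coeff)) \<le> L2_norm (fourier (q + 2) (coeffs_on low u_coeff)) * C_rel k N"
proof (rule power2_le_imp_le)
  have "(L2_norm (fourier q (coeffs_on low E1_coeff)))\<^sup>2 = (\<Sum>m\<in>low. ((real m * pi) ^ q * E1_coeff m)\<^sup>2) / 2"
    by (rule fourier_finite_norm[OF finite_low])
  also have "\<dots> \<le> (\<Sum>m\<in>low. (C_rel k N)\<^sup>2 * ((real m * pi) ^ (q + 2) * u_coeff m)\<^sup>2) / 2"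
    using rel_symb_err_le_C_rel rel_symb_err_nonneg
    by (intro divide_right_mono sum_mono) (auto simp: E1_term_eq intro!: mult_right_mono power_mono)
  also have "\<dots> = (C_rel k N)\<^sup>2 * ((\<Sum>m\<in>low. ((real m * pi) ^ (q + 2) * u_coeff m)\<^sup>2) / 2)"
    by (simp only: sum_distrib_left times_divide_eq_right)
  also have "\<dots> = (C_rel k N)\<^sup>2 * (L2_norm (fourier (q + 2) (coeffs_on low u_coeff)))\<^sup>2"
    by (simp only: fourier_finite_norm[OF finite_low])
  finally show "(L2_norm (fourier q (coeffs_on low E1_coeff)))\<^sup>2 \<le> (L2_norm (fourier (q + 2) (coeffs_on low u_coeff)) * C_rel k N)\<^sup>2"
    by (simp add: power_mult_distrib mult.commute)
qed (use C_rel_nonneg in simp)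

text \<open>If the maximum \<open>C_rel\<close> is attained at the only low frequency present, no term
  loses anything in \<open>E1_norm_le\<close>.\<close>

lemma E1_norm_eq:
  assumes "C_rel k N = rel_symb_err (real m0 * pi)" "\<And>m. m \<in> low \<Longrightarrow> m \<noteq> m0 \<Longrightarrow> a m = 0"
  shows "L2_norm (fourier q (coeffs_on low E1_coeff)) = L2_norm (fourier (q + 2) (coeffs_on low u_coeff)) * C_rel k N"
proof (rule power2_eq_imp_eq)
  have "((real m * pi) ^ q * E1_coeff m)\<^sup>2 = (C_rel k N)\<^sup>2 * ((real m * pi) ^ (q + 2) * u_coeff m)\<^sup>2" if "m \<in> low" for m
    using E1_term_eq[OF that, of q] assms that
    by (cases "m = m0") (auto simp: E1_coeff_def u_coeff_def)
  then show "(L2_norm (fourier q (coeffs_on low E1_coeff)))\<^sup>2 = (L2_norm (fourier (q + 2) (coeffs_on low u_coeff)) * C_rel k N)\<^sup>2"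
    unfolding power_mult_distrib fourier_finite_norm[OF finite_low]
    by (simp add: sum_distrib_left[symmetric] mult.commute)
qed (use C_rel_nonneg in auto)

lemma err_coeff_no_high:
  assumes "\<And>n. N \<le> n \<Longrightarrow> a n = 0"
  shows "err_coeff = coeffs_on low E1_coeff"
proof
  fix m
  have "alias_coeff m = 0" for m
  proof (rule LIMSEQ_unique[OF alias_coeff_limit])
    have "(\<Sum>n\<in>{N..<L}. a n * alias_sign N m n) = 0" for L
      by (intro sum.neutral) (auto simp: assms)
    then show "(\<lambda>L. \<Sum>n\<in>{N..<L}. a n * alias_sign N m n) \<longlonglongrightarrow> 0" by simp
  qed
  then show "err_coeff m = coeffs_on low E1_coeff m"
    using assms by (auto simp: err_coeff_def coeffs_on_def alias_err_coeff_def u_coeff_def)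
qed

end

section \<open>Relative error estimates\<close>

context fd_problem begin

text \<open>On the unit interval the high part is \<open>f\<close> minus a finite sum of sines, so it
  has a \<open>p\<close>-th weak derivative, and Bessel's inequality applies to it.\<close>

lemma high_part_Bessel:
  assumes f: "sobolev0 p f"
  shows "(\<Sum>n\<in>{N..<L}. ((real n * pi) ^ p * a n)\<^sup>2) \<le> 2 * (seminorm p (high_part N f))\<^sup>2"
proof -
  obtain w where w: "weak_deriv p f w" using f by (auto simp: sobolev0_def sobolev_def)
  define w' where "w' x = w x - fourier p (coeffs_on low a) x" for x
  have "weak_deriv p (low_part N f) (fourier p (coeffs_on low a))"
    unfolding low_part_f using weak_deriv_chain[OF fourier_chain[OF low_conv]] .
  from weak_deriv_diff[OF w this] have "weak_deriv p (\<lambda>x. f x - low_part N f x) w'"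
    unfolding w'_def .
  then have w': "weak_deriv p (high_part N f) w'"
    using weak_deriv_cong[of "\<lambda>x. f x - low_part N f x" "high_part N f" p w'] f_split by simp
  have Lw: "L2_fun w" "L2_fun w'" using w w' by (auto simp: weak_deriv_def)
  have "(\<Sum>n\<in>{N..<L}. ((real n * pi) ^ p * a n)\<^sup>2) \<le> 2 * (L2_norm w')\<^sup>2"
  proof (rule Bessel_inequality[OF Lw(2), where q = p])
    fix n assume n: "n \<in> {N..<L}"
    have "(\<integral>x. w' x * trig p n x \<partial>I01) = (\<integral>x. w x * trig p n x \<partial>I01) - (\<integral>x. fourier p (coeffs_on low a) x * trig p n x \<partial>I01)"
      unfolding w'_def left_diff_distrib
      by (intro Bochner_Integration.integral_diff L2_mult_integrable Lw trig_L2 fourier_L2 low_conv)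
    then show "(real n * pi) ^ p * a n = 2 * (\<integral>x. w' x * trig p n x \<partial>I01)"
      using weak_deriv_trig_coeff[OF f w, of n] fourier_coeff[OF low_conv, of p a n] n
      by (simp add: sine_coeff_f coeffs_on_def)
  qed (use N_pos in auto)
  then show ?thesis by (simp add: seminorm_eq[OF w'])
qed

lemma seminorm_zero:
  assumes "\<And>x. 0 < x \<Longrightarrow> x < 1 \<Longrightarrow> v x = 0"
  shows "seminorm q v = 0"
proof -
  have "derivative_chain q (\<lambda>j x. 0)" by (simp add: derivative_chain_def)
  then have "seminorm q v = L2_norm (\<lambda>x. 0)" by (rule seminorm_chain) (use assms in auto)
  then show ?thesis by (simp add: L2_norm_I01)
qed

text \<open>A vanishing high part has vanishing seminorm, hence vanishing coefficients.\<close>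

lemma no_high_coeff:
  assumes f: "sobolev0 p f" and z: "\<forall>x\<in>{0<..<1}. high_part N f x = 0" and n: "N \<le> n"
  shows "a n = 0"
proof -
  have "(\<Sum>n\<in>{N..<Suc n}. ((real n * pi) ^ p * a n)\<^sup>2) \<le> 0"
    using high_part_Bessel[OF f, of "Suc n"] seminorm_zero[of "high_part N f" p] z by simp
  moreover have "((real n * pi) ^ p * a n)\<^sup>2 \<le> (\<Sum>n\<in>{N..<Suc n}. ((real n * pi) ^ p * a n)\<^sup>2)"
    using n by (intro member_le_sum[of n]) auto
  ultimately have "((real n * pi) ^ p * a n)\<^sup>2 \<le> 0" by linarith
  then have "(real n * pi) ^ p * a n = 0" by simp
  then show ?thesis using n N_pos by simp
qed

lemma norms_u:
  assumes u: "helmholtz_sol k f u"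
  shows "L2_norm u = L2_norm (fourier 0 u_coeff)"
    and "seminorm 1 u = L2_norm (fourier 1 u_coeff)"
    and "seminorm q (low_part N u) = L2_norm (fourier q (coeffs_on low u_coeff))"
proof -
  show "L2_norm u = L2_norm (fourier 0 u_coeff)"
    by (rule L2_norm_cong) (simp add: helmholtz_sol_series[OF u])
  show "seminorm 1 u = L2_norm (fourier 1 u_coeff)"
    by (rule fourier_seminorm[OF u_conv]) (simp_all add: helmholtz_sol_series[OF u])
  show "seminorm q (low_part N u) = L2_norm (fourier q (coeffs_on low u_coeff))"
    by (rule fourier_seminorm[OF low_conv]) (simp add: low_part_u[OF u])
qed

lemma norms_E1:
  "L2_norm (E1 k N f) = L2_norm (fourier 0 (coeffs_on low E1_coeff))"
  "seminorm 1 (E1 k N f) = L2_norm (fourier 1 (coeffs_on low E1_coeff))"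
  unfolding E1_series by (rule refl, rule fourier_seminorm[OF low_conv]) simp

lemma norms_low_f:
  "L2_norm (low_part N f) = L2_norm (fourier 0 (coeffs_on low a))"
  "seminorm 1 (low_part N f) = L2_norm (fourier 1 (coeffs_on low a))"
  unfolding low_part_f by (rule refl, rule fourier_seminorm[OF low_conv]) simp

lemma norms_err:
  assumes u: "helmholtz_sol k f u" and U: "fd_sol k f N U"
  shows "L2_norm (\<lambda>x. u x - sine_interp N U x) = L2_norm (fourier 0 err_coeff)"
    and "seminorm 1 (\<lambda>x. u x - sine_interp N U x) = L2_norm (fourier 1 err_coeff)"
proof -
  have s: "u x - sine_interp N U x = fourier 0 err_coeff x" if "0 < x" "x < 1" for x
    using error_series[OF u U that] by (simp add: err_coeff_def[abs_def])
  show "L2_norm (\<lambda>x. u x - sine_interp N U x) = L2_norm (fourier 0 err_coeff)"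
    by (rule L2_norm_cong) (rule s)
  show "seminorm 1 (\<lambda>x. u x - sine_interp N U x) = L2_norm (fourier 1 err_coeff)"
    by (rule fourier_seminorm[OF err_conv]) (use s in auto)
qed

lemma E1_relative_le:
  assumes u: "helmholtz_sol k f u"
  shows "L2_norm (E1 k N f) / L2_norm u
      \<le> k powi (- 2) * seminorm 2 (low_part N u) / L2_norm u * (k\<^sup>2 * C_rel k N)"
    and "seminorm 1 (E1 k N f) / seminorm 1 u
      \<le> k powi (- 3) * seminorm 3 (low_part N u) / (k powi (- 1) * seminorm 1 u) * (k\<^sup>2 * C_rel k N)"
proof -
  have k: "k \<noteq> 0" using k_ge by simp
  have 2: "k powi (- 2) * X / Y * (k\<^sup>2 * Z) = X * Z / Y" for X Y Z
    using k by (simp add: power_int_minus field_simps)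
  have 3: "k powi (- 3) * X / (k powi (- 1) * Y) * (k\<^sup>2 * Z) = X * Z / Y" for X Y Z
    using k by (simp add: power_int_minus field_simps power3_eq_cube power2_eq_square)
  show "L2_norm (E1 k N f) / L2_norm u
      \<le> k powi (- 2) * seminorm 2 (low_part N u) / L2_norm u * (k\<^sup>2 * C_rel k N)"
    unfolding 2 norms_E1 norms_u[OF u] using E1_norm_le[of 0] by (intro divide_right_mono) (auto simp: numeral_2_eq_2)
  show "seminorm 1 (E1 k N f) / seminorm 1 u
      \<le> k powi (- 3) * seminorm 3 (low_part N u) / (k powi (- 1) * seminorm 1 u) * (k\<^sup>2 * C_rel k N)"
    unfolding 3 norms_E1 norms_u[OF u] using E1_norm_le[of 1] by (intro divide_right_mono) (auto simp: numeral_3_eq_3)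
qed

lemma E1_relative_eq:
  assumes u: "helmholtz_sol k f u" and m0: "C_rel k N = rel_symb_err (real m0 * pi)" "\<And>m. m \<in> low \<Longrightarrow> m \<noteq> m0 \<Longrightarrow> a m = 0"
  shows "L2_norm (E1 k N f) / L2_norm u
      = k powi (- 2) * seminorm 2 (low_part N u) / L2_norm u * (k\<^sup>2 * C_rel k N)"
    and "seminorm 1 (E1 k N f) / seminorm 1 u
      = k powi (- 3) * seminorm 3 (low_part N u) / (k powi (- 1) * seminorm 1 u) * (k\<^sup>2 * C_rel k N)"
proof -
  have k: "k \<noteq> 0" using k_ge by simp
  have 2: "k powi (- 2) * X / Y * (k\<^sup>2 * Z) = X * Z / Y" for X Y Z
    using k by (simp add: power_int_minus field_simps)
  have 3: "k powi (- 3) * X / (k powi (- 1) * Y) * (k\<^sup>2 * Z) = X * Z / Y" for X Y Z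
    using k by (simp add: power_int_minus field_simps power3_eq_cube power2_eq_square)
  show "L2_norm (E1 k N f) / L2_norm u
      = k powi (- 2) * seminorm 2 (low_part N u) / L2_norm u * (k\<^sup>2 * C_rel k N)"
    unfolding 2 norms_E1 norms_u[OF u] using E1_norm_eq[OF m0, of 0] by (simp add: numeral_2_eq_2)
  show "seminorm 1 (E1 k N f) / seminorm 1 u
      = k powi (- 3) * seminorm 3 (low_part N u) / (k powi (- 1) * seminorm 1 u) * (k\<^sup>2 * C_rel k N)"
    unfolding 3 norms_E1 norms_u[OF u] using E1_norm_eq[OF m0, of 1] by (simp add: numeral_3_eq_3)
qed

text \<open>The multiplier $\xi^q/\lambda^h$ is bounded by $1/(\sigma k)$ for \<open>q = 0\<close>, as
  $|\lambda^h| \ge \sigma k$, and by $\pi/(2\sigma)$ for \<open>q = 1\<close>, as $|\lambda^h| \ge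
  \sigma s$ with the discrete frequency $s \ge 2\xi/\pi$.\<close>

lemma error_bounds:
  assumes f: "sobolev0 p f" and p: "2 \<le> p" and nz: "\<exists>x\<in>{0<..<1}. low_part N f x \<noteq> 0"
    and \<sigma>: "0 < \<sigma>" "\<And>m. m \<in> low \<Longrightarrow> \<sigma> \<le> sigma_h k N (real m * pi)"
    and u: "helmholtz_sol k f u" and U: "fd_sol k f N U"
  defines "err \<equiv> \<lambda>x. u x - sine_interp N U x"
  defines "R0 \<equiv> ((k * mesh N) ^ p / pi ^ p + 2 * k * (k * mesh N) ^ (p - 2) / (\<sigma> * pi ^ (p - 2)))
        * (k powi (- int p) * seminorm p (high_part N f) / L2_norm (low_part N f)) + L2_norm (E1 k N f) / L2_norm u"
    and "R1 \<equiv> ((k * mesh N) ^ (p - 1) / pi ^ (p - 1) + k * (k * mesh N) ^ (p - 2) / (\<sigma> * pi powi (int p - 3)))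
        * (k powi (- int p) * seminorm p (high_part N f) / (k powi (- 1) * seminorm 1 (low_part N f)))
        + seminorm 1 (E1 k N f) / seminorm 1 u"
  shows "L2_norm err / L2_norm u \<le> R0" "seminorm 1 err / seminorm 1 u \<le> R1"
    and "\<forall>x\<in>{0<..<1}. high_part N f x = 0 \<Longrightarrow> L2_norm err / L2_norm u = R0 \<and> seminorm 1 err / seminorm 1 u = R1"
proof -
  define F where "F = seminorm p (high_part N f)"
  have F: "0 \<le> F" by (simp add: F_def seminorm_def)
  note B = high_part_Bessel[OF f, folded F_def]
  have kp: "0 < k" using k_ge by simp
  have Np: "0 < real N" using N_pos by simp
  \<comment> \<open>The substitution turns the exponents \<open>p - 1\<close> and \<open>p - 2\<close> into sums, on which the power laws apply.\<close>
  obtain r where r: "p = r + 2" using p by (metis add.commute le_Suc_ex)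
  have symb: "\<bar>symb_h k N (real m * pi)\<bar> = sigma_h k N (real m * pi) * (k + disc_freq m)" if "m \<in> low" for m
    using disc_freq_pos[OF that] kp by (simp add: symb_h_eq sigma_h_eq abs_mult)
  have c0: "(real m * pi) ^ 0 \<le> 1 / (\<sigma> * k) * \<bar>symb_h k N (real m * pi)\<bar>" if m: "m \<in> low" for m
  proof -
    have "\<sigma> * k \<le> sigma_h k N (real m * pi) * (k + disc_freq m)"
      using \<sigma>(2)[OF m] \<sigma>(1) kp disc_freq_pos[OF m] by (intro mult_mono) auto
    then show ?thesis unfolding symb[OF m] using \<sigma>(1) kp by (simp add: field_simps)
  qed
  have c1: "(real m * pi) ^ 1 \<le> pi / (2 * \<sigma>) * \<bar>symb_h k N (real m * pi)\<bar>" if m: "m \<in> low" for m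
  proof -
    have "real m * pi = pi / (2 * \<sigma>) * (\<sigma> * (2 / pi * (real m * pi)))" using \<sigma>(1) by simp
    also have "\<dots> \<le> pi / (2 * \<sigma>) * (sigma_h k N (real m * pi) * (k + disc_freq m))"
      using \<sigma>(2)[OF m] \<sigma>(1) kp disc_freq_pos[OF m] disc_freq_ge_Jordan[OF m] by (intro mult_left_mono mult_mono) auto
    finally show ?thesis unfolding symb[OF m] by simp
  qed
  have A0: "((k * mesh N) ^ p / pi ^ p + 2 * k * (k * mesh N) ^ (p - 2) / (\<sigma> * pi ^ (p - 2))) * (k powi (- int p) * F / A)
    = (1 / (real N * pi) ^ (p - 0) + 2 * (1 / (\<sigma> * k)) * (real N * pi)\<^sup>2 / (real N * pi) ^ p) * (F / A)" for A
    unfolding r power_int_minus power_int_of_nat using kp Np \<sigma>(1)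
    by (simp add: power_mult_distrib power_divide power_add power2_eq_square divide_simps)
      (simp add: algebra_simps)
  have pw: "pi powi (int p - 3) = pi ^ p / pi ^ 3" by (simp add: power_int_diff)
  have A1: "((k * mesh N) ^ (p - 1) / pi ^ (p - 1) + k * (k * mesh N) ^ (p - 2) / (\<sigma> * pi powi (int p - 3)))
      * (k powi (- int p) * F / (k powi (- 1) * A))
    = (1 / (real N * pi) ^ (p - 1) + 2 * (pi / (2 * \<sigma>)) * (real N * pi)\<^sup>2 / (real N * pi) ^ p) * (F / A)" for A
    unfolding pw unfolding r power_int_minus power_int_of_nat using kp Np \<sigma>(1)
    by (simp add: power_mult_distrib power_divide power_add power2_eq_square power3_eq_cube divide_simps)
      (simp add: algebra_simps)
  have R0: "R0 = (1 / (real N * pi) ^ (p - 0) + 2 * (1 / (\<sigma> * k)) * (real N * pi)\<^sup>2 / (real N * pi) ^ p)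
      * (F / L2_norm (fourier 0 (coeffs_on low a))) + L2_norm (fourier 0 (coeffs_on low E1_coeff)) / L2_norm (fourier 0 u_coeff)"
    unfolding R0_def F_def[symmetric] A0 norms_low_f norms_E1 norms_u[OF u] ..
  have R1: "R1 = (1 / (real N * pi) ^ (p - 1) + 2 * (pi / (2 * \<sigma>)) * (real N * pi)\<^sup>2 / (real N * pi) ^ p)
      * (F / L2_norm (fourier 1 (coeffs_on low a))) + L2_norm (fourier 1 (coeffs_on low E1_coeff)) / L2_norm (fourier 1 u_coeff)"
    unfolding R1_def F_def[symmetric] A1 norms_low_f norms_E1 norms_u[OF u] ..
  show "L2_norm err / L2_norm u \<le> R0"
    unfolding err_def norms_err[OF u U] norms_u[OF u] R0
    by (rule relative_error_bound[OF nz _ _ _ B F]) (use c0 \<sigma>(1) kp p in auto)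
  show "seminorm 1 err / seminorm 1 u \<le> R1"
    unfolding err_def norms_err[OF u U] norms_u[OF u] R1
    by (rule relative_error_bound[OF nz _ _ _ B F]) (use c1 \<sigma>(1) kp p in auto)
  assume z: "\<forall>x\<in>{0<..<1}. high_part N f x = 0"
  have "F = 0" unfolding F_def by (rule seminorm_zero) (use z in auto)
  moreover have "err_coeff = coeffs_on low E1_coeff"
    by (rule err_coeff_no_high) (rule no_high_coeff[OF f z])
  ultimately show "L2_norm err / L2_norm u = R0 \<and> seminorm 1 err / seminorm 1 u = R1"
    unfolding err_def norms_err[OF u U] norms_u[OF u] R0 R1 by simp
qed

end

context fd_mesh begin

lemma sobolev0_fd_problem:
  assumes "sobolev0 p f" "1 \<le> p" "continuous_on {0<..<1} f"
  shows "fd_problem k N f (\<lambda>m. sine_coeff f (real m * pi))"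
proof unfold_locales
  show a: "abs_conv 0 (\<lambda>m. sine_coeff f (real m * pi))" by (rule sobolev0_abs_conv[OF assms(1,2)])
  have "L2_fun f" using assms(1) sobolev_L2 by (auto simp: sobolev0_def)
  then show "f x = fourier 0 (\<lambda>m. sine_coeff f (real m * pi)) x" if "0 < x" "x < 1" for x
    using sine_series_represents[OF _ assms(3) a that] by simp
qed

text \<open>All series have a single term here, and since $\kappa < N\pi$ there is no aliasing: the
  error is exactly $E_1^h$.\<close>

lemma single_frequency:
  assumes m0: "m0 \<in> {M, M + 1}" and C: "C_rel k N = rel_symb_err (real m0 * pi)"
  defines "\<kappa> \<equiv> real m0 * pi"
  defines "f \<equiv> \<lambda>x. 2 * sin (\<kappa> * x)"
  assumes u: "helmholtz_sol k f u" and U: "fd_sol k f N U"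
  defines "err \<equiv> \<lambda>x. u x - sine_interp N U x"
  shows "\<And>x. x \<in> {0..1} \<Longrightarrow> u x = f x / (k\<^sup>2 - \<kappa>\<^sup>2)"
    and "L2_norm u = L2_norm f / \<bar>k\<^sup>2 - \<kappa>\<^sup>2\<bar>"
    and "seminorm q u = seminorm q (low_part N u)"
    and "seminorm q (low_part N u) = L2_norm f * \<kappa> ^ q / \<bar>k\<^sup>2 - \<kappa>\<^sup>2\<bar>"
    and "L2_norm (E1 k N f) / L2_norm u
      = k powi (- 2) * seminorm 2 (low_part N u) / L2_norm u * (k\<^sup>2 * C_rel k N)"
    and "seminorm 1 (E1 k N f) / seminorm 1 u
      = k powi (- 3) * seminorm 3 (low_part N u) / (k powi (- 1) * seminorm 1 u) * (k\<^sup>2 * C_rel k N)"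
    and "L2_norm (E1 k N f) / L2_norm u = \<kappa>\<^sup>2 * C_rel k N"
    and "seminorm 1 (E1 k N f) / seminorm 1 u = \<kappa>\<^sup>2 * C_rel k N"
    and "L2_norm err / L2_norm u = \<kappa>\<^sup>2 * C_rel k N"
    and "seminorm 1 err / seminorm 1 u = \<kappa>\<^sup>2 * C_rel k N"
proof -
  define a where "a = coeffs_on {m0} (\<lambda>_. 2)"
  note mb = M_freq_bounds(1)[OF m0]
  have fin: "finite {m0}" "0 \<notin> {m0}" using mb by auto
  interpret fd_problem k N f a
  proof unfold_locales
    show "abs_conv 0 a" unfolding a_def by (rule abs_conv_finite[OF fin])
    show "f x = fourier 0 a x" for x
      by (simp add: a_def f_def \<kappa>_def fourier_finite trig_0)
  qed
  define \<Lambda> where "\<Lambda> = symb k \<kappa>"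
  have \<Lambda>: "\<Lambda> \<noteq> 0" "\<Lambda> = k\<^sup>2 - \<kappa>\<^sup>2" using symb_nonzero[of m0] by (auto simp: \<Lambda>_def \<kappa>_def symb_def)
  have \<kappa>: "0 < \<kappa>" using mb by (simp add: \<kappa>_def)
  have uc: "u_coeff = coeffs_on {m0} (\<lambda>_. 2 / \<Lambda>)"
    unfolding u_coeff_def by (rule ext) (auto simp: a_def coeffs_on_def \<Lambda>_def \<kappa>_def)
  have lowc: "coeffs_on low u_coeff = u_coeff"
    by (rule ext) (use mb in \<open>auto simp: uc coeffs_on_def\<close>)
  have conv: "abs_conv q u_coeff" for q unfolding uc by (rule abs_conv_finite[OF fin])
  have norm: "L2_norm (fourier q u_coeff) = sqrt 2 * \<kappa> ^ q / \<bar>\<Lambda>\<bar>" for q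
  proof (rule power2_eq_imp_eq)
    show "(L2_norm (fourier q u_coeff))\<^sup>2 = (sqrt 2 * \<kappa> ^ q / \<bar>\<Lambda>\<bar>)\<^sup>2"
      unfolding uc fourier_finite_norm[OF fin] by (simp add: \<kappa>_def power_mult_distrib power_divide)
  qed (use \<kappa> in auto)
  have "L2_norm f = L2_norm (fourier 0 a)" by (rule L2_norm_cong) (rule f_series)
  moreover have "L2_norm (fourier 0 a) = sqrt 2"
  proof (rule power2_eq_imp_eq)
    show "(L2_norm (fourier 0 a))\<^sup>2 = (sqrt 2)\<^sup>2" unfolding a_def fourier_finite_norm[OF fin] by simp
  qed auto
  ultimately have nf: "L2_norm f = sqrt 2" by simp
  have us: "u x = fourier 0 u_coeff x" if "0 \<le> x" "x \<le> 1" for x by (rule helmholtz_sol_series[OF u that])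
  have semi: "seminorm q u = sqrt 2 * \<kappa> ^ q / \<bar>\<Lambda>\<bar>" for q
    unfolding norm[symmetric] by (rule fourier_seminorm[OF conv]) (simp add: us)
  have lowsemi: "seminorm q (low_part N u) = sqrt 2 * \<kappa> ^ q / \<bar>\<Lambda>\<bar>" for q
    unfolding norms_u[OF u] lowc norm ..
  have L2u: "L2_norm u = sqrt 2 / \<bar>\<Lambda>\<bar>" unfolding norms_u[OF u] norm by simp
  show "u x = f x / (k\<^sup>2 - \<kappa>\<^sup>2)" if "x \<in> {0..1}" for x
  proof -
    have "u x = fourier 0 u_coeff x" using that by (intro us) auto
    then show ?thesis unfolding uc fourier_finite[OF fin(1)] by (simp add: trig_0 f_def \<kappa>_def[symmetric] \<Lambda>(2))
  qed
  show "L2_norm u = L2_norm f / \<bar>k\<^sup>2 - \<kappa>\<^sup>2\<bar>" unfolding L2u nf \<Lambda>(2) ..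
  show "seminorm q u = seminorm q (low_part N u)" unfolding semi lowsemi ..
  show "seminorm q (low_part N u) = L2_norm f * \<kappa> ^ q / \<bar>k\<^sup>2 - \<kappa>\<^sup>2\<bar>" unfolding lowsemi nf \<Lambda>(2) ..
  have a0: "a m = 0" if "m \<in> low" "m \<noteq> m0" for m using that by (simp add: a_def coeffs_on_def)
  show "L2_norm (E1 k N f) / L2_norm u
      = k powi (- 2) * seminorm 2 (low_part N u) / L2_norm u * (k\<^sup>2 * C_rel k N)"
    by (rule E1_relative_eq(1)[OF u C a0])
  show "seminorm 1 (E1 k N f) / seminorm 1 u
      = k powi (- 3) * seminorm 3 (low_part N u) / (k powi (- 1) * seminorm 1 u) * (k\<^sup>2 * C_rel k N)"
    by (rule E1_relative_eq(2)[OF u C a0])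
  have ratio: "L2_norm (fourier q (coeffs_on low E1_coeff)) / L2_norm (fourier q u_coeff) = \<kappa>\<^sup>2 * C_rel k N" for q
  proof -
    have "L2_norm (fourier q (coeffs_on low E1_coeff)) = L2_norm (fourier (q + 2) (coeffs_on low u_coeff)) * C_rel k N"
      by (rule E1_norm_eq[OF C a0])
    then show ?thesis unfolding lowc norm using \<kappa> \<Lambda>(1) by (simp add: power_add power2_eq_square)
  qed
  show E0: "L2_norm (E1 k N f) / L2_norm u = \<kappa>\<^sup>2 * C_rel k N"
    unfolding norms_E1 norms_u[OF u] by (rule ratio)
  show E1: "seminorm 1 (E1 k N f) / seminorm 1 u = \<kappa>\<^sup>2 * C_rel k N"
    unfolding norms_E1 norms_u[OF u] by (rule ratio)
  have "err_coeff = coeffs_on low E1_coeff"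
    by (rule err_coeff_no_high) (use mb in \<open>auto simp: a_def coeffs_on_def\<close>)
  then show "L2_norm err / L2_norm u = \<kappa>\<^sup>2 * C_rel k N" "seminorm 1 err / seminorm 1 u = \<kappa>\<^sup>2 * C_rel k N"
    unfolding err_def norms_err[OF u U] norms_u[OF u] by (simp_all only: ratio)
qed

end

section \<open>Mesh sequences\<close>

text \<open>The threshold is about \<open>18.88\<close>. The value \<open>16\<close> is convenient since
  $\frac{4\pi}{\pi-\sqrt{16-\pi^2}} \ge 16$ amounts to $\sqrt{16-\pi^2} \ge \frac34\pi$, i.e. to $\pi^2
  \le 10.24$.\<close>

lemma k_ge_16:
  assumes "k > 4 * pi / (pi - sqrt (16 - pi\<^sup>2))"
  shows "16 \<le> k"
proof -
  have p: "3 < pi" "pi \<le> 3.15" using pi_approx by auto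
  have "pi * pi \<le> 3.15 * 3.15" "3 * 3 \<le> pi * pi" using p by (intro mult_mono; simp)+
  then have p2: "pi\<^sup>2 \<le> 10" "9 \<le> pi\<^sup>2" by (auto simp: power2_eq_square)
  have "sqrt (16 - pi\<^sup>2) < pi" by (rule real_less_lsqrt) (use p p2 in auto)
  moreover have "3 / 4 * pi \<le> sqrt (16 - pi\<^sup>2)"
    by (rule real_le_rsqrt) (use p2 in \<open>simp add: power_mult_distrib power_divide\<close>)
  ultimately have "16 \<le> 4 * pi / (pi - sqrt (16 - pi\<^sup>2))" by (simp add: field_simps)
  then show ?thesis using assms by simp
qed

context fd_mesh begin

lemma scaled_C_rel_bounds:
  assumes "m0 \<in> {M, M + 1}"
  defines "\<kappa> \<equiv> real m0 * pi"
  shows "1 / 200 * (\<kappa>\<^sup>2 * k * (mesh N)\<^sup>2 / sigma_min k N) < \<kappa>\<^sup>2 * C_rel k N"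
    and "\<kappa>\<^sup>2 * C_rel k N < 1 * (\<kappa>\<^sup>2 * k * (mesh N)\<^sup>2 / sigma_min k N)"
    and "1 / 400 * (k ^ 3 * (mesh N)\<^sup>2 / sigma_min k N) < \<kappa>\<^sup>2 * C_rel k N"
    and "\<kappa>\<^sup>2 * C_rel k N < 4 * (k ^ 3 * (mesh N)\<^sup>2 / sigma_min k N)"
proof -
  define Q where "Q = k * (mesh N)\<^sup>2 / sigma_min k N"
  have Q: "0 < Q" using k_ge N_pos sigma_min_pos by (simp add: Q_def)
  have C: "1 / 200 * Q < C_rel k N" "C_rel k N < Q" using C_rel_bounds by (auto simp: Q_def)
  have \<kappa>: "4 / 5 * k \<le> \<kappa>" "\<kappa> \<le> 9 / 5 * k" using M_freq_bounds[OF assms(1)] by (auto simp: \<kappa>_def)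
  then have \<kappa>2: "(4 / 5 * k)\<^sup>2 \<le> \<kappa>\<^sup>2" "\<kappa>\<^sup>2 \<le> (9 / 5 * k)\<^sup>2" "0 < \<kappa>\<^sup>2"
    using k_ge by (auto intro!: power_mono)
  have k2: "0 < k\<^sup>2 * Q" using Q k_ge by simp
  have e1: "\<kappa>\<^sup>2 * k * (mesh N)\<^sup>2 / sigma_min k N = \<kappa>\<^sup>2 * Q" by (simp add: Q_def)
  have e2: "k ^ 3 * (mesh N)\<^sup>2 / sigma_min k N = k\<^sup>2 * Q" by (simp add: Q_def power3_eq_cube power2_eq_square)
  have l: "\<kappa>\<^sup>2 * (1 / 200 * Q) < \<kappa>\<^sup>2 * C_rel k N" using C \<kappa>2 by (intro mult_strict_left_mono) auto
  have r: "\<kappa>\<^sup>2 * C_rel k N < \<kappa>\<^sup>2 * Q" using C \<kappa>2 by (intro mult_strict_left_mono) auto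
  show "1 / 200 * (\<kappa>\<^sup>2 * k * (mesh N)\<^sup>2 / sigma_min k N) < \<kappa>\<^sup>2 * C_rel k N"
    unfolding e1 using l by simp
  show "\<kappa>\<^sup>2 * C_rel k N < 1 * (\<kappa>\<^sup>2 * k * (mesh N)\<^sup>2 / sigma_min k N)"
    unfolding e1 using r by simp
  have "(4 / 5 * k)\<^sup>2 * Q \<le> \<kappa>\<^sup>2 * Q" "\<kappa>\<^sup>2 * Q \<le> (9 / 5 * k)\<^sup>2 * Q"
    using \<kappa>2 Q by (intro mult_right_mono; simp)+
  moreover have "(4 / 5 * k)\<^sup>2 * Q = 16 / 25 * (k\<^sup>2 * Q)" "(9 / 5 * k)\<^sup>2 * Q = 81 / 25 * (k\<^sup>2 * Q)"
    by (simp_all add: power_mult_distrib power_divide)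
  ultimately show "1 / 400 * (k ^ 3 * (mesh N)\<^sup>2 / sigma_min k N) < \<kappa>\<^sup>2 * C_rel k N"
    and "\<kappa>\<^sup>2 * C_rel k N < 4 * (k ^ 3 * (mesh N)\<^sup>2 / sigma_min k N)"
    unfolding e2 using l r k2 by linarith+
qed

end

text \<open>The two infima exclude resonance: the one over multiples of $\pi$ for the boundary value
  problem, the one along the sequence for the scheme.\<close>

lemma fd_mesh_of_sequence:
  fixes Ns :: "nat \<Rightarrow> nat"
  assumes k: "k > 4 * pi / (pi - sqrt (16 - pi\<^sup>2))" "sigma_k k > 0"
    and h: "0 < k * mesh (Ns n) / 2" "k * mesh (Ns n) / 2 \<le> C" "C \<le> 3 / 4"
    and \<sigma>: "sigma_seq k Ns > 0"
  shows "fd_mesh k (Ns n)" "\<And>m. m \<in> {1..<Ns n} \<Longrightarrow> sigma_seq k Ns \<le> sigma_h k (Ns n) (real m * pi)"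
proof -
  show *: "sigma_seq k Ns \<le> sigma_h k (Ns n) (real m * pi)" if "m \<in> {1..<Ns n}" for m
  proof -
    have "(INF (n, \<xi>)\<in>(SIGMA n:UNIV. low_freqs (Ns n)). sigma_h k (Ns n) \<xi>)
        \<le> (case (n, real m * pi) of (n, \<xi>) \<Rightarrow> sigma_h k (Ns n) \<xi>)"
      by (rule cINF_lower) (use that in \<open>auto simp: low_freqs_def sigma_h_def intro!: bdd_belowI2[of _ 0]\<close>)
    then show ?thesis by (simp add: sigma_seq_def)
  qed
  show "fd_mesh k (Ns n)"
  proof
    show k16: "16 \<le> k" by (rule k_ge_16[OF k(1)])
    show "0 < Ns n" using h(1) by (cases "Ns n = 0") auto
    show "k / (real (Ns n) * 2) \<le> 3 / 4" by (rule order_trans[OF _ h(3)]) (use h(2) in simp)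
    show "sigma_h k (Ns n) (real m * pi) \<noteq> 0" if "m \<in> {1..<Ns n}" for m
      using *[OF that] \<sigma> by auto
    show "k \<noteq> real m * pi" for m
    proof
      assume e: "k = real m * pi"
      then have "1 \<le> m" using k16 by (cases m) auto
      then have "sigma_k k \<le> \<bar>k - real m * pi\<bar>"
        unfolding sigma_k_def by (intro cINF_lower) (auto intro!: bdd_belowI2[of _ 0])
      then show False using e k(2) by simp
    qed
  qed
qed

theorem theorem4:
  "\<exists>c C d D :: real. 0 < c \<and> 0 < C \<and> 0 < d \<and> 0 < D \<and>
    (\<forall>(k::real) (p::nat) (C\<^sub>\<mu>::real) (Ns :: nat \<Rightarrow> nat).
      k > 4 * pi / (pi - sqrt (16 - pi\<^sup>2)) \<and> sigma_k k > 0 \<and> p \<ge> 2 \<and>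
      (\<lambda>n. mesh (Ns n)) \<longlonglongrightarrow> 0 \<and>
      (\<forall>n. 0 < k * mesh (Ns n) / 2 \<and> k * mesh (Ns n) / 2 \<le> C\<^sub>\<mu>) \<and> C\<^sub>\<mu> \<le> 3 / 4 \<and>
      sigma_seq k Ns > 0
      \<longrightarrow>
      (\<forall>n. let N = Ns n; h = mesh N; \<sigma> = sigma_seq k Ns in
        (\<forall>f. sobolev0 p f \<and> continuous_on {0<..<1} f \<and> (\<exists>x\<in>{0<..<1}. low_part N f x \<noteq> 0) \<longrightarrow>
          (\<exists>!U. U \<in> extensional {0..N} \<and> fd_sol k f N U) \<and>
          (\<forall>u U. helmholtz_sol k f u \<and> fd_sol k f N U \<longrightarrow>
            (let err = (\<lambda>x. u x - sine_interp N U x);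
                 L0 = L2_norm err / L2_norm u;
                 R0 = ((k * h) ^ p / pi ^ p + 2 * k * (k * h) ^ (p - 2) / (\<sigma> * pi ^ (p - 2)))
                        * (k powi (- int p) * seminorm p (high_part N f) / L2_norm (low_part N f))
                      + L2_norm (E1 k N f) / L2_norm u;
                 L1 = seminorm 1 err / seminorm 1 u;
                 R1 = ((k * h) ^ (p - 1) / pi ^ (p - 1)
                         + k * (k * h) ^ (p - 2) / (\<sigma> * pi powi (int p - 3)))
                        * (k powi (- int p) * seminorm p (high_part N f)
                             / (k powi (- 1) * seminorm 1 (low_part N f)))
                      + seminorm 1 (E1 k N f) / seminorm 1 u
             in L0 \<le> R0 \<and> L1 \<le> R1 \<and>
                ((\<forall>x\<in>{0<..<1}. high_part N f x = 0) \<longrightarrow> L0 = R0 \<and> L1 = R1)) \<and>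
            L2_norm (E1 k N f) / L2_norm u
              \<le> k powi (- 2) * seminorm 2 (low_part N u) / L2_norm u * (k\<^sup>2 * C_rel k N) \<and>
            seminorm 1 (E1 k N f) / seminorm 1 u
              \<le> k powi (- 3) * seminorm 3 (low_part N u) / (k powi (- 1) * seminorm 1 u)
                  * (k\<^sup>2 * C_rel k N))) \<and>
        c * (k ^ 3 * h\<^sup>2 / sigma_min k N) < k\<^sup>2 * C_rel k N \<and>
        k\<^sup>2 * C_rel k N < C * (k ^ 3 * h\<^sup>2 / sigma_min k N) \<and>
        (\<exists>\<kappa>\<in>{k_minus k N, k_plus k N}.
          (\<forall>f u. sobolev0 p f \<and> continuous_on {0<..<1} f \<and>
              (\<exists>x\<in>{0<..<1}. low_part N f x \<noteq> 0) \<and> helmholtz_sol k f u \<and>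
              (\<forall>\<xi>\<in>low_freqs N - {\<kappa>}. sine_coeff f \<xi> = 0) \<longrightarrow>
            L2_norm (E1 k N f) / L2_norm u
              = k powi (- 2) * seminorm 2 (low_part N u) / L2_norm u * (k\<^sup>2 * C_rel k N) \<and>
            seminorm 1 (E1 k N f) / seminorm 1 u
              = k powi (- 3) * seminorm 3 (low_part N u) / (k powi (- 1) * seminorm 1 u)
                  * (k\<^sup>2 * C_rel k N)) \<and>
          (let f = (\<lambda>x. 2 * sin (\<kappa> * x)) in
            (\<exists>!U. U \<in> extensional {0..N} \<and> fd_sol k f N U) \<and>
            (\<forall>u U. helmholtz_sol k f u \<and> fd_sol k f N U \<longrightarrow>
              (\<forall>x\<in>{0..1}. u x = f x / (k\<^sup>2 - \<kappa>\<^sup>2)) \<and>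
              L2_norm u = L2_norm f / \<bar>k\<^sup>2 - \<kappa>\<^sup>2\<bar> \<and>
              (\<forall>q. seminorm q u = seminorm q (low_part N u) \<and>
                   seminorm q (low_part N u) = L2_norm f * \<kappa> ^ q / \<bar>k\<^sup>2 - \<kappa>\<^sup>2\<bar>) \<and>
              L2_norm (E1 k N f) / L2_norm u
                = k powi (- 2) * seminorm 2 (low_part N u) / L2_norm u * (k\<^sup>2 * C_rel k N) \<and>
              seminorm 1 (E1 k N f) / seminorm 1 u
                = k powi (- 3) * seminorm 3 (low_part N u) / (k powi (- 1) * seminorm 1 u)
                    * (k\<^sup>2 * C_rel k N) \<and>
              L2_norm (E1 k N f) / L2_norm u = seminorm 1 (E1 k N f) / seminorm 1 u \<and>
              seminorm 1 (E1 k N f) / seminorm 1 u = \<kappa>\<^sup>2 * C_rel k N \<and>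
              c * (\<kappa>\<^sup>2 * k * h\<^sup>2 / sigma_min k N) < \<kappa>\<^sup>2 * C_rel k N \<and>
              \<kappa>\<^sup>2 * C_rel k N < C * (\<kappa>\<^sup>2 * k * h\<^sup>2 / sigma_min k N) \<and>
              (let err = (\<lambda>x. u x - sine_interp N U x) in
                \<forall>r\<in>{L2_norm err / L2_norm u, seminorm 1 err / seminorm 1 u}.
                  d * (k ^ 3 * h\<^sup>2 / sigma_min k N) < r \<and>
                  r < D * (k ^ 3 * h\<^sup>2 / sigma_min k N)))))))"
\<comment> \<open>The constants $c_{rel} = 1/200$ and $\tilde C_{rel} = 1$ come from \<open>C_rel_bounds\<close>; the last two absorb $\frac{16}{25} k^2 \le \kappa^2 \le \frac{81}{25} k^2$.\<close>
proof (rule exI[of _ "1 / 200"], rule exI[of _ 1], rule exI[of _ "1 / 400"], rule exI[of _ 4],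
    intro conjI allI impI, goal_cases)
  case (5 k p C\<^sub>\<mu> Ns n)
  then have k: "k > 4 * pi / (pi - sqrt (16 - pi\<^sup>2))" "sigma_k k > 0" and p: "2 \<le> p"
    and h: "0 < k * mesh (Ns n) / 2" "k * mesh (Ns n) / 2 \<le> C\<^sub>\<mu>" "C\<^sub>\<mu> \<le> 3 / 4"
    and \<sigma>: "sigma_seq k Ns > 0" by auto
  define N \<sigma>' where "N = Ns n" and "\<sigma>' = sigma_seq k Ns"
  interpret fd_mesh k N unfolding N_def by (rule fd_mesh_of_sequence(1)[OF k h \<sigma>])
  have \<sigma>': "0 < \<sigma>'" "\<And>m. m \<in> {1..<N} \<Longrightarrow> \<sigma>' \<le> sigma_h k N (real m * pi)"
    using \<sigma> fd_mesh_of_sequence(2)[OF k h \<sigma>] by (auto simp: N_def \<sigma>'_def)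
  show ?case
    unfolding Let_def N_def[symmetric] \<sigma>'_def[symmetric]
  proof (intro conjI, goal_cases)
    case 1
    show ?case
    proof (intro allI impI, goal_cases)
      case (1 f)
      then have f: "sobolev0 p f" and nz: "\<exists>x\<in>{0<..<1}. low_part N f x \<noteq> 0" by auto
      interpret fd_problem k N f "\<lambda>m. sine_coeff f (real m * pi)"
        using 1 p by (intro sobolev0_fd_problem[of p]) auto
      note err = error_bounds[OF f p nz \<sigma>'(1)]
      show ?case
      proof ((intro conjI allI impI fd_sol_ex1; elim conjE), goal_cases)
        case (1 u U)
        show ?case by (rule err(1)[OF _ 1]) (rule \<sigma>'(2))
      next
        case (2 u U)
        show ?case by (rule err(2)[OF _ 2]) (rule \<sigma>'(2))
      next
        case (3 u U)
        show ?case by (rule conjunct1[OF err(3)[OF _ 3(2,3,1)]]) (rule \<sigma>'(2))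
      next
        case (4 u U)
        show ?case by (rule conjunct2[OF err(3)[OF _ 4(2,3,1)]]) (rule \<sigma>'(2))
      next
        case (5 u U)
        then show ?case by (intro E1_relative_le)
      next
        case (6 u U)
        then show ?case by (intro E1_relative_le)
      qed
    qed
  next
    case 2
    have "k\<^sup>2 * (1 / 200 * (k * (mesh N)\<^sup>2 / sigma_min k N)) < k\<^sup>2 * C_rel k N"
      using C_rel_bounds(1) k_ge by (intro mult_strict_left_mono) auto
    then show ?case by (simp add: power3_eq_cube power2_eq_square)
  next
    case 3
    have "k\<^sup>2 * C_rel k N < k\<^sup>2 * (k * (mesh N)\<^sup>2 / sigma_min k N)"
      using C_rel_bounds(2) k_ge by (intro mult_strict_left_mono) auto
    then show ?case by (simp add: power3_eq_cube power2_eq_square)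
  next
    case 4
    obtain m0 where m0: "m0 \<in> {M, M + 1}" and C: "C_rel k N = rel_symb_err (real m0 * pi)"
      by (rule C_rel_attained)
    show ?case
    proof (rule bexI[of _ "real m0 * pi"], intro conjI, goal_cases)
      case 1
      show ?case
      proof (intro allI impI, goal_cases)
        case (1 f u)
        then have f: "sobolev0 p f" "continuous_on {0<..<1} f" and u: "helmholtz_sol k f u"
          and z: "\<forall>\<xi>\<in>low_freqs N - {real m0 * pi}. sine_coeff f \<xi> = 0" by auto
        interpret fd_problem k N f "\<lambda>m. sine_coeff f (real m * pi)"
          using f p by (intro sobolev0_fd_problem[of p]) auto
        have "sine_coeff f (real m * pi) = 0" if "m \<in> low" "m \<noteq> m0" for m
          using z that by (auto simp: low_freqs_def)
        then show ?case using E1_relative_eq[OF u C] by blast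
      qed
    next
      case 2
      show ?case by (rule fd_sol_ex1)
    next
      case 3
      show ?case
      proof (intro allI impI, elim conjE, goal_cases)
        case (1 u U)
        note sf = single_frequency[OF m0 C 1]
        note cb = scaled_C_rel_bounds[OF m0]
        show ?case
        proof (intro conjI, goal_cases)
          case 6
          then show ?case unfolding sf(7,8) ..
        next
          case 10
          then show ?case using cb(3,4) unfolding sf(9,10) by simp
        qed (use sf cb in blast)+
      qed
    next
      case 4
      show ?case using m0 by (auto simp: k_minus_eq k_plus_eq)
    qed
  qed
qed simp_all

end
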